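(* Let $f\in L^2(\Omega)$, let $u\in H_0^1(\Omega)$ be the weak solution of $-\Delta u=f$ in $\Omega$, $u=0$ on $\partial\Omega$, and let $u_h\in V_h^0$ be its piecewise linear finite element approximation on the triangulation $\mathcal{T}_h$, i.e. $(\nabla u_h,\nabla v_h)=(f,v_h)$ for all $v_h\in V_h^0$. For $K\in\mathcal{T}_h$ define $$\eta_K^2=\|G(\nabla u_h)-\nabla u_h\|_{0,K}^2+h_K^2\|f+\nabla\cdot G(\nabla u_h)\|_{0,K}^2 .$$ Then there exists a positive constant $C$, independent of the mesh size, such that for every $K\in\mathcal{T}_h$ $$\eta_K^2\leq C\left(\|\nabla u-\nabla u_h\|_{0,\omega_K}^2+\sum_{K'\in\mathcal{T}_h,\,K'\subset\omega_K}h_{K'}^2\|f-\bar f\|_{0,K'}^2\right),$$ where $\bar f$ is the piecewise constant function on $\mathcal{T}_h$ whose value on each element is the mean value of $f$ over that element.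
   Context: $\Omega\subset\mathbb{R}^d$ ($d=2,3$) is an open bounded polyhedral domain. $\|\cdot\|_{0,D}$ is the $L^2(D)$ norm and $(\cdot,\cdot)$ the $L^2(\Omega)$ inner product. $\mathcal{T}_h$ is a conforming simplicial triangulation of $\Omega$; $h_K$ is the diameter of $K\in\mathcal{T}_h$; the triangulation is regular: $h_K\le\kappa\rho_K$ for all $K\in\mathcal{T}_h$, where $\rho_K$ is the diameter of the largest ball inscribed in $K$ and $\kappa>0$ is a fixed constant (on which $C$ may depend). $\omega_K=\bigcup\{K'\in\mathcal{T}_h:\bar K'\cap\bar K\ne\emptyset\}$. $V_h=\{v\in H^1(\Omega): v|_K\in P_1(K)\ \forall K\in\mathcal{T}_h\}$ and $V_h^0=\{v\in V_h: v=0\text{ on }\partial\Omega\}$. Gradient recovery: let $\mathcal{N}$ be the set of mesh nodes (vertices of $\mathcal{T}_h$), $\phi_z\in V_h$ the nodal (Lagrange) basis function at $z\in\mathcal{N}$, and $\omega_z=\mathrm{supp}(\phi_z)$, which is the union of the elements $K_z^1,\dots,K_z^{J_z}$ having $z$ as a vertex. The recovered gradient is the continuous piecewise linear vector field $$G(\nabla u_h)=\sum_{z\in\mathcal{N}}G(\nabla u_h)(z)\,\phi_z\in (V_h)^d,\qquad G(\nabla u_h)(z)=\sum_{j=1}^{J_z}\alpha_z^j(\nabla u_h)|_{K_z^j},$$ where the weights satisfy $0\le\alpha_z^j\le1$ and $\sum_{j=1}^{J_z}\alpha_z^j=1$.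
   Formalization: The polyhedral domain is additionally assumed to be the interior of a finite union of polytopes and locally connected at each boundary point (true for Lipschitz domains); for pinched or slit domains the estimate can fail. *)

theory Defs
  imports "HOL-Analysis.Analysis"
begin

section \<open>Lebesgue and Sobolev spaces\<close>

text \<open>Functions are concrete representatives. All integrals are with respect to the completed
  Lebesgue measure, so values on null sets (in particular on the boundary of \<open>\<Omega>\<close> and on the
  boundaries of mesh elements) affect neither measurability nor integrals.\<close>

definition L2 :: "'a::euclidean_space set \<Rightarrow> ('a \<Rightarrow> 'b::euclidean_space) set" where
  "L2 D = {f. f \<in> borel_measurable (lebesgue_on D) \<and>
              integrable (lebesgue_on D) (\<lambda>x. (norm (f x))\<^sup>2)}"

definition L2norm :: "'a::euclidean_space set \<Rightarrow> ('a \<Rightarrow> 'b::euclidean_space) \<Rightarrow> real" where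
  "L2norm D f = sqrt (LINT x|lebesgue_on D. (norm (f x))\<^sup>2)"

text \<open>The classical pointwise gradient and divergence. They are also applied to continuous
  piecewise affine functions, which are differentiable in the interior of every element, that is,
  almost everywhere.\<close>

definition grad :: "('a::euclidean_space \<Rightarrow> real) \<Rightarrow> 'a \<Rightarrow> 'a" where
  "grad v x = (THE D. GDERIV v x :> D)"

definition divergence :: "('a::euclidean_space \<Rightarrow> 'a) \<Rightarrow> 'a \<Rightarrow> real" where
  "divergence F x = (\<Sum>b\<in>Basis. grad (\<lambda>y. F y \<bullet> b) x \<bullet> b)"

primrec C_k :: "nat \<Rightarrow> ('a::euclidean_space \<Rightarrow> real) \<Rightarrow> bool" where
  "C_k 0 f \<longleftrightarrow> continuous_on UNIV f"
| "C_k (Suc k) f \<longleftrightarrow>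
     (\<exists>g. (\<forall>x. GDERIV f x :> g x) \<and> (\<forall>b\<in>Basis. C_k k (\<lambda>x. g x \<bullet> b)))"

definition test_functions :: "'a::euclidean_space set \<Rightarrow> ('a \<Rightarrow> real) set" where
  "test_functions \<Omega> =
     {\<phi>. (\<forall>k. C_k k \<phi>) \<and> compact (closure {x. \<phi> x \<noteq> 0}) \<and> closure {x. \<phi> x \<noteq> 0} \<subseteq> \<Omega>}"

text \<open>The weak gradient is a relation, since it is determined only almost everywhere.\<close>

definition has_weak_gradient ::
    "'a::euclidean_space set \<Rightarrow> ('a \<Rightarrow> real) \<Rightarrow> ('a \<Rightarrow> 'a) \<Rightarrow> bool" where
  "has_weak_gradient \<Omega> u g \<longleftrightarrow> u \<in> L2 \<Omega> \<and> g \<in> L2 \<Omega> \<and>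
     (\<forall>\<phi>\<in>test_functions \<Omega>.
        (LINT x|lebesgue_on \<Omega>. u x *\<^sub>R grad \<phi> x) = - (LINT x|lebesgue_on \<Omega>. \<phi> x *\<^sub>R g x))"

definition H1 :: "'a::euclidean_space set \<Rightarrow> ('a \<Rightarrow> real) set" where
  "H1 \<Omega> = {u. \<exists>g. has_weak_gradient \<Omega> u g}"

text \<open>The closure of the test functions in the \<open>H1\<close> norm.\<close>

definition H10 :: "'a::euclidean_space set \<Rightarrow> ('a \<Rightarrow> real) set" where
  "H10 \<Omega> = {u. \<exists>g. has_weak_gradient \<Omega> u g \<and>
     (\<exists>\<phi>. (\<forall>n. \<phi> n \<in> test_functions \<Omega>) \<and>
          (\<lambda>n. L2norm \<Omega> (\<lambda>x. u x - \<phi> n x)) \<longlonglongrightarrow> 0 \<and>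
          (\<lambda>n. L2norm \<Omega> (\<lambda>x. g x - grad (\<phi> n) x)) \<longlonglongrightarrow> 0)}"

definition poisson_weak_solution ::
    "'a::euclidean_space set \<Rightarrow> ('a \<Rightarrow> real) \<Rightarrow> ('a \<Rightarrow> real) \<Rightarrow> bool" where
  "poisson_weak_solution \<Omega> f u \<longleftrightarrow> u \<in> H10 \<Omega> \<and>
     (\<forall>gu v gv. has_weak_gradient \<Omega> u gu \<and> v \<in> H10 \<Omega> \<and> has_weak_gradient \<Omega> v gv \<longrightarrow>
        (LINT x|lebesgue_on \<Omega>. gu x \<bullet> gv x) = (LINT x|lebesgue_on \<Omega>. f x * v x))"


section \<open>Domains and meshes\<close>

text \<open>Taking the interior of a finite union of polytopes rules out slits and isolated boundary
  points. The last conjunct rules out pinched domains, where several parts of \<open>\<Omega>\<close> meet at a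
  boundary point or edge without being connected near it; it holds for every Lipschitz domain.\<close>

definition polyhedral_domain :: "'a::euclidean_space set \<Rightarrow> bool" where
  "polyhedral_domain \<Omega> \<longleftrightarrow> open \<Omega> \<and> bounded \<Omega> \<and> connected \<Omega> \<and> \<Omega> \<noteq> {} \<and>
     (\<exists>\<P>. finite \<P> \<and> (\<forall>P\<in>\<P>. polytope P) \<and> \<Omega> = interior (\<Union>\<P>)) \<and>
     (\<forall>x\<in>frontier \<Omega>. \<forall>U. open U \<and> x \<in> U \<longrightarrow>
        (\<exists>V. open V \<and> x \<in> V \<and> V \<subseteq> U \<and> connected (V \<inter> \<Omega>)))"

text \<open>Elements are closed simplices of full dimension. That two of them meet in a common,
  possibly empty, face is part of \<^const>\<open>triangulation\<close>.\<close>

definition conforming_mesh :: "'a::euclidean_space set \<Rightarrow> 'a set set \<Rightarrow> bool" where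
  "conforming_mesh \<Omega> \<T> \<longleftrightarrow>
     triangulation \<T> \<and> (\<forall>K\<in>\<T>. int DIM('a) simplex K) \<and> \<Union>\<T> = closure \<Omega>"

definition inball_diameter :: "'a::euclidean_space set \<Rightarrow> real" where
  "inball_diameter K = Sup {2 * r |r. 0 \<le> r \<and> (\<exists>x. cball x r \<subseteq> K)}"

definition shape_regular :: "real \<Rightarrow> 'a::euclidean_space set set \<Rightarrow> bool" where
  "shape_regular \<kappa> \<T> \<longleftrightarrow> (\<forall>K\<in>\<T>. diameter K \<le> \<kappa> * inball_diameter K)"

definition patch :: "'a set set \<Rightarrow> 'a set \<Rightarrow> 'a set" where
  "patch \<T> K = \<Union>{K'\<in>\<T>. K' \<inter> K \<noteq> {}}"

definition nodes :: "'a::euclidean_space set set \<Rightarrow> 'a set" where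
  "nodes \<T> = {z. \<exists>K\<in>\<T>. z extreme_point_of K}"

definition elements_at :: "'a::euclidean_space set set \<Rightarrow> 'a \<Rightarrow> 'a set set" where
  "elements_at \<T> z = {K\<in>\<T>. z extreme_point_of K}"


section \<open>Finite elements and gradient recovery\<close>

text \<open>Since elements are closed, members of \<open>Vh\<close> are continuous representatives on the closure
  of \<open>\<Omega>\<close>, and their boundary values are pointwise values.\<close>

definition Vh :: "'a::euclidean_space set \<Rightarrow> 'a set set \<Rightarrow> ('a \<Rightarrow> real) set" where
  "Vh \<Omega> \<T> = {v \<in> H1 \<Omega>. \<forall>K\<in>\<T>. \<exists>a c. \<forall>x\<in>K. v x = a \<bullet> x + c}"

definition Vh0 :: "'a::euclidean_space set \<Rightarrow> 'a set set \<Rightarrow> ('a \<Rightarrow> real) set" where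
  "Vh0 \<Omega> \<T> = {v \<in> Vh \<Omega> \<T>. \<forall>x\<in>frontier \<Omega>. v x = 0}"

definition galerkin_solution ::
    "'a::euclidean_space set \<Rightarrow> 'a set set \<Rightarrow> ('a \<Rightarrow> real) \<Rightarrow> ('a \<Rightarrow> real) \<Rightarrow> bool" where
  "galerkin_solution \<Omega> \<T> f uh \<longleftrightarrow> uh \<in> Vh0 \<Omega> \<T> \<and>
     (\<forall>vh\<in>Vh0 \<Omega> \<T>.
        (LINT x|lebesgue_on \<Omega>. grad uh x \<bullet> grad vh x) = (LINT x|lebesgue_on \<Omega>. f x * vh x))"

text \<open>These conditions determine each \<open>\<phi> z\<close> on the closure of \<open>\<Omega>\<close>.\<close>

definition nodal_basis ::
    "'a::euclidean_space set \<Rightarrow> 'a set set \<Rightarrow> ('a \<Rightarrow> 'a \<Rightarrow> real) \<Rightarrow> bool" where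
  "nodal_basis \<Omega> \<T> \<phi> \<longleftrightarrow>
     (\<forall>z\<in>nodes \<T>. \<phi> z \<in> Vh \<Omega> \<T> \<and> (\<forall>y\<in>nodes \<T>. \<phi> z y = (if y = z then 1 else 0)))"

text \<open>The constant value on \<open>K\<close> of the gradient of a function that is affine on \<open>K\<close>.\<close>

definition elem_grad :: "('a::euclidean_space \<Rightarrow> real) \<Rightarrow> 'a set \<Rightarrow> 'a" where
  "elem_grad v K = (THE g. \<forall>x\<in>interior K. GDERIV v x :> g)"

definition recovery_weights ::
    "'a::euclidean_space set set \<Rightarrow> ('a \<Rightarrow> 'a set \<Rightarrow> real) \<Rightarrow> bool" where
  "recovery_weights \<T> \<alpha> \<longleftrightarrow>
     (\<forall>z\<in>nodes \<T>. (\<forall>K\<in>elements_at \<T> z. 0 \<le> \<alpha> z K \<and> \<alpha> z K \<le> 1) \<and>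
                   (\<Sum>K\<in>elements_at \<T> z. \<alpha> z K) = 1)"

definition recovered_gradient ::
    "'a::euclidean_space set set \<Rightarrow> ('a \<Rightarrow> 'a \<Rightarrow> real) \<Rightarrow> ('a \<Rightarrow> 'a set \<Rightarrow> real) \<Rightarrow>
     ('a \<Rightarrow> real) \<Rightarrow> 'a \<Rightarrow> 'a" where
  "recovered_gradient \<T> \<phi> \<alpha> v x =
     (\<Sum>z\<in>nodes \<T>. \<phi> z x *\<^sub>R (\<Sum>K\<in>elements_at \<T> z. \<alpha> z K *\<^sub>R elem_grad v K))"

text \<open>The square of the local error estimator, for the recovered field \<open>G\<close>.\<close>

definition eta_sq ::
    "('a::euclidean_space \<Rightarrow> real) \<Rightarrow> ('a \<Rightarrow> 'a) \<Rightarrow> ('a \<Rightarrow> real) \<Rightarrow> 'a set \<Rightarrow> real" where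
  "eta_sq f G uh K =
     (L2norm K (\<lambda>x. G x - grad uh x))\<^sup>2 +
     (diameter K)\<^sup>2 * (L2norm K (\<lambda>x. f x + divergence G x))\<^sup>2"

definition elem_mean :: "('a::euclidean_space \<Rightarrow> real) \<Rightarrow> 'a set \<Rightarrow> real" where
  "elem_mean f K = (LINT x|lebesgue_on K. f x) / measure lebesgue K"

end

theory Submission
  imports Defs
begin

text \<open>Testing the weak equation with a smooth bump supported in a ball inside an element \<open>K\<close>
  bounds the mean of \<open>f\<close>, hence \<open>h\<^sub>K \<parallel>f\<parallel>\<close>, by the error and the oscillation. Testing with a bump
  centred on a common facet of \<open>K\<close> and \<open>K'\<close> bounds the jump of \<open>\<nabla>u\<^sub>h\<close>, which is normal to the facet because \<open>u\<^sub>h\<close>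
  is continuous. Any two elements at a node \<open>z\<close> are joined by a
  chain of elements at \<open>z\<close> with consecutive ones sharing a facet, since \<open>\<Omega>\<close> is connected near \<open>z\<close> and
  sets of codimension two do not separate. Shape regularity bounds the chain length and makes the
  diameters along it comparable. Hence \<open>G(\<nabla>u\<^sub>h)(z)\<close>, a convex combination of gradients at \<open>z\<close>, differs
  from \<open>\<nabla>u\<^sub>h\<close> on \<open>K\<close> by what the error controls, and an inverse estimate handles the divergence.\<close>

section \<open>Smooth bump functions\<close>

text \<open>Smooth bumps on balls take the place of polynomial bubbles: as soon as the closed ball
  lies in \<open>\<Omega>\<close>, the bump is itself a test function, so no density argument, trace
  or surface integral enters. On such a ball \<open>grad uh\<close> has one value, or two values
  separated by a hyperplane through the centre. A constant vector integrates to zero against the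
  gradient of the bump. Hence one value leaves only the error, and two values leave the jump times
  an integral over half a ball, which has a definite sign.

  The obstacle sits at boundary nodes. A bump needs elements on both sides of a facet, so gradients
  can be compared only across interior facets, while the weights may put all their mass on any
  element at the node. At a pinch point two elements could share a node without being linked by such
  facets; the local connectedness demanded in \<open>polyhedral_domain\<close> excludes this.

  All balls have radii comparable to element diameters, so every constant is an explicit expression
  in \<open>\<kappa>\<close> and the dimension.\<close>

definition theta :: "nat \<Rightarrow> real \<Rightarrow> real" where
  "theta n t = (if t \<le> 0 then 0 else exp (- (1 / t)) / t ^ n)"

lemma theta_nonneg: "0 \<le> theta n t"
  by (simp add: theta_def)

lemma theta_eq_0: "t \<le> 0 \<Longrightarrow> theta n t = 0"
  by (simp add: theta_def)

lemma exp_ge_power_div_fact: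
  fixes x :: real
  assumes "0 \<le> x"
  shows "x ^ m / fact m \<le> exp x"
proof -
  have "(\<Sum>k\<in>{m}. x ^ k /\<^sub>R fact k) \<le> (\<Sum>k. x ^ k /\<^sub>R fact k)"
    using summable_exp[of x] assms by (intro sum_le_suminf) auto
  then show ?thesis by (simp add: exp_def divide_inverse mult.commute)
qed

text \<open>The exponential series dominates each of its terms, here the one of degree
  \<open>n + m\<close>. The free exponent has two uses: \<open>m = 0\<close> gives boundedness and
  \<open>m = 2\<close> the vanishing derivative at the origin.\<close>

lemma theta_le:
  assumes "0 \<le> t"
  shows "theta n t \<le> fact (n + m) * t ^ m"
proof (cases "t = 0")
  case False
  with assms have t: "t > 0" by simp
  have "(1 / t) ^ (n + m) / fact (n + m) \<le> exp (1 / t)"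
    using exp_ge_power_div_fact[of "1 / t" "n + m"] t by simp
  then have "1 \<le> exp (1 / t) * (fact (n + m) * t ^ (n + m))"
    using t by (simp add: field_simps power_one_over)
  then have "exp (- (1 / t)) \<le> fact (n + m) * t ^ (n + m)"
    by (simp add: exp_minus field_simps)
  then have "exp (- (1 / t)) / t ^ n \<le> fact (n + m) * t ^ (n + m) / t ^ n"
    using t by (simp add: divide_right_mono)
  also have "\<dots> = fact (n + m) * t ^ m"
    using t by (simp add: power_add)
  finally show ?thesis using t by (simp add: theta_def)
qed (simp add: theta_eq_0)

lemma theta_le_fact: "t \<le> 1 \<Longrightarrow> theta n t \<le> fact n"
  using theta_le[of t n 0] by (cases "t \<le> 0") (simp_all add: theta_eq_0)

text \<open>The index \<open>n\<close> exists for this closure: differentiation stays inside the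
  family, at the origin too.\<close>

lemma DERIV_theta: "DERIV (theta n) t :> theta (n + 2) t - of_nat n * theta (n + 1) t"
proof -
  consider "t < 0" | "t = 0" | "t > 0" by linarith
  then show ?thesis
  proof cases
    case 1
    have "DERIV (\<lambda>_. 0) t :> 0" by simp
    then have "DERIV (theta n) t :> 0"
      by (rule has_field_derivative_transform_within_open[of _ _ _ "{..<0}"])
         (use 1 in \<open>auto simp: theta_eq_0\<close>)
    then show ?thesis using 1 by (simp add: theta_eq_0)
  next
    case 2
    have "((\<lambda>h. theta n h / h) \<longlongrightarrow> 0) (at 0)"
    proof (rule Lim_null_comparison)
      have "norm (theta n h / h) \<le> fact (n + 2) * \<bar>h\<bar>" for h
      proof (cases "h > 0")
        case True
        then show ?thesis
          using theta_le[of h n 2] theta_nonneg[of n h] by (simp add: field_simps power2_eq_square)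
      next
        case False
        then have "theta n h = 0" by (simp add: theta_eq_0)
        then show ?thesis by (metis abs_ge_zero div_0 fact_ge_zero mult_nonneg_nonneg norm_zero)
      qed
      then show "\<forall>\<^sub>F h in at 0. norm (theta n h / h) \<le> fact (n + 2) * \<bar>h\<bar>"
        by simp
      show "((\<lambda>h::real. fact (n + 2) * \<bar>h\<bar>) \<longlongrightarrow> 0) (at 0)"
        by (auto intro!: tendsto_eq_intros)
    qed
    then show ?thesis using 2 by (simp add: DERIV_def theta_eq_0)
  next
    case 3
    have "DERIV (\<lambda>t. exp (- (1 / t)) / t ^ n) t :>
        (exp (- (1 / t)) * (1 / t\<^sup>2) * t ^ n - exp (- (1 / t)) * (of_nat n * t ^ (n - 1))) / (t ^ n * t ^ n)"
      using 3 by (auto intro!: derivative_eq_intros simp: power2_eq_square)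
    also have "(exp (- (1 / t)) * (1 / t\<^sup>2) * t ^ n - exp (- (1 / t)) * (of_nat n * t ^ (n - 1))) / (t ^ n * t ^ n)
       = theta (n + 2) t - of_nat n * theta (n + 1) t"
      using 3 by (cases n) (simp_all add: theta_def field_simps power2_eq_square)
    finally show ?thesis
      by (rule has_field_derivative_transform_within_open[of _ _ _ "{0<..}"])
         (use 3 in \<open>auto simp: theta_def\<close>)
  qed
qed

section \<open>Pointwise gradients and smoothness\<close>

lemma GDERIV_unique: "GDERIV f x :> D \<Longrightarrow> GDERIV f x :> E \<Longrightarrow> D = E"
  unfolding gderiv_def
  by (drule (1) has_derivative_unique) (metis inner_commute vector_eq_ldot)

lemma grad_eqI: "GDERIV f x :> D \<Longrightarrow> grad f x = D"
  unfolding grad_def by (rule the_equality) (auto dest: GDERIV_unique)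

lemma GDERIV_affine: "GDERIV (\<lambda>x. a \<bullet> x + c) x :> a"
  unfolding gderiv_def by (auto intro!: derivative_eq_intros simp: inner_commute)

lemma GDERIV_transform_open:
  assumes "GDERIV f x :> D" "open S" "x \<in> S" "\<And>y. y \<in> S \<Longrightarrow> f y = g y"
  shows "GDERIV g x :> D"
  using assms unfolding gderiv_def by (rule has_derivative_transform_within_open)

lemma GDERIV_continuous: "(\<And>x. GDERIV f x :> g x) \<Longrightarrow> continuous_on UNIV f"
  unfolding gderiv_def
  by (meson UNIV_I continuous_at_imp_continuous_on has_derivative_continuous)

text \<open>Membership in \<open>S\<close> passes on to the partial derivatives, so induction on the
  order works without any formula for higher derivatives.\<close>

lemma C_k_coinduct:
  assumes "\<And>f. S f \<Longrightarrow> \<exists>g. (\<forall>x. GDERIV f x :> g x) \<and> (\<forall>b\<in>Basis. S (\<lambda>x. g x \<bullet> b))"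
    and "S f"
  shows "C_k k f"
  using assms(2)
proof (induction k arbitrary: f)
  case 0
  then show ?case using assms(1) GDERIV_continuous by fastforce
next
  case (Suc k)
  then show ?case using assms(1)[OF Suc.prems] by auto
qed

text \<open>A class of functions that contains the bump and all partial derivatives of its members.\<close>

inductive bump_algebra :: "'a::euclidean_space \<Rightarrow> real \<Rightarrow> ('a \<Rightarrow> real) \<Rightarrow> bool"
  for x0 R where
  "bump_algebra x0 R (\<lambda>_. c)"
| "bump_algebra x0 R (\<lambda>x. (x - x0) \<bullet> b)"
| "bump_algebra x0 R (\<lambda>x. theta n (1 - (norm (x - x0))\<^sup>2 / R\<^sup>2))"
| "bump_algebra x0 R f \<Longrightarrow> bump_algebra x0 R g \<Longrightarrow> bump_algebra x0 R (\<lambda>x. f x + g x)"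
| "bump_algebra x0 R f \<Longrightarrow> bump_algebra x0 R g \<Longrightarrow> bump_algebra x0 R (\<lambda>x. f x * g x)"

lemma GDERIV_theta_comp:
  fixes x0 :: "'a::euclidean_space"
  shows "GDERIV (\<lambda>x. theta n (1 - (norm (x - x0))\<^sup>2 / R\<^sup>2)) x :>
   (theta (n + 2) (1 - (norm (x - x0))\<^sup>2 / R\<^sup>2) - of_nat n * theta (n + 1) (1 - (norm (x - x0))\<^sup>2 / R\<^sup>2))
     *\<^sub>R ((- 2 / R\<^sup>2) *\<^sub>R (x - x0))"
proof -
  have "GDERIV (\<lambda>x. 1 - (norm (x - x0))\<^sup>2 / R\<^sup>2) x :> (- 2 / R\<^sup>2) *\<^sub>R (x - x0)"
    unfolding gderiv_def power2_norm_eq_inner divide_inverse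
    by (auto intro!: derivative_eq_intros simp: inner_commute algebra_simps)
  from GDERIV_DERIV_compose[OF this DERIV_theta] show ?thesis .
qed

lemma bump_algebra_GDERIV:
  assumes "bump_algebra x0 R f"
  shows "\<exists>g. (\<forall>x. GDERIV f x :> g x) \<and> (\<forall>b\<in>Basis. bump_algebra x0 R (\<lambda>x. g x \<bullet> b))"
  using assms
proof induction
  case (1 c)
  then show ?case
    by (intro exI[of _ "\<lambda>_. 0"]) (simp add: GDERIV_const bump_algebra.intros)
next
  case (2 b)
  have "GDERIV (\<lambda>x. (x - x0) \<bullet> b) x :> b" for x
    unfolding gderiv_def by (auto intro!: derivative_eq_intros)
  then show ?case
    by (intro exI[of _ "\<lambda>_. b"]) (simp add: bump_algebra.intros)
next
  case (3 n)
  let ?s = "\<lambda>x. 1 - (norm (x - x0))\<^sup>2 / R\<^sup>2"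
  have "bump_algebra x0 R (\<lambda>x. ((theta (n + 2) (?s x) - of_nat n * theta (n + 1) (?s x))
     *\<^sub>R ((- 2 / R\<^sup>2) *\<^sub>R (x - x0))) \<bullet> b)" for b
  proof -
    have "bump_algebra x0 R (\<lambda>x. (theta (n + 2) (?s x) + (- of_nat n) * theta (n + 1) (?s x))
       * ((- 2 / R\<^sup>2) * ((x - x0) \<bullet> b)))"
      by (intro bump_algebra.intros)
    moreover have "((theta (n + 2) (?s x) - of_nat n * theta (n + 1) (?s x))
        *\<^sub>R ((- 2 / R\<^sup>2) *\<^sub>R (x - x0))) \<bullet> b
      = (theta (n + 2) (?s x) + (- of_nat n) * theta (n + 1) (?s x)) * ((- 2 / R\<^sup>2) * ((x - x0) \<bullet> b))" for x
      by simp
    ultimately show ?thesis by presburger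
  qed
  then show ?case
    using GDERIV_theta_comp[of n x0 R]
    by (intro exI[of _ "\<lambda>x. (theta (n + 2) (?s x) - of_nat n * theta (n + 1) (?s x))
     *\<^sub>R ((- 2 / R\<^sup>2) *\<^sub>R (x - x0))"]) blast
next
  case (4 f g)
  then obtain f' g' where
    *: "\<forall>x. GDERIV f x :> f' x" "\<forall>b\<in>Basis. bump_algebra x0 R (\<lambda>x. f' x \<bullet> b)"
    "\<forall>x. GDERIV g x :> g' x" "\<forall>b\<in>Basis. bump_algebra x0 R (\<lambda>x. g' x \<bullet> b)"
    by blast
  have "\<forall>x. GDERIV (\<lambda>x. f x + g x) x :> f' x + g' x"
    using * by (simp add: GDERIV_add)
  moreover have "\<forall>b\<in>Basis. bump_algebra x0 R (\<lambda>x. (f' x + g' x) \<bullet> b)"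
    using * by (auto simp: inner_add_left intro!: bump_algebra.intros)
  ultimately show ?case by (intro exI[of _ "\<lambda>x. f' x + g' x"]) blast
next
  case (5 f g)
  then obtain f' g' where
    *: "\<forall>x. GDERIV f x :> f' x" "\<forall>b\<in>Basis. bump_algebra x0 R (\<lambda>x. f' x \<bullet> b)"
    "\<forall>x. GDERIV g x :> g' x" "\<forall>b\<in>Basis. bump_algebra x0 R (\<lambda>x. g' x \<bullet> b)"
    by blast
  have "\<forall>x. GDERIV (\<lambda>x. f x * g x) x :> f x *\<^sub>R g' x + g x *\<^sub>R f' x"
    using * by (simp add: GDERIV_mult)
  moreover have "\<forall>b\<in>Basis. bump_algebra x0 R (\<lambda>x. (f x *\<^sub>R g' x + g x *\<^sub>R f' x) \<bullet> b)"
    using * 5 by (auto simp: inner_add_left intro!: bump_algebra.intros)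
  ultimately show ?case by (intro exI[of _ "\<lambda>x. f x *\<^sub>R g' x + g x *\<^sub>R f' x"]) blast
qed

text \<open>The standard mollifier profile exp(-1/(1 - r^2)), where r is the distance to the centre
  relative to \<open>R\<close>; the square keeps it smooth at the centre.\<close>

definition bump :: "'a::euclidean_space \<Rightarrow> real \<Rightarrow> 'a \<Rightarrow> real" where
  "bump x0 R x = theta 0 (1 - (norm (x - x0))\<^sup>2 / R\<^sup>2)"

text \<open>In this form the gradient is visibly a nonpositive multiple of \<open>x - x0\<close>,
  which fixes the sign of its normal component on a half ball.\<close>

definition bump_grad :: "'a::euclidean_space \<Rightarrow> real \<Rightarrow> 'a \<Rightarrow> 'a" where
  "bump_grad x0 R x = (- 2 / R\<^sup>2 * theta 2 (1 - (norm (x - x0))\<^sup>2 / R\<^sup>2)) *\<^sub>R (x - x0)"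

lemma C_k_bump: "C_k k (bump x0 R)"
proof (rule C_k_coinduct[where S = "bump_algebra x0 R"])
  show "bump_algebra x0 R (bump x0 R)"
    unfolding bump_def by (rule bump_algebra.intros)
qed (rule bump_algebra_GDERIV)

lemma GDERIV_bump: "GDERIV (bump x0 R) x :> bump_grad x0 R x"
  using GDERIV_theta_comp[of 0 x0 R x] unfolding bump_def bump_grad_def
  by (simp add: mult.commute numeral_2_eq_2)

lemma grad_bump: "grad (bump x0 R) = bump_grad x0 R"
  using GDERIV_bump by (intro ext grad_eqI)

lemma bump_outside: 
  assumes "R > 0" "x \<notin> ball x0 R"
  shows "bump x0 R x = 0" "bump_grad x0 R x = 0"
proof -
  have "R\<^sup>2 \<le> (norm (x - x0))\<^sup>2"
    using assms by (intro power_mono) (auto simp: dist_norm norm_minus_commute)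
  then have "1 - (norm (x - x0))\<^sup>2 / R\<^sup>2 \<le> 0"
    using assms by (simp add: field_simps)
  then show "bump x0 R x = 0" "bump_grad x0 R x = 0"
    by (simp_all add: bump_def bump_grad_def theta_eq_0)
qed

lemma bump_test_function:
  assumes "R > 0" "cball x0 R \<subseteq> \<Omega>"
  shows "bump x0 R \<in> test_functions \<Omega>"
proof -
  have "closure {x. bump x0 R x \<noteq> 0} \<subseteq> cball x0 R"
    using bump_outside[OF \<open>R > 0\<close>] by (intro closure_minimal) force+
  then show ?thesis
    using assms(2) C_k_bump unfolding test_functions_def
    by (auto intro: bounded_subset simp: compact_eq_bounded_closed)
qed

lemma bump_nonneg: "0 \<le> bump x0 R x"
  by (simp add: bump_def theta_nonneg)

lemma bump_le_1: "bump x0 R x \<le> 1"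
  using theta_le_fact[of "1 - (norm (x - x0))\<^sup>2 / R\<^sup>2" 0] by (simp add: bump_def)

text \<open>Inside the ball \<open>theta 2\<close> is at most 2! = 2 and
  \<open>norm (x - x0)\<close> at most \<open>R\<close>, so the prefactor 2/R^2 leaves 4/R.\<close>

lemma norm_bump_grad_le:
  assumes "R > 0"
  shows "norm (bump_grad x0 R x) \<le> 4 / R"
proof (cases "x \<in> ball x0 R")
  case True
  then have *: "norm (x - x0) \<le> R" by (simp add: dist_norm norm_minus_commute)
  have "theta 2 (1 - (norm (x - x0))\<^sup>2 / R\<^sup>2) \<le> 2"
    using theta_le_fact[of _ 2] by simp
  then have "theta 2 (1 - (norm (x - x0))\<^sup>2 / R\<^sup>2) * norm (x - x0) \<le> 2 * R"
    using * assms by (intro mult_mono) auto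
  then have "2 / R\<^sup>2 * (theta 2 (1 - (norm (x - x0))\<^sup>2 / R\<^sup>2) * norm (x - x0)) \<le> 2 / R\<^sup>2 * (2 * R)"
    using assms by (intro mult_left_mono) auto
  then show ?thesis
    using assms by (simp add: bump_grad_def abs_mult theta_nonneg power2_eq_square)
next
  case False
  then have "bump_grad x0 R x = 0" by (rule bump_outside(2)[OF assms])
  then show ?thesis using assms by simp
qed

lemma continuous_on_bump: "continuous_on S (bump x0 R)"
  using GDERIV_continuous GDERIV_bump continuous_on_subset by blast

lemma C_k_1D:
  assumes "C_k 1 f"
  shows "GDERIV f x :> grad f x" "continuous_on UNIV (grad f)" "continuous_on UNIV f"
proof -
  obtain g where g: "\<forall>x. GDERIV f x :> g x" "\<forall>b\<in>Basis. continuous_on UNIV (\<lambda>x. g x \<bullet> b)"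
    using assms by auto
  then have "grad f = g" by (intro ext grad_eqI) blast
  with g show "GDERIV f x :> grad f x" "continuous_on UNIV (grad f)" "continuous_on UNIV f"
    by (auto intro: GDERIV_continuous continuous_on_componentwise[THEN iffD2])
qed

lemma continuous_on_bump_grad: "continuous_on S (bump_grad x0 R)"
  using C_k_1D(2)[OF C_k_bump, unfolded grad_bump] continuous_on_subset by blast

section \<open>Integration of compactly supported functions\<close>

lemma absolutely_integrable_compact_support:
  fixes f :: "'a::euclidean_space \<Rightarrow> 'b::euclidean_space"
  assumes "continuous_on UNIV f" "\<And>x. x \<notin> S \<Longrightarrow> f x = 0" "bounded S"
  shows "f absolutely_integrable_on UNIV"
proof -
  obtain a where a: "S \<subseteq> cbox (-a) a" using assms(3) bounded_subset_cbox_symmetric by blast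
  have "f absolutely_integrable_on cbox (-a) a"
    using assms(1) by (intro absolutely_integrable_continuous) (auto intro: continuous_on_subset)
  moreover have "{x \<in> cbox (-a) a - UNIV. f x \<noteq> 0} = {}" "{x \<in> UNIV - cbox (-a) a. f x \<noteq> 0} = {}"
    using assms(2) a by blast+
  ultimately show ?thesis
    by (subst (asm) absolutely_integrable_spike_set_eq[where T = UNIV]) (simp_all only: negligible_empty)
qed

lemma lborel_integral_translate:
  fixes F :: "'a::euclidean_space \<Rightarrow> real"
  assumes "F \<in> borel_measurable borel"
  shows "(\<integral>x. F (x + c) \<partial>lborel) = (\<integral>x. F x \<partial>lborel)"
proof -
  have "(\<integral>x. F x \<partial>lborel) = (\<integral>x. F x \<partial>distr lborel borel ((+) c))"
    by (simp only: lborel_distr_plus)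
  also have "\<dots> = (\<integral>x. F (c + x) \<partial>lborel)"
    using assms by (intro integral_distr) auto
  finally show ?thesis by (simp add: add.commute)
qed

lemma GDERIV_zero_outside:
  assumes "\<And>x. GDERIV F x :> g x" "\<And>x. x \<notin> S \<Longrightarrow> F x = 0" "closed S" "x \<notin> S"
  shows "g x = 0"
proof -
  have "GDERIV F x :> 0"
    by (rule GDERIV_transform_open[OF GDERIV_const[of 0], where S = "- S"]) (use assms in auto)
  then show ?thesis using GDERIV_unique assms(1) by blast
qed

text \<open>The integral of a difference quotient of \<open>F\<close> vanishes by translation invariance; dominated
  convergence passes to the derivative.\<close>

lemma integral_gradient_compact_support:
  fixes F :: "'a::euclidean_space \<Rightarrow> real"
  assumes der: "\<And>x. GDERIV F x :> g x" and cont: "continuous_on UNIV g"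
    and supp: "\<And>x. x \<notin> S \<Longrightarrow> F x = 0" and "bounded S"
  shows "g absolutely_integrable_on UNIV" "integral UNIV g = 0"
proof -
  obtain \<rho> where \<rho>: "\<rho> > 0" "S \<subseteq> cball 0 \<rho>"
    using \<open>bounded S\<close> by (meson bounded_subset_ballD ball_subset_cball order_trans)
  have F0: "F x = 0" if "x \<notin> cball 0 \<rho>" for x using supp that \<rho> by blast
  have g0: "g x = 0" if "x \<notin> cball 0 \<rho>" for x
    by (rule GDERIV_zero_outside[OF der F0 closed_cball that])
  show gi: "g absolutely_integrable_on UNIV"
    by (rule absolutely_integrable_compact_support[OF cont g0 bounded_cball])
  have contF: "continuous_on UNIV F" using GDERIV_continuous der by blast
  have "compact (g ` cball 0 \<rho>)"
    using cont by (intro compact_continuous_image) (auto intro: continuous_on_subset)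
  then obtain M where M: "\<forall>x\<in>cball 0 \<rho>. norm (g x) \<le> M" "M > 0"
    by (auto dest!: compact_imp_bounded simp: bounded_pos)
  have Mg: "norm (g x) \<le> M" for x
    using M g0 by (cases "x \<in> cball 0 \<rho>") auto
  have lip: "\<bar>F y - F x\<bar> \<le> M * norm (y - x)" for x y
  proof -
    have "norm (F y - F x) \<le> M * norm (y - x)"
    proof (rule differentiable_bound[of UNIV F "\<lambda>x h. h \<bullet> g x"])
      show "(F has_derivative (\<lambda>h. h \<bullet> g x)) (at x within UNIV)" for x
        using der unfolding gderiv_def by simp
      show "onorm (\<lambda>h. h \<bullet> g x) \<le> M" for x
      proof (rule onorm_le)
        fix h
        have "\<bar>h \<bullet> g x\<bar> \<le> norm h * norm (g x)" by (rule Cauchy_Schwarz_ineq2)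
        also have "\<dots> \<le> norm h * M" using Mg by (intro mult_left_mono) auto
        finally show "norm (h \<bullet> g x) \<le> M * norm h" by (simp add: mult.commute)
      qed
    qed auto
    then show ?thesis by simp
  qed
  have intF: "integrable lborel (\<lambda>x. F (x + c))" for c
  proof -
    have "continuous_on UNIV (\<lambda>x. F (x + c))"
      by (intro continuous_on_compose2[OF contF]) (auto intro!: continuous_intros)
    moreover have "F (x + c) = 0" if "x \<notin> cball 0 (\<rho> + norm c)" for x
      using norm_triangle_ineq4[of "x + c" c] that by (intro F0) auto
    ultimately have "(\<lambda>x. F (x + c)) absolutely_integrable_on UNIV"
      using absolutely_integrable_compact_support bounded_cball by blast
    moreover have "(\<lambda>x. F (x + c)) \<in> borel_measurable borel"
      using \<open>continuous_on UNIV (\<lambda>x. F (x + c))\<close> by (rule borel_measurable_continuous_onI)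
    ultimately show ?thesis
      by (simp add: set_integrable_def integrable_completion)
  qed
  have int0: "integral\<^sup>L lborel (\<lambda>x. g x \<bullet> e) = 0" if e: "e \<in> Basis" for e
  proof -
    define s where "s n x = (F (x + (1 / real (Suc n)) *\<^sub>R e) - F x) * real (Suc n)" for n x
    \<comment> \<open>The dominating function: \<open>M\<close> is a Lipschitz constant of
      \<open>F\<close>, and all shifts have length at most one, so radius \<open>\<rho> + 1\<close>
      covers the support of every difference quotient.\<close>
    define w where "w x = M * indicator (cball (0::'a) (\<rho> + 1)) x" for x
    have meas: "s n \<in> borel_measurable lborel" for n
      unfolding s_def using intF[of 0] intF by simp
    have "(\<lambda>n. integral\<^sup>L lborel (s n)) \<longlonglongrightarrow> integral\<^sup>L lborel (\<lambda>x. g x \<bullet> e)"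
    proof (rule integral_dominated_convergence[where w = w])
      show "(\<lambda>x. g x \<bullet> e) \<in> borel_measurable lborel"
        using cont by (auto intro!: borel_measurable_continuous_onI continuous_intros)
      show "integrable lborel w"
        unfolding w_def by (intro integrable_mult_right integrable_real_indicator) (use emeasure_lborel_cball_finite[of 0 "\<rho> + 1"] in \<open>simp_all add: less_top\<close>)
      show "AE x in lborel. (\<lambda>n. s n x) \<longlonglongrightarrow> g x \<bullet> e"
      proof (rule AE_I2)
        fix x
        have "((\<lambda>t. F (x + t *\<^sub>R e)) has_derivative (\<lambda>t. (t *\<^sub>R e) \<bullet> g x)) (at 0)"
        proof -
          have 1: "(F has_derivative (\<lambda>h. h \<bullet> g x)) (at (x + 0 *\<^sub>R e))"
            using der unfolding gderiv_def by simp
          have 2: "((\<lambda>t. x + t *\<^sub>R e) has_derivative (\<lambda>t. t *\<^sub>R e)) (at 0)"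
            by (auto intro!: derivative_eq_intros)
          show ?thesis
            using has_derivative_compose[OF 2 1] by simp
        qed
        then have "DERIV (\<lambda>t. F (x + t *\<^sub>R e)) 0 :> g x \<bullet> e"
          by (simp add: has_field_derivative_def inner_commute mult_commute_abs)
        then have "((\<lambda>t. (F (x + t *\<^sub>R e) - F x) / t) \<longlongrightarrow> g x \<bullet> e) (at 0)"
          by (simp add: DERIV_def)
        moreover have "filterlim (\<lambda>n. 1 / real (Suc n)) (at 0) sequentially"
          unfolding filterlim_at
          by (intro conjI LIMSEQ_Suc[OF lim_1_over_n] always_eventually) auto
        ultimately have "((\<lambda>n. (F (x + (1 / real (Suc n)) *\<^sub>R e) - F x) / (1 / real (Suc n)))
            \<longlonglongrightarrow> g x \<bullet> e)"
          by (rule filterlim_compose)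
        then show "(\<lambda>n. s n x) \<longlonglongrightarrow> g x \<bullet> e"
          by (simp add: s_def del: of_nat_Suc)
      qed
      show "AE x in lborel. norm (s n x) \<le> w x" for n
      proof (rule AE_I2)
        fix x
        have nn: "norm ((1 / real (Suc n)) *\<^sub>R e) = 1 / real (Suc n)"
          using e by simp
        show "norm (s n x) \<le> w x"
        proof (cases "x \<in> cball 0 (\<rho> + 1)")
          case True
          have "\<bar>F (x + (1 / real (Suc n)) *\<^sub>R e) - F x\<bar> \<le> M * (1 / real (Suc n))"
            using lip[of "x + (1 / real (Suc n)) *\<^sub>R e" x] nn by simp
          then have "\<bar>s n x\<bar> \<le> M"
            unfolding s_def abs_mult by (simp add: field_simps del: of_nat_Suc)
          with True show ?thesis by (simp add: w_def)
        next
          case False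
          then have "norm x > \<rho> + 1" by simp
          moreover have "norm x \<le> norm (x + (1 / real (Suc n)) *\<^sub>R e) + 1 / real (Suc n)"
            using norm_triangle_ineq4[of "x + (1 / real (Suc n)) *\<^sub>R e" "(1 / real (Suc n)) *\<^sub>R e"] nn
            by simp
          moreover have "1 / real (Suc n) \<le> 1" by simp
          ultimately have "norm (x + (1 / real (Suc n)) *\<^sub>R e) > \<rho>" "norm x > \<rho>"
            by linarith+
          then have "x + (1 / real (Suc n)) *\<^sub>R e \<notin> cball 0 \<rho>" "x \<notin> cball 0 \<rho>"
            by (simp_all del: of_nat_Suc)
          then have "s n x = 0" unfolding s_def by (simp add: F0)
          then show ?thesis using M(2) by (simp add: w_def)
        qed
      qed
    qed (rule meas)
    moreover have "integral\<^sup>L lborel (s n) = 0" for n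
      unfolding s_def using intF[of 0] intF[of "(1 / real (Suc n)) *\<^sub>R e"]
        lborel_integral_translate[of F "(1 / real (Suc n)) *\<^sub>R e"]
      by (simp add: borel_measurable_continuous_onI contF del: of_nat_Suc)
    ultimately show ?thesis by (simp add: LIMSEQ_const_iff)
  qed
  have gil: "integrable lborel g"
    using gi cont by (simp add: set_integrable_def integrable_completion borel_measurable_continuous_onI)
  have "integral UNIV g \<bullet> e = 0" if "e \<in> Basis" for e
    using int0[OF that] gil by (simp add: integral_lborel)
  then show "integral UNIV g = 0"
    by (metis euclidean_all_zero_iff)
qed

section \<open>Square integrable functions\<close>

text \<open>Trades Lebesgue integrability for gauge integrability, in which subsets, null sets and
  unions are handled below.\<close>

lemma L2_iff:
  assumes "D \<in> sets lebesgue"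
  shows "f \<in> L2 D \<longleftrightarrow> f \<in> borel_measurable (lebesgue_on D) \<and> (\<lambda>x. (norm (f x))\<^sup>2) integrable_on D"
proof
  assume "f \<in> L2 D"
  then show "f \<in> borel_measurable (lebesgue_on D) \<and> (\<lambda>x. (norm (f x))\<^sup>2) integrable_on D"
    using integrable_on_lebesgue_on assms by (auto simp: L2_def)
next
  assume *: "f \<in> borel_measurable (lebesgue_on D) \<and> (\<lambda>x. (norm (f x))\<^sup>2) integrable_on D"
  then have "(\<lambda>x. (norm (f x))\<^sup>2) absolutely_integrable_on D"
    by (intro nonnegative_absolutely_integrable_1) auto
  then show "f \<in> L2 D"
    using * absolutely_integrable_imp_integrable assms by (auto simp: L2_def)
qed

lemma L2norm_sq:
  assumes "f \<in> L2 D" "D \<in> sets lebesgue"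
  shows "(L2norm D f)\<^sup>2 = integral D (\<lambda>x. (norm (f x))\<^sup>2)"
proof -
  have "0 \<le> (LINT x|lebesgue_on D. (norm (f x))\<^sup>2)" by simp
  then show ?thesis
    using assms lebesgue_integral_eq_integral[of D "\<lambda>x. (norm (f x))\<^sup>2"]
    unfolding L2norm_def L2_def by (simp only: real_sqrt_pow2) simp
qed

lemma L2_subset:
  assumes "f \<in> L2 D" "E \<subseteq> D" "D \<in> sets lebesgue" "E \<in> sets lebesgue"
  shows "f \<in> L2 E"
proof -
  have "(\<lambda>x. (norm (f x))\<^sup>2) absolutely_integrable_on D"
    using assms L2_iff by (intro nonnegative_absolutely_integrable_1) auto
  then have "(\<lambda>x. (norm (f x))\<^sup>2) absolutely_integrable_on E"
    by (rule set_integrable_subset) (rule assms)+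
  then have "(\<lambda>x. (norm (f x))\<^sup>2) integrable_on E"
    by (rule absolutely_integrable_on_def[THEN iffD1, THEN conjunct1])
  moreover have "f \<in> borel_measurable (lebesgue_on E)"
    using assms(1,2) measurable_restrict_mono unfolding L2_def by blast
  ultimately show ?thesis
    using assms(4) by (simp only: L2_iff)
qed

lemma L2norm_mono:
  assumes "f \<in> L2 D" "E \<subseteq> D" "D \<in> sets lebesgue" "E \<in> sets lebesgue"
  shows "(L2norm E f)\<^sup>2 \<le> (L2norm D f)\<^sup>2"
  using assms L2_subset[OF assms] by (auto simp: L2norm_sq L2_iff intro!: integral_subset_le)

text \<open>\<open>grad uh\<close> is known only in the interiors of elements; through this lemma a
  constant vector can stand in for it on a whole element.\<close>

lemma L2_spike:
  assumes "f \<in> L2 D" "D \<in> sets lebesgue" "negligible N" "\<And>x. x \<in> D - N \<Longrightarrow> g x = f x"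
  shows "g \<in> L2 D" "L2norm D g = L2norm D f"
proof -
  have "g \<in> borel_measurable (lebesgue_on D)"
    using measurable_on_spike[of f D N g] assms(1)
    unfolding L2_iff[OF assms(2)] measurable_on_iff_borel_measurable[OF assms(2)]
    by (simp only: assms(3,4) simp_thms)
  moreover have "(\<lambda>x. (norm (g x))\<^sup>2) integrable_on D"
    by (rule integrable_spike[of "\<lambda>x. (norm (f x))\<^sup>2" D N])
      (use assms(1) in \<open>simp_all only: L2_iff[OF assms(2)] assms(3,4)\<close>)
  ultimately show g: "g \<in> L2 D" by (simp only: L2_iff[OF assms(2)])
  have "integral D (\<lambda>x. (norm (g x))\<^sup>2) = integral D (\<lambda>x. (norm (f x))\<^sup>2)"
    by (rule integral_spike[of N]) (simp_all only: assms(3,4))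
  then have "(L2norm D g)\<^sup>2 = (L2norm D f)\<^sup>2"
    by (simp only: L2norm_sq[OF g assms(2)] L2norm_sq[OF assms(1,2)])
  moreover have "L2norm D g \<ge> 0" "L2norm D f \<ge> 0" by (simp_all add: L2norm_def)
  ultimately show "L2norm D g = L2norm D f" by (simp add: power2_eq_iff_nonneg)
qed

lemma L2_spike_set:
  assumes "f \<in> L2 D" "D \<subseteq> E" "D \<in> sets lebesgue" "negligible (E - D)"
  shows "f \<in> L2 E" "(L2norm E f)\<^sup>2 = (L2norm D f)\<^sup>2"
proof -
  have E: "E \<in> sets lebesgue"
    using assms by (metis Un_Diff_cancel Un_absorb1 negligible_imp_sets sets.Un)
  have ns: "negligible {x \<in> D - E. P x}" "negligible {x \<in> E - D. P x}" for P
    using assms by (auto intro: negligible_subset)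
  have "f measurable_on D"
    using assms by (auto simp: L2_iff measurable_on_iff_borel_measurable)
  then have "f measurable_on E"
    by (rule measurable_on_spike_set) (use assms ns in \<open>auto intro: negligible_subset\<close>)
  moreover have "(\<lambda>x. (norm (f x))\<^sup>2) integrable_on E"
    using assms ns by (subst integrable_spike_set_eq[of E D]) (auto simp: L2_iff sup_commute intro: negligible_subset)
  ultimately show "f \<in> L2 E"
    using E by (simp add: L2_iff measurable_on_iff_borel_measurable)
  then show "(L2norm E f)\<^sup>2 = (L2norm D f)\<^sup>2"
    using assms E ns by (simp add: L2norm_sq integral_spike_set)
qed

lemma L2_const:
  assumes "D \<in> lmeasurable"
  shows "(\<lambda>x. c) \<in> L2 D"
  using assms by (auto simp: L2_iff fmeasurableD integrable_on_const)

lemma norm_add_sq_le: "(norm (a + b))\<^sup>2 \<le> 2 * (norm a)\<^sup>2 + 2 * (norm (b::'a::real_normed_vector))\<^sup>2"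
proof -
  have "(norm (a + b))\<^sup>2 \<le> (norm a + norm b)\<^sup>2"
    by (simp add: norm_triangle_ineq power_mono)
  also have "\<dots> \<le> 2 * (norm a)\<^sup>2 + 2 * (norm b)\<^sup>2"
    using sum_squares_bound[of "norm a" "norm b"] by (simp add: power2_sum)
  finally show ?thesis .
qed

lemma L2_add:
  assumes "f \<in> L2 D" "g \<in> L2 D" "D \<in> sets lebesgue"
  shows "(\<lambda>x. f x + g x) \<in> L2 D"
    "(L2norm D (\<lambda>x. f x + g x))\<^sup>2 \<le> 2 * (L2norm D f)\<^sup>2 + 2 * (L2norm D g)\<^sup>2"
proof -
  have m: "(\<lambda>x. f x + g x) \<in> borel_measurable (lebesgue_on D)"
    using assms by (auto simp: L2_def)
  have i: "(\<lambda>x. 2 * (norm (f x))\<^sup>2 + 2 * (norm (g x))\<^sup>2) integrable_on D"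
    using assms by (auto simp: L2_iff intro!: integrable_add integrable_on_mult_right)
  have "(\<lambda>x. (norm (f x + g x))\<^sup>2) integrable_on D"
  proof (rule measurable_bounded_by_integrable_imp_integrable[OF _ i _ assms(3)])
    show "(\<lambda>x. (norm (f x + g x))\<^sup>2) \<in> borel_measurable (lebesgue_on D)"
      using m by measurable
    show "norm ((norm (f x + g x))\<^sup>2) \<le> 2 * (norm (f x))\<^sup>2 + 2 * (norm (g x))\<^sup>2" for x
      using norm_add_sq_le[of "f x" "g x"] by simp
  qed
  then show s: "(\<lambda>x. f x + g x) \<in> L2 D" using m assms by (simp add: L2_iff)
  have "integral D (\<lambda>x. (norm (f x + g x))\<^sup>2) \<le> integral D (\<lambda>x. 2 * (norm (f x))\<^sup>2 + 2 * (norm (g x))\<^sup>2)"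
    by (rule integral_le[OF \<open>(\<lambda>x. (norm (f x + g x))\<^sup>2) integrable_on D\<close> i norm_add_sq_le])
  also have "\<dots> = 2 * integral D (\<lambda>x. (norm (f x))\<^sup>2) + 2 * integral D (\<lambda>x. (norm (g x))\<^sup>2)"
    using assms by (subst integral_add) (auto simp: L2_iff intro!: integrable_on_mult_right)
  finally show "(L2norm D (\<lambda>x. f x + g x))\<^sup>2 \<le> 2 * (L2norm D f)\<^sup>2 + 2 * (L2norm D g)\<^sup>2"
    using assms s by (simp add: L2norm_sq)
qed

lemma L2_uminus: "f \<in> L2 D \<Longrightarrow> (\<lambda>x. - f x) \<in> L2 D"
  by (auto simp: L2_def)

lemma L2_diff:
  assumes "f \<in> L2 D" "g \<in> L2 D" "D \<in> sets lebesgue"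
  shows "(\<lambda>x. f x - g x) \<in> L2 D"
  using L2_add(1)[OF assms(1) L2_uminus[OF assms(2)] assms(3)] by simp

text \<open>Cutting the second set down to \<open>B - A\<close> makes the union disjoint; restoring
  the overlap turns the resulting equality into an inequality.\<close>

lemma L2_Un:
  assumes "f \<in> L2 A" "f \<in> L2 B" "A \<in> sets lebesgue" "B \<in> sets lebesgue"
  shows "f \<in> L2 (A \<union> B)" "(L2norm (A \<union> B) f)\<^sup>2 \<le> (L2norm A f)\<^sup>2 + (L2norm B f)\<^sup>2"
proof -
  have B: "f \<in> L2 (B - A)" using assms by (intro L2_subset[OF assms(2)]) auto
  have "(\<lambda>x. if x \<in> A then f x else 0) \<in> borel_measurable lebesgue"
    "(\<lambda>x. if x \<in> B - A then f x else 0) \<in> borel_measurable lebesgue"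
    using assms B by (simp_all only: L2_iff sets.Diff borel_measurable_if)
  then have "(\<lambda>x. (if x \<in> A then f x else 0) + (if x \<in> B - A then f x else 0)) \<in> borel_measurable lebesgue"
    by (rule borel_measurable_add)
  also have "(\<lambda>x. (if x \<in> A then f x else 0) + (if x \<in> B - A then f x else 0)) =
     (\<lambda>x. if x \<in> A \<union> B then f x else 0)" by auto
  finally have m: "f \<in> borel_measurable (lebesgue_on (A \<union> B))" by (rule borel_measurable_if_D)
  have i: "((\<lambda>x. (norm (f x))\<^sup>2) has_integral
     integral A (\<lambda>x. (norm (f x))\<^sup>2) + integral (B - A) (\<lambda>x. (norm (f x))\<^sup>2)) (A \<union> (B - A))"
  proof (rule has_integral_Un)
    show "((\<lambda>x. (norm (f x))\<^sup>2) has_integral integral A (\<lambda>x. (norm (f x))\<^sup>2)) A"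
      using assms by (intro integrable_integral) (simp add: L2_iff)
    show "((\<lambda>x. (norm (f x))\<^sup>2) has_integral integral (B - A) (\<lambda>x. (norm (f x))\<^sup>2)) (B - A)"
      using assms B by (intro integrable_integral) (simp add: L2_iff)
  qed (simp add: Int_Diff)
  have AB: "A \<union> (B - A) = A \<union> B" by blast
  note i = i[unfolded AB]
  note i' = has_integral_integrable[OF i]
  then show l: "f \<in> L2 (A \<union> B)" using m assms by (simp add: L2_iff)
  have "(L2norm (A \<union> B) f)\<^sup>2 = (L2norm A f)\<^sup>2 + (L2norm (B - A) f)\<^sup>2"
    unfolding L2norm_sq[OF l sets.Un[OF assms(3,4)]] L2norm_sq[OF assms(1,3)]
      L2norm_sq[OF B sets.Diff[OF assms(4,3)]] by (rule integral_unique[OF i])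
  also have "\<dots> \<le> (L2norm A f)\<^sup>2 + (L2norm B f)\<^sup>2"
    using L2norm_mono[OF assms(2) Diff_subset assms(4) sets.Diff[OF assms(4,3)]] by simp
  finally show "(L2norm (A \<union> B) f)\<^sup>2 \<le> (L2norm A f)\<^sup>2 + (L2norm B f)\<^sup>2" .
qed

lemma L2_Union:
  assumes "finite \<F>" "\<And>A. A \<in> \<F> \<Longrightarrow> f \<in> L2 A" "\<And>A. A \<in> \<F> \<Longrightarrow> A \<in> sets lebesgue"
  shows "f \<in> L2 (\<Union>\<F>)"
  using assms
proof (induction \<F>)
  case empty
  show ?case
    unfolding Union_empty by (rule L2_spike(1)[OF L2_const[of "{}" 0], of "{}"]) simp_all
next
  case (insert A \<F>)
  have "\<Union>\<F> \<in> sets lebesgue"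
    using insert.hyps(1) insert.prems(2) by (intro sets.finite_Union) auto
  moreover have "f \<in> L2 (\<Union>\<F>)" by (rule insert.IH) (simp_all add: insert.prems)
  ultimately have "f \<in> L2 (A \<union> \<Union>\<F>)" by (intro L2_Un(1)) (simp_all add: insert.prems)
  then show ?case by simp
qed

lemma L2norm_le_const:
  assumes "f \<in> L2 D" "D \<in> lmeasurable" "negligible N" "\<And>x. x \<in> D - N \<Longrightarrow> norm (f x) \<le> M"
  shows "(L2norm D f)\<^sup>2 \<le> M\<^sup>2 * measure lebesgue D"
proof -
  define g where "g x = (if x \<in> N then 0 else f x)" for x
  have g: "g \<in> L2 D" "L2norm D g = L2norm D f"
    by (rule L2_spike[OF assms(1) fmeasurableD[OF assms(2)] assms(3)]; simp add: g_def)+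
  have "integral D (\<lambda>x. (norm (g x))\<^sup>2) \<le> integral D (\<lambda>x. M\<^sup>2)"
  proof (rule integral_le)
    show "(\<lambda>x. (norm (g x))\<^sup>2) integrable_on D"
      using g(1) assms(2) by (simp add: L2_iff fmeasurableD)
    show "(\<lambda>x. M\<^sup>2) integrable_on D" using assms(2) by (rule integrable_on_const)
    show "(norm (g x))\<^sup>2 \<le> M\<^sup>2" if "x \<in> D" for x
      using assms(4)[of x] that by (auto simp: g_def intro: power_mono)
  qed
  moreover have "integral D (\<lambda>x. M\<^sup>2) = M\<^sup>2 * measure lebesgue D"
    using lmeasure_integral[OF assms(2)] integral_mult_right[of D "M\<^sup>2" "\<lambda>x. 1"] by simp
  moreover have "(L2norm D g)\<^sup>2 = integral D (\<lambda>x. (norm (g x))\<^sup>2)"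
    using g(1) assms(2) by (simp add: L2norm_sq fmeasurableD)
  ultimately show ?thesis
    using g(2) by simp
qed

lemma L2_absolutely_integrable:
  assumes "f \<in> L2 D" "D \<in> lmeasurable"
  shows "f absolutely_integrable_on D"
proof (rule measurable_bounded_by_integrable_imp_absolutely_integrable)
  show "(\<lambda>x. 1 + (norm (f x))\<^sup>2) integrable_on D"
    using assms by (intro integrable_add integrable_on_const) (simp_all add: L2_iff fmeasurableD)
  show "norm (f x) \<le> 1 + (norm (f x))\<^sup>2" for x
    using sum_squares_bound[of "norm (f x)" 1] norm_ge_zero[of "f x"]
    unfolding mult_1_right power_one by linarith
qed (use assms in \<open>simp_all add: L2_iff fmeasurableD\<close>)

text \<open>The integral of \<open>(norm (f x) - m)\<^sup>2\<close> is nonnegative for every real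
  \<open>m\<close>, and \<open>m = I / V\<close> minimises it; a set of measure zero is treated
  apart.\<close>

lemma L2_Cauchy_Schwarz:
  assumes "f \<in> L2 D" "D \<in> lmeasurable"
  shows "(integral D (\<lambda>x. norm (f x)))\<^sup>2 \<le> measure lebesgue D * (L2norm D f)\<^sup>2"
proof -
  define I where "I = integral D (\<lambda>x. norm (f x))"
  define V where "V = measure lebesgue D"
  have i1: "(\<lambda>x. norm (f x)) integrable_on D"
    using L2_absolutely_integrable[OF assms] by (simp add: absolutely_integrable_on_def)
  have i2: "(\<lambda>x. (norm (f x))\<^sup>2) integrable_on D"
    using assms by (simp add: L2_iff fmeasurableD)
  have ic: "(\<lambda>x. c) integrable_on D" for c :: real using assms integrable_on_const by blast
  have *: "0 \<le> (L2norm D f)\<^sup>2 - 2 * m * I + m\<^sup>2 * V" for m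
  proof -
    have "((\<lambda>x. (norm (f x))\<^sup>2 - 2 * m * norm (f x) + m\<^sup>2 * 1) has_integral
        integral D (\<lambda>x. (norm (f x))\<^sup>2) - 2 * m * I + m\<^sup>2 * V) D"
      using i1 i2 ic[of 1] assms unfolding I_def V_def
      by (intro has_integral_add has_integral_diff has_integral_mult_right)
        (auto simp: lmeasure_integral integrable_integral)
    moreover have "0 \<le> (norm (f x))\<^sup>2 - 2 * m * norm (f x) + m\<^sup>2 * 1" for x
      using zero_le_power2[of "norm (f x) - m"] unfolding power2_diff by (simp add: algebra_simps)
    ultimately have "0 \<le> integral D (\<lambda>x. (norm (f x))\<^sup>2) - 2 * m * I + m\<^sup>2 * V"
      by (rule has_integral_nonneg)
    then show ?thesis using assms by (simp add: L2norm_sq fmeasurableD)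
  qed
  have "I\<^sup>2 \<le> V * (L2norm D f)\<^sup>2"
  proof (cases "V = 0")
    case True
    then have "negligible D" using assms V_def by (simp add: negligible_iff_measure)
    then have "I = 0" unfolding I_def by (rule integral_negligible) 
    with True show ?thesis by simp
  next
    case False
    then have V: "V > 0" by (simp add: V_def zero_less_measure_iff less_le)
    have "0 \<le> V * ((L2norm D f)\<^sup>2 - 2 * (I / V) * I + (I / V)\<^sup>2 * V)"
      by (intro mult_nonneg_nonneg less_imp_le[OF V] *)
    also have "\<dots> = V * (L2norm D f)\<^sup>2 - I\<^sup>2"
      using V by (simp add: field_simps power2_eq_square)
    finally show ?thesis by simp
  qed
  then show ?thesis by (simp add: I_def V_def)
qed

section \<open>Testing the equation with bump functions\<close>

text \<open>Passes from the Lebesgue integral over the domain, used in the weak formulation, to a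
  gauge integral over the ball that carries the bump.\<close>

lemma LINT_eq_integral_subset:
  fixes f :: "'a::euclidean_space \<Rightarrow> 'b::euclidean_space"
  assumes f: "f absolutely_integrable_on B" and "B \<subseteq> \<Omega>" and \<Omega>: "\<Omega> \<in> sets lebesgue"
    and z: "\<And>x. x \<in> \<Omega> - B \<Longrightarrow> f x = 0"
  shows "(LINT x|lebesgue_on \<Omega>. f x) = integral B f"
proof -
  have e: "{x \<in> B - \<Omega>. f x \<noteq> 0} = {}" "{x \<in> \<Omega> - B. f x \<noteq> 0} = {}"
    using assms(2) z by auto
  have "f absolutely_integrable_on \<Omega>"
    using f absolutely_integrable_spike_set_eq[of B \<Omega> f] unfolding e by simp
  then have "(LINT x|lebesgue_on \<Omega>. f x) = integral \<Omega> f"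
    using \<Omega> by (intro lebesgue_integral_eq_integral absolutely_integrable_imp_integrable)
  also have "\<dots> = integral B f"
    by (rule integral_spike_set) (simp_all only: e negligible_empty)
  finally show ?thesis .
qed

lemma L2_continuous_compact_support:
  fixes f :: "'a::euclidean_space \<Rightarrow> 'b::euclidean_space"
  assumes "continuous_on UNIV f" "\<And>x. x \<notin> S \<Longrightarrow> f x = 0" "bounded S" "\<Omega> \<in> sets lebesgue"
  shows "f \<in> L2 \<Omega>"
proof -
  have "f \<in> borel_measurable borel"
    using assms(1) by (rule borel_measurable_continuous_onI)
  then have "f \<in> borel_measurable lebesgue"
    by (intro measurable_completion) simp
  then have 1: "f \<in> borel_measurable (lebesgue_on \<Omega>)"
    by (rule measurable_restrict_space1)
  have "(\<lambda>x. (norm (f x))\<^sup>2) absolutely_integrable_on UNIV"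
    by (rule absolutely_integrable_compact_support[of _ S])
       (use assms in \<open>auto intro!: continuous_intros\<close>)
  then have "(\<lambda>x. (norm (f x))\<^sup>2) absolutely_integrable_on \<Omega>"
    by (rule set_integrable_subset) (simp_all add: assms)
  with 1 show ?thesis
    using absolutely_integrable_imp_integrable[OF _ assms(4)] by (simp add: L2_def)
qed

text \<open>Integration by parts: the product of two test functions has compact support, so its
  gradient integrates to zero whatever the shape of \<open>\<Omega>\<close>.\<close>

lemma test_function_weak_gradient:
  assumes v: "v \<in> test_functions \<Omega>" and "open \<Omega>"
  shows "has_weak_gradient \<Omega> v (grad v)"
  unfolding has_weak_gradient_def
proof (intro conjI ballI)
  define S where "S = closure {x. v x \<noteq> 0}"
  have \<Omega>: "\<Omega> \<in> sets lebesgue" using assms(2) by (simp add: lborelD borel_open)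
  have C1: "C_k 1 w" if "w \<in> test_functions \<Omega>" for w using that unfolding test_functions_def by blast
  note v1 = C_k_1D[OF C1[OF v]]
  have S: "bounded S" "S \<subseteq> \<Omega>" "closed S"
    using v by (auto simp: test_functions_def compact_imp_bounded S_def)
  have v0: "v x = 0" if "x \<notin> S" for x using that closure_subset[of "{x. v x \<noteq> 0}"] unfolding S_def by blast
  have gv0: "grad v x = 0" if "x \<notin> S" for x
    by (rule GDERIV_zero_outside[OF v1(1) v0 S(3) that])
  show "v \<in> L2 \<Omega>" by (rule L2_continuous_compact_support[OF v1(3) v0 S(1) \<Omega>])
  show "grad v \<in> L2 \<Omega>" by (rule L2_continuous_compact_support[OF v1(2) gv0 S(1) \<Omega>])
  fix \<phi> assume \<phi>: "\<phi> \<in> test_functions \<Omega>"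
  note p1 = C_k_1D[OF C1[OF \<phi>]]
  have der: "GDERIV (\<lambda>x. v x * \<phi> x) x :> v x *\<^sub>R grad \<phi> x + \<phi> x *\<^sub>R grad v x" for x
    using v1(1) p1(1) by (rule GDERIV_mult)
  have c1: "continuous_on UNIV (\<lambda>x. v x *\<^sub>R grad \<phi> x)"
    and c2: "continuous_on UNIV (\<lambda>x. \<phi> x *\<^sub>R grad v x)"
    using v1 p1 by (auto intro!: continuous_intros)
  have a1: "(\<lambda>x. v x *\<^sub>R grad \<phi> x) absolutely_integrable_on UNIV"
    by (rule absolutely_integrable_compact_support[OF c1 _ S(1)]) (simp add: v0)
  have a2: "(\<lambda>x. \<phi> x *\<^sub>R grad v x) absolutely_integrable_on UNIV"
    by (rule absolutely_integrable_compact_support[OF c2 _ S(1)]) (simp add: gv0)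
  have "integral UNIV (\<lambda>x. v x *\<^sub>R grad \<phi> x + \<phi> x *\<^sub>R grad v x) = 0"
  proof (rule integral_gradient_compact_support(2)[OF der continuous_on_add[OF c1 c2] _ S(1)])
    show "v x * \<phi> x = 0" if "x \<notin> S" for x using v0[OF that] by simp
  qed
  then have sum0: "integral UNIV (\<lambda>x. v x *\<^sub>R grad \<phi> x) + integral UNIV (\<lambda>x. \<phi> x *\<^sub>R grad v x) = 0"
    using a1 a2 unfolding absolutely_integrable_on_def by (subst integral_add[symmetric]) blast+
  have eqU: "(LINT x|lebesgue_on \<Omega>. h x) = integral UNIV h"
    if "h absolutely_integrable_on UNIV" "\<And>x. x \<notin> S \<Longrightarrow> h x = 0" for h :: "'a \<Rightarrow> 'a"
  proof -
    have e: "{x \<in> UNIV - \<Omega>. h x \<noteq> 0} = {}" "{x \<in> \<Omega> - UNIV. h x \<noteq> 0} = {}"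
      using S that(2) by blast+
    have "integral \<Omega> h = integral UNIV h"
      by (rule integral_spike_set) (simp_all only: e negligible_empty)
    moreover have "h absolutely_integrable_on \<Omega>"
      using that(1) by (rule set_integrable_subset) (simp_all add: \<Omega>)
    then have "(LINT x|lebesgue_on \<Omega>. h x) = integral \<Omega> h"
      using \<Omega> by (intro lebesgue_integral_eq_integral absolutely_integrable_imp_integrable)
    ultimately show ?thesis by simp
  qed
  have "(LINT x|lebesgue_on \<Omega>. v x *\<^sub>R grad \<phi> x) = integral UNIV (\<lambda>x. v x *\<^sub>R grad \<phi> x)"
    by (rule eqU[OF a1]) (simp add: v0)
  moreover have "(LINT x|lebesgue_on \<Omega>. \<phi> x *\<^sub>R grad v x) = integral UNIV (\<lambda>x. \<phi> x *\<^sub>R grad v x)"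
    by (rule eqU[OF a2]) (simp add: gv0)
  ultimately show "(LINT x|lebesgue_on \<Omega>. v x *\<^sub>R grad \<phi> x) = - (LINT x|lebesgue_on \<Omega>. \<phi> x *\<^sub>R grad v x)"
    using sum0 by (simp add: eq_neg_iff_add_eq_0)
qed

lemma test_function_H10:
  assumes "v \<in> test_functions \<Omega>" "open \<Omega>"
  shows "v \<in> H10 \<Omega>"
proof -
  have "L2norm \<Omega> (\<lambda>x. v x - v x) = 0" "L2norm \<Omega> (\<lambda>x. grad v x - grad v x) = 0"
    by (simp_all add: L2norm_def)
  then show ?thesis
    unfolding H10_def using test_function_weak_gradient[OF assms] assms(1)
    by (intro CollectI exI[of _ "grad v"] conjI exI[of _ "\<lambda>n. v"]) simp_all
qed

lemma bump_products:
  fixes f :: "'a::euclidean_space \<Rightarrow> real" and e :: "'a \<Rightarrow> 'a"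
  assumes "R > 0"
  shows "f \<in> L2 (ball x0 R) \<Longrightarrow> (\<lambda>x. f x * bump x0 R x) absolutely_integrable_on ball x0 R"
    and "f \<in> L2 (ball x0 R) \<Longrightarrow> \<bar>integral (ball x0 R) (\<lambda>x. f x * bump x0 R x)\<bar> \<le> integral (ball x0 R) (\<lambda>x. norm (f x))"
    and "e \<in> L2 (ball x0 R) \<Longrightarrow> (\<lambda>x. e x \<bullet> bump_grad x0 R x) absolutely_integrable_on ball x0 R"
    and "e \<in> L2 (ball x0 R) \<Longrightarrow> \<bar>integral (ball x0 R) (\<lambda>x. e x \<bullet> bump_grad x0 R x)\<bar> \<le> 4 / R * integral (ball x0 R) (\<lambda>x. norm (e x))"
proof -
  let ?B = "ball x0 R"
  have B: "?B \<in> sets lebesgue" "?B \<in> lmeasurable" by simp_all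
  have m1: "bump x0 R \<in> borel_measurable (lebesgue_on ?B)"
    and m2: "bump_grad x0 R \<in> borel_measurable (lebesgue_on ?B)"
    by (auto intro!: continuous_imp_measurable_on_sets_lebesgue continuous_on_bump continuous_on_bump_grad)
  {
    assume f: "f \<in> L2 ?B"
    have i: "(\<lambda>x. norm (f x)) integrable_on ?B"
      using L2_absolutely_integrable[OF f B(2)] by (simp add: absolutely_integrable_on_def)
    have le: "norm (f x * bump x0 R x) \<le> norm (f x)" for x
      using mult_left_mono[OF bump_le_1[of x0 R x], of "\<bar>f x\<bar>"] bump_nonneg[of x0 R x] by (simp add: abs_mult)
    have fm: "f \<in> borel_measurable (lebesgue_on ?B)" using f by (simp add: L2_def)
    show a: "(\<lambda>x. f x * bump x0 R x) absolutely_integrable_on ?B"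
      by (rule measurable_bounded_by_integrable_imp_absolutely_integrable[OF borel_measurable_times[OF fm m1] B(1) i le])
    show "\<bar>integral ?B (\<lambda>x. f x * bump x0 R x)\<bar> \<le> integral ?B (\<lambda>x. norm (f x))"
      using integral_norm_bound_integral[OF _ i le] a by (simp add: absolutely_integrable_on_def)
  }
  {
    assume e: "e \<in> L2 ?B"
    have "(\<lambda>x. norm (e x)) integrable_on ?B"
      using L2_absolutely_integrable[OF e B(2)] by (simp add: absolutely_integrable_on_def)
    then have i: "(\<lambda>x. 4 / R * norm (e x)) integrable_on ?B" by (rule integrable_on_mult_right)
    have le: "norm (e x \<bullet> bump_grad x0 R x) \<le> 4 / R * norm (e x)" for x
    proof -
      have "norm (e x \<bullet> bump_grad x0 R x) \<le> norm (e x) * norm (bump_grad x0 R x)"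
        using Cauchy_Schwarz_ineq2 by simp
      also have "\<dots> \<le> norm (e x) * (4 / R)"
        using norm_bump_grad_le[OF assms] by (intro mult_left_mono) auto
      finally show ?thesis by (simp add: mult.commute)
    qed
    have em: "e \<in> borel_measurable (lebesgue_on ?B)" using e by (simp add: L2_def)
    show a: "(\<lambda>x. e x \<bullet> bump_grad x0 R x) absolutely_integrable_on ?B"
      by (rule measurable_bounded_by_integrable_imp_absolutely_integrable[OF borel_measurable_inner[OF em m2] B(1) i le])
    show "\<bar>integral ?B (\<lambda>x. e x \<bullet> bump_grad x0 R x)\<bar> \<le> 4 / R * integral ?B (\<lambda>x. norm (e x))"
      using integral_norm_bound_integral[OF _ i le] a by (simp add: absolutely_integrable_on_def)
  }
qed

lemma poisson_bump:
  assumes sol: "poisson_weak_solution \<Omega> f u" and gu: "has_weak_gradient \<Omega> u gu" and f: "f \<in> L2 \<Omega>"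
    and "open \<Omega>" "R > 0" "cball x0 R \<subseteq> \<Omega>"
  shows "integral (ball x0 R) (\<lambda>x. gu x \<bullet> bump_grad x0 R x) = integral (ball x0 R) (\<lambda>x. f x * bump x0 R x)"
proof -
  let ?B = "ball x0 R"
  have \<Omega>: "\<Omega> \<in> sets lebesgue" using assms(4) by (simp add: lborelD borel_open)
  have sub: "?B \<subseteq> \<Omega>" using assms(6) by auto
  have t: "bump x0 R \<in> test_functions \<Omega>" using bump_test_function assms by blast
  have "(LINT x|lebesgue_on \<Omega>. gu x \<bullet> bump_grad x0 R x) = (LINT x|lebesgue_on \<Omega>. f x * bump x0 R x)"
    using sol gu test_function_H10[OF t assms(4)] test_function_weak_gradient[OF t assms(4)]
    unfolding poisson_weak_solution_def grad_bump by blast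
  moreover have "(LINT x|lebesgue_on \<Omega>. gu x \<bullet> bump_grad x0 R x) = integral ?B (\<lambda>x. gu x \<bullet> bump_grad x0 R x)"
  proof (rule LINT_eq_integral_subset[OF bump_products(3)[OF assms(5)] sub \<Omega>])
    show "gu \<in> L2 ?B"
      using gu by (intro L2_subset[OF _ sub \<Omega>]) (simp_all add: has_weak_gradient_def)
  qed (simp add: bump_outside(2)[OF assms(5)])
  moreover have "(LINT x|lebesgue_on \<Omega>. f x * bump x0 R x) = integral ?B (\<lambda>x. f x * bump x0 R x)"
  proof (rule LINT_eq_integral_subset[OF bump_products(1)[OF assms(5)] sub \<Omega>])
    show "f \<in> L2 ?B"
      using f by (intro L2_subset[OF _ sub \<Omega>]) simp_all
  qed (simp add: bump_outside(1)[OF assms(5)])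
  ultimately show ?thesis by simp
qed

text \<open>This makes constant vectors invisible to the bump; inside an element
  \<open>grad uh\<close> is such a vector.\<close>

lemma integral_bump_grad:
  assumes "R > 0"
  shows "bump_grad x0 R integrable_on ball x0 R" "integral (ball x0 R) (bump_grad x0 R) = 0"
proof -
  have o: "bump x0 R x = 0" "bump_grad x0 R x = 0" if "x \<notin> ball x0 R" for x
    using bump_outside[OF assms that] by auto
  note z = integral_gradient_compact_support[OF GDERIV_bump continuous_on_bump_grad o(1) bounded_ball]
  have e: "{x \<in> UNIV - ball x0 R. bump_grad x0 R x \<noteq> 0} = {}" "{x \<in> ball x0 R - UNIV. bump_grad x0 R x \<noteq> 0} = {}"
    using o by blast+
  have "integral (ball x0 R) (bump_grad x0 R) = integral UNIV (bump_grad x0 R)"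
    by (rule integral_spike_set) (simp_all only: e negligible_empty)
  then show "integral (ball x0 R) (bump_grad x0 R) = 0" using z(2) by simp
  have "bump_grad x0 R absolutely_integrable_on ball x0 R"
    using z(1) by (rule set_integrable_subset) simp_all
  then show "bump_grad x0 R integrable_on ball x0 R" by (simp add: absolutely_integrable_on_def)
qed

text \<open>On the concentric ball of half the radius the argument of \<open>theta 0\<close> is at
  least 3/4, and exp(-4/3) exceeds exp(-2); halving the radius costs the factor 2^d in
  volume.\<close>

lemma integral_bump_ge:
  assumes "R > 0"
  shows "bump x0 R integrable_on ball x0 R"
    "exp (- 2) / 2 ^ DIM('a) * measure lebesgue (ball (x0::'a::euclidean_space) R) \<le> integral (ball x0 R) (bump x0 R)"
proof -
  have "(\<lambda>x. 1 * bump x0 R x) absolutely_integrable_on ball x0 R"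
    by (rule bump_products(1)[OF assms L2_const]) simp
  then show i: "bump x0 R integrable_on ball x0 R" by (simp add: absolutely_integrable_on_def)
  have i2: "(\<lambda>x. exp (-2::real)) integrable_on ball x0 (R / 2)"
    by (intro integrable_on_const) simp
  have i3: "bump x0 R integrable_on ball x0 (R/2)"
  proof -
    have "bump x0 R absolutely_integrable_on ball x0 R"
      using i bump_nonneg by (intro nonnegative_absolutely_integrable_1) auto
    then have "bump x0 R absolutely_integrable_on ball x0 (R/2)"
      by (rule set_integrable_subset) (use assms in auto)
    then show ?thesis by (simp add: absolutely_integrable_on_def)
  qed
  have "exp (- 2) / 2 ^ DIM('a) * measure lebesgue (ball x0 R) = integral (ball x0 (R / 2)) (\<lambda>x. exp (-2))"
  proof -
    have "integral (ball x0 (R / 2)) (\<lambda>x. exp (-2)) = exp (-2) * measure lebesgue (ball x0 (R / 2))"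
      using lmeasure_integral[of "ball x0 (R/2)"] integral_mult_right[of "ball x0 (R/2)" "exp (-2::real)" "\<lambda>x. 1"]
      by simp
    then show ?thesis using assms by (simp add: content_ball power_divide)
  qed
  also have "\<dots> \<le> integral (ball x0 (R / 2)) (bump x0 R)"
  proof (rule integral_le[OF i2 i3])
    fix x assume "x \<in> ball x0 (R/2)"
    then have "(norm (x - x0))\<^sup>2 \<le> (R / 2)\<^sup>2"
      by (intro power_mono) (auto simp: dist_norm norm_minus_commute)
    moreover define s where "s = 1 - (norm (x - x0))\<^sup>2 / R\<^sup>2"
    moreover have "(norm (x - x0))\<^sup>2 / R\<^sup>2 \<le> 1/4"
      using assms calculation(1) by (simp add: field_simps power2_eq_square)
    ultimately have s: "s \<ge> 3/4" by linarith
    then have "exp (- 2) \<le> theta 0 s" by (simp add: theta_def divide_le_eq)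
    then show "exp (- 2) \<le> bump x0 R x" by (simp add: bump_def s_def)
  qed
  also have "\<dots> \<le> integral (ball x0 R) (bump x0 R)"
    using assms by (intro integral_subset_le i i3) (auto simp: bump_nonneg)
  finally show "exp (- 2) / 2 ^ DIM('a) * measure lebesgue (ball x0 R) \<le> integral (ball x0 R) (bump x0 R)" .
qed

text \<open>By the divergence theorem the right-hand side is \<open>norm a\<close> times the
  integral of the bump over the flat disc; staying with the volume integral avoids surface measure.
  The integrand has one sign on \<open>H\<close>, so a lower bound on a small ball inside
  \<open>H\<close> is enough.\<close>

lemma bump_grad_halfspace:
  fixes x0 a :: "'a::euclidean_space"
  assumes "R > 0"
  defines "H \<equiv> {x \<in> ball x0 R. a \<bullet> (x - x0) > 0}"
  shows "norm a * (exp (- 3) / (2 * R * 4 ^ DIM('a))) * measure lebesgue (ball x0 R)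
     \<le> - integral H (\<lambda>x. a \<bullet> bump_grad x0 R x)"
proof -
  define q where "q x = - (a \<bullet> bump_grad x0 R x)" for x
  have q: "q x = 2 / R\<^sup>2 * theta 2 (1 - (norm (x - x0))\<^sup>2 / R\<^sup>2) * (a \<bullet> (x - x0))" for x
    by (simp add: q_def bump_grad_def)
  have q0: "0 \<le> q x" if "x \<in> H" for x
    using that by (auto simp: q H_def theta_nonneg intro!: mult_nonneg_nonneg)
  have "(\<lambda>x. (- a) \<bullet> bump_grad x0 R x) absolutely_integrable_on ball x0 R"
    by (rule bump_products(3)[OF assms(1) L2_const]) simp
  then have qi: "q absolutely_integrable_on ball x0 R"
    by (simp add: q_def[abs_def])
  have H: "open H"
  proof -
    have "H = ball x0 R \<inter> {x. a \<bullet> x > a \<bullet> x0}" by (auto simp: H_def inner_diff_right)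
    then show ?thesis by (simp add: open_Int open_halfspace_gt)
  qed
  have qH: "q integrable_on S" if "open S" "S \<subseteq> ball x0 R" for S
  proof -
    have "q absolutely_integrable_on S"
      using qi by (rule set_integrable_subset) (use that in \<open>auto simp: lborelD borel_open\<close>)
    then show ?thesis by (simp add: absolutely_integrable_on_def)
  qed
  have HB: "H \<subseteq> ball x0 R" by (auto simp: H_def)
  have main: "norm a * (exp (- 3) / (2 * R * 4 ^ DIM('a))) * measure lebesgue (ball x0 R) \<le> integral H q"
  proof (cases "a = 0")
    case True
    then show ?thesis using integral_nonneg[OF qH[OF H HB] q0] by simp
  next
    case False
    \<comment> \<open>Half the radius in the direction of \<open>a\<close>: the ball of radius R/4
      about \<open>x0 + y0\<close> keeps a distance of R/4 from both the bounding hyperplane and the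
      sphere.\<close>
    define y0 where "y0 = (R / 2 / norm a) *\<^sub>R a"
    have ny: "norm y0 = R / 2" "a \<bullet> y0 = norm a * (R / 2)"
      using False assms(1) by (simp_all add: y0_def power2_norm_eq_inner[symmetric] power2_eq_square)
    define D where "D = ball (x0 + y0) (R / 4)"
    define c where "c = norm a * exp (-3) / (2 * R)"
    have D: "norm (x - x0) \<le> 3 / 4 * R \<and> norm a * (R / 4) \<le> a \<bullet> (x - x0)" if "x \<in> D" for x
    proof -
      have d: "norm (x - x0 - y0) \<le> R / 4"
        using that by (simp add: D_def dist_norm norm_minus_commute algebra_simps)
      have "norm (x - x0) \<le> norm (x - x0 - y0) + norm y0"
        using norm_triangle_ineq[of "x - x0 - y0" y0] by simp
      moreover have "\<bar>a \<bullet> (x - x0 - y0)\<bar> \<le> norm a * (R / 4)"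
        using Cauchy_Schwarz_ineq2[of a "x - x0 - y0"] mult_left_mono[OF d norm_ge_zero[of a]] by linarith
      moreover have "a \<bullet> (x - x0) = a \<bullet> (x - x0 - y0) + a \<bullet> y0"
        by (simp add: inner_diff_right)
      ultimately show ?thesis
        using d ny unfolding times_divide_eq_right by (intro conjI; linarith)
    qed
    have DH: "D \<subseteq> H"
    proof
      fix x assume "x \<in> D"
      note d = D[OF this]
      have "norm (x - x0) < R" using d assms(1) by linarith
      moreover have "0 < norm a * (R / 4)" using False assms(1) by simp
      ultimately show "x \<in> H" using d by (simp add: H_def dist_norm norm_minus_commute)
    qed
    have cq: "c \<le> q x" if "x \<in> D" for x
    proof -
      note d = D[OF that]
      define s where "s = 1 - (norm (x - x0))\<^sup>2 / R\<^sup>2"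
      have "(norm (x - x0))\<^sup>2 \<le> (3 / 4 * R)\<^sup>2" using d by (intro power_mono) auto
      then have s: "7 / 16 \<le> s" "s \<le> 1"
        using assms(1) by (simp_all add: s_def field_simps power2_eq_square)
      \<comment> \<open>Here 1/s is at most 16/7, which is below 3.\<close>
      have "exp (-3) \<le> exp (- (1 / s))" using s by (simp add: divide_le_eq)
      also have "\<dots> \<le> exp (- (1 / s)) / s\<^sup>2"
        using s power_le_one[of s 2] by (simp add: le_divide_eq)
      finally have t: "exp (-3) \<le> theta 2 s" using s by (simp add: theta_def)
      have "c = 2 / R\<^sup>2 * exp (-3) * (norm a * (R / 4))"
        using assms(1) by (simp add: c_def power2_eq_square)
      also have "\<dots> \<le> 2 / R\<^sup>2 * theta 2 s * (a \<bullet> (x - x0))"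
        using t d assms(1) by (intro mult_mono) (auto simp: theta_nonneg)
      finally show ?thesis by (simp add: q s_def)
    qed
    have "integral D (\<lambda>x. c) = c * measure lebesgue D"
      using lmeasure_integral[of D] integral_mult_right[of D c "\<lambda>x. 1"] by (simp add: D_def)
    also have "\<dots> = norm a * (exp (- 3) / (2 * R * 4 ^ DIM('a))) * measure lebesgue (ball x0 R)"
      using assms(1) by (simp add: D_def c_def content_ball power_divide)
    finally have "norm a * (exp (- 3) / (2 * R * 4 ^ DIM('a))) * measure lebesgue (ball x0 R) = integral D (\<lambda>x. c)"
      by simp
    also have "\<dots> \<le> integral D q"
    proof (rule integral_le)
      show "(\<lambda>x. c) integrable_on D" by (intro integrable_on_const) (simp add: D_def)
      show "q integrable_on D" using DH HB by (intro qH) (auto simp: D_def)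
    qed (rule cq)
    also have "\<dots> \<le> integral H q"
      using DH HB q0 by (intro integral_subset_le qH H) (auto simp: D_def)
    finally show ?thesis .
  qed
  have "integral H q = - integral H (\<lambda>x. a \<bullet> bump_grad x0 R x)"
    unfolding q_def by (rule integral_neg)
  with main show ?thesis by simp
qed

section \<open>Local estimates from a single bump\<close>

lemma bubble_arith:
  fixes t V I1 I2 R F E :: real
  assumes "t * V \<le> I1 + 4 / R * I2" "I1\<^sup>2 \<le> V * F" "I2\<^sup>2 \<le> V * E" "V > 0" "R > 0" "t \<ge> 0" "F \<ge> 0" "E \<ge> 0"
  shows "t\<^sup>2 * R\<^sup>2 * V \<le> 32 * (R\<^sup>2 * F + E)"
proof -
  have "(t * V)\<^sup>2 \<le> (I1 + 4 / R * I2)\<^sup>2"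
    using assms by (intro power_mono) auto
  also have "\<dots> \<le> 2 * I1\<^sup>2 + 2 * (4 / R * I2)\<^sup>2"
    using norm_add_sq_le[of I1 "4 / R * I2"] by (simp only: real_norm_def power2_abs)
  \<comment> \<open>32 = 2 * 4^2, with the 4 from the gradient bound 4/R.\<close>
  also have "\<dots> = 2 * I1\<^sup>2 + 32 / R\<^sup>2 * I2\<^sup>2"
    by (simp add: power_divide power_mult_distrib)
  also have "\<dots> \<le> 2 * (V * F) + 32 / R\<^sup>2 * (V * E)"
    using assms by (intro add_mono mult_left_mono) auto
  finally have "(t * V)\<^sup>2 * R\<^sup>2 \<le> (2 * (V * F) + 32 / R\<^sup>2 * (V * E)) * R\<^sup>2"
    by (rule mult_right_mono) simp
  also have "\<dots> = V * (2 * (R\<^sup>2 * F) + 32 * E)"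
    using assms by (simp add: field_simps)
  also have "\<dots> \<le> V * (32 * (R\<^sup>2 * F + E))"
    using assms by (intro mult_left_mono) auto
  finally have "V * (t\<^sup>2 * R\<^sup>2 * V) \<le> V * (32 * (R\<^sup>2 * F + E))"
    by (simp add: power2_eq_square algebra_simps)
  then show ?thesis using assms by simp
qed

text \<open>Split \<open>f\<close> into \<open>m\<close> and \<open>f - m\<close>, and
  \<open>gu\<close> into \<open>g\<close> and \<open>gu - g\<close>. The constant \<open>g\<close>
  drops out of the tested equation, so \<open>m\<close> times the integral of the bump is a sum of
  an error term and an oscillation term.\<close>

lemma interior_bubble:
  fixes x0 :: "'a::euclidean_space"
  assumes sol: "poisson_weak_solution \<Omega> f u" and gu: "has_weak_gradient \<Omega> u gu" and f: "f \<in> L2 \<Omega>"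
    and "open \<Omega>" "R > 0" "cball x0 R \<subseteq> \<Omega>"
  shows "m\<^sup>2 * R\<^sup>2 * measure lebesgue (ball x0 R) \<le> 32 * (exp 2 * 2 ^ DIM('a))\<^sup>2 *
    (R\<^sup>2 * (L2norm (ball x0 R) (\<lambda>x. f x - m))\<^sup>2 + (L2norm (ball x0 R) (\<lambda>x. gu x - g))\<^sup>2)"
proof -
  let ?B = "ball x0 R"
  define V where "V = measure lebesgue ?B"
  define c :: real where "c = exp (- 2) / 2 ^ DIM('a)"
  have c: "c > 0" by (simp add: c_def)
  have \<Omega>: "\<Omega> \<in> sets lebesgue" using assms(4) by (simp add: lborelD borel_open)
  have sub: "?B \<subseteq> \<Omega>" using assms(6) by auto
  have f2: "(\<lambda>x. f x - m) \<in> L2 ?B"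
    by (intro L2_diff L2_const L2_subset[OF f sub \<Omega>]) simp_all
  have e2: "(\<lambda>x. gu x - g) \<in> L2 ?B"
    using gu by (intro L2_diff L2_const L2_subset[OF _ sub \<Omega>]) (simp_all add: has_weak_gradient_def)
  note pf = bump_products(1,2)[OF assms(5) f2] and pe = bump_products(3,4)[OF assms(5) e2]
  have "integral ?B (\<lambda>x. f x * bump x0 R x)
      = integral ?B (\<lambda>x. (f x - m) * bump x0 R x + m * bump x0 R x)"
    by (simp add: algebra_simps)
  also have "\<dots> = integral ?B (\<lambda>x. (f x - m) * bump x0 R x) + m * integral ?B (bump x0 R)"
    using pf(1) integral_bump_ge(1)[OF assms(5), of x0]
    by (subst integral_add) (auto simp: absolutely_integrable_on_def intro: integrable_on_mult_right)
  finally have 1: "integral ?B (\<lambda>x. f x * bump x0 R x) = \<dots>" .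
  have i0: "(\<lambda>x. g \<bullet> bump_grad x0 R x) integrable_on ?B" "integral ?B (\<lambda>x. g \<bullet> bump_grad x0 R x) = 0"
    using integrable_linear[OF integral_bump_grad(1)[OF assms(5)] bounded_linear_inner_right[of g], of x0]
      integral_linear[OF integral_bump_grad(1)[OF assms(5)] bounded_linear_inner_right[of g], of x0]
      integral_bump_grad(2)[OF assms(5), of x0] by (simp_all add: o_def)
  have "integral ?B (\<lambda>x. gu x \<bullet> bump_grad x0 R x)
      = integral ?B (\<lambda>x. (gu x - g) \<bullet> bump_grad x0 R x + g \<bullet> bump_grad x0 R x)"
    by (simp add: inner_diff_left)
  also have "\<dots> = integral ?B (\<lambda>x. (gu x - g) \<bullet> bump_grad x0 R x)"
    using pe(1) i0 by (subst integral_add) (auto simp: absolutely_integrable_on_def)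
  finally have 2: "integral ?B (\<lambda>x. gu x \<bullet> bump_grad x0 R x) = \<dots>" .
  have eq: "m * integral ?B (bump x0 R) = integral ?B (\<lambda>x. (gu x - g) \<bullet> bump_grad x0 R x)
     - integral ?B (\<lambda>x. (f x - m) * bump x0 R x)"
    using 1 2 poisson_bump[OF assms] by simp
  have "(\<bar>m\<bar> * c) * V \<le> \<bar>m\<bar> * integral ?B (bump x0 R)"
    using integral_bump_ge(2)[OF assms(5), of x0] unfolding c_def V_def mult.assoc by (intro mult_left_mono) auto
  also have "\<dots> = \<bar>m * integral ?B (bump x0 R)\<bar>"
    using integral_nonneg[OF integral_bump_ge(1)[OF assms(5), of x0] bump_nonneg] by (simp add: abs_mult)
  also have "\<dots> \<le> integral ?B (\<lambda>x. norm (f x - m)) + 4 / R * integral ?B (\<lambda>x. norm (gu x - g))"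
    using pf(2) pe(2) unfolding eq by linarith
  finally have "(\<bar>m\<bar> * c)\<^sup>2 * R\<^sup>2 * V \<le> 32 * (R\<^sup>2 * (L2norm ?B (\<lambda>x. f x - m))\<^sup>2 + (L2norm ?B (\<lambda>x. gu x - g))\<^sup>2)"
    unfolding V_def
    by (rule bubble_arith) (use L2_Cauchy_Schwarz[OF f2] L2_Cauchy_Schwarz[OF e2] assms(5) c in \<open>simp_all add: content_ball_pos\<close>)
  then have "c\<^sup>2 * (m\<^sup>2 * R\<^sup>2 * V) \<le> 32 * (R\<^sup>2 * (L2norm ?B (\<lambda>x. f x - m))\<^sup>2 + (L2norm ?B (\<lambda>x. gu x - g))\<^sup>2)"
    by (simp add: power_mult_distrib mult_ac)
  then have "m\<^sup>2 * R\<^sup>2 * V \<le> 32 * (R\<^sup>2 * (L2norm ?B (\<lambda>x. f x - m))\<^sup>2 + (L2norm ?B (\<lambda>x. gu x - g))\<^sup>2) / c\<^sup>2"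
    using c by (simp add: pos_le_divide_eq mult.commute)
  also have "\<dots> = 32 * (exp 2 * 2 ^ DIM('a))\<^sup>2 * (R\<^sup>2 * (L2norm ?B (\<lambda>x. f x - m))\<^sup>2 + (L2norm ?B (\<lambda>x. gu x - g))\<^sup>2)"
    by (simp add: c_def exp_minus field_simps)
  finally show ?thesis by (simp add: V_def)
qed

text \<open>The part \<open>g\<close> common to both halves drops out and the half-ball integral
  isolates \<open>s\<close>. Its lower bound carries a factor 1/R, which cancels the R^2 coming from
  \<open>bubble_arith\<close>; apart from the volume, no power of \<open>R\<close> stays with the
  jump.\<close>

lemma face_bubble:
  fixes x0 a g :: "'a::euclidean_space" and s :: real
  assumes sol: "poisson_weak_solution \<Omega> f u" and gu: "has_weak_gradient \<Omega> u gu" and f: "f \<in> L2 \<Omega>"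
    and "open \<Omega>" "R > 0" "cball x0 R \<subseteq> \<Omega>"
  defines "w \<equiv> \<lambda>x. if a \<bullet> (x - x0) > 0 then g + s *\<^sub>R a else g"
  shows "(norm (s *\<^sub>R a))\<^sup>2 * measure lebesgue (ball x0 R) \<le> 32 * (2 * exp 3 * 4 ^ DIM('a))\<^sup>2 *
    (R\<^sup>2 * (L2norm (ball x0 R) f)\<^sup>2 + (L2norm (ball x0 R) (\<lambda>x. gu x - w x))\<^sup>2)"
proof -
  let ?B = "ball x0 R"
  define H where "H = {x \<in> ?B. a \<bullet> (x - x0) > 0}"
  define V where "V = measure lebesgue ?B"
  define c where "c = exp (- 3) / (2 * R * 4 ^ DIM('a))"
  have c: "c > 0" using assms(5) by (simp add: c_def)
  have \<Omega>: "\<Omega> \<in> sets lebesgue" using assms(4) by (simp add: lborelD borel_open)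
  have sub: "?B \<subseteq> \<Omega>" using assms(6) by auto
  have "H = ?B \<inter> {x. a \<bullet> x > a \<bullet> x0}" by (auto simp: H_def inner_diff_right)
  then have "open H" by (simp add: open_Int open_halfspace_gt)
  moreover have "bounded H" by (rule bounded_subset[OF bounded_ball]) (auto simp: H_def)
  ultimately have H: "H \<in> lmeasurable" by (simp add: lmeasurable_open)
  have HB: "H \<subseteq> ?B" by (auto simp: H_def)
  have BH: "?B - H \<in> lmeasurable" using H by (simp add: fmeasurable.Diff)
  have "w \<in> L2 H"
    by (rule L2_spike(1)[where f = "\<lambda>_. g + s *\<^sub>R a", OF L2_const[OF H] fmeasurableD[OF H] negligible_empty])
      (auto simp: w_def H_def)
  moreover have "w \<in> L2 (?B - H)"
    by (rule L2_spike(1)[where f = "\<lambda>_. g", OF L2_const[OF BH] fmeasurableD[OF BH] negligible_empty])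
      (auto simp: w_def H_def)
  ultimately have "w \<in> L2 (H \<union> (?B - H))"
    using H BH by (intro L2_Un fmeasurableD)
  moreover have "H \<union> (?B - H) = ?B" using HB by blast
  ultimately have w: "w \<in> L2 ?B" by simp
  have f2: "f \<in> L2 ?B" by (intro L2_subset[OF f sub \<Omega>]) simp_all
  have e2: "(\<lambda>x. gu x - w x) \<in> L2 ?B"
    using gu by (intro L2_diff w L2_subset[OF _ sub \<Omega>]) (simp_all add: has_weak_gradient_def)
  note pf = bump_products(1,2)[OF assms(5) f2] and pe = bump_products(3,4)[OF assms(5) e2]
  have i0: "(\<lambda>x. g \<bullet> bump_grad x0 R x) integrable_on ?B" "integral ?B (\<lambda>x. g \<bullet> bump_grad x0 R x) = 0"
    using integrable_linear[OF integral_bump_grad(1)[OF assms(5)] bounded_linear_inner_right[of g], of x0]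
      integral_linear[OF integral_bump_grad(1)[OF assms(5)] bounded_linear_inner_right[of g], of x0]
      integral_bump_grad(2)[OF assms(5), of x0] by (simp_all add: o_def)
  have iH: "(\<lambda>x. if x \<in> H then s * (a \<bullet> bump_grad x0 R x) else 0) integrable_on ?B"
  proof -
    have "(\<lambda>x. (s *\<^sub>R a) \<bullet> bump_grad x0 R x) absolutely_integrable_on ?B"
      by (rule bump_products(3)[OF assms(5) L2_const]) simp
    then have "(\<lambda>x. (s *\<^sub>R a) \<bullet> bump_grad x0 R x) absolutely_integrable_on H"
      by (rule set_integrable_subset) (use H HB in \<open>simp_all add: fmeasurableD\<close>)
    then have "(\<lambda>x. s * (a \<bullet> bump_grad x0 R x)) integrable_on H"
      by (simp add: absolutely_integrable_on_def)
    then show ?thesis using HB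
      by (subst integrable_restrict_Int) (simp add: Int_absorb2)
  qed
  have "integral ?B (\<lambda>x. gu x \<bullet> bump_grad x0 R x)
      = integral ?B (\<lambda>x. (gu x - w x) \<bullet> bump_grad x0 R x + (g \<bullet> bump_grad x0 R x
          + (if x \<in> H then s * (a \<bullet> bump_grad x0 R x) else 0)))"
    by (rule integral_cong) (simp add: inner_diff_left inner_add_left w_def H_def)
  also have "\<dots> = integral ?B (\<lambda>x. (gu x - w x) \<bullet> bump_grad x0 R x)
      + integral ?B (\<lambda>x. if x \<in> H then s * (a \<bullet> bump_grad x0 R x) else 0)"
    using pe(1) i0 iH by (simp add: integral_add integrable_add absolutely_integrable_on_def)
  also have "integral ?B (\<lambda>x. if x \<in> H then s * (a \<bullet> bump_grad x0 R x) else 0)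
      = s * integral H (\<lambda>x. a \<bullet> bump_grad x0 R x)"
    using HB by (subst Henstock_Kurzweil_Integration.integral_restrict_Int) (simp add: Int_absorb2)
  finally have eq: "s * integral H (\<lambda>x. a \<bullet> bump_grad x0 R x) = integral ?B (\<lambda>x. f x * bump x0 R x)
     - integral ?B (\<lambda>x. (gu x - w x) \<bullet> bump_grad x0 R x)"
    using poisson_bump[OF assms(1-6)] by simp
  have lb: "norm a * c * V \<le> \<bar>integral H (\<lambda>x. a \<bullet> bump_grad x0 R x)\<bar>"
    using bump_grad_halfspace[OF assms(5), of a x0] unfolding c_def V_def H_def by linarith
  have "(\<bar>s\<bar> * norm a * c) * V \<le> \<bar>s\<bar> * \<bar>integral H (\<lambda>x. a \<bullet> bump_grad x0 R x)\<bar>"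
    using mult_left_mono[OF lb abs_ge_zero[of s]] by (simp add: mult.assoc)
  also have "\<dots> \<le> integral ?B (\<lambda>x. norm (f x)) + 4 / R * integral ?B (\<lambda>x. norm (gu x - w x))"
    using pf(2) pe(2) unfolding abs_mult[symmetric] eq by linarith
  finally have "(\<bar>s\<bar> * norm a * c)\<^sup>2 * R\<^sup>2 * V \<le> 32 * (R\<^sup>2 * (L2norm ?B f)\<^sup>2 + (L2norm ?B (\<lambda>x. gu x - w x))\<^sup>2)"
    unfolding V_def
    by (rule bubble_arith) (use L2_Cauchy_Schwarz[OF f2] L2_Cauchy_Schwarz[OF e2] assms(5) c in \<open>simp_all add: content_ball_pos\<close>)
  then have "(c * R)\<^sup>2 * ((norm (s *\<^sub>R a))\<^sup>2 * V) \<le> 32 * (R\<^sup>2 * (L2norm ?B f)\<^sup>2 + (L2norm ?B (\<lambda>x. gu x - w x))\<^sup>2)"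
    by (simp add: power_mult_distrib mult_ac)
  then have "(norm (s *\<^sub>R a))\<^sup>2 * V \<le> 32 * (R\<^sup>2 * (L2norm ?B f)\<^sup>2 + (L2norm ?B (\<lambda>x. gu x - w x))\<^sup>2) / (c * R)\<^sup>2"
    using c assms(5) by (simp add: pos_le_divide_eq mult.commute)
  also have "\<dots> = 32 * (2 * exp 3 * 4 ^ DIM('a))\<^sup>2 * (R\<^sup>2 * (L2norm ?B f)\<^sup>2 + (L2norm ?B (\<lambda>x. gu x - w x))\<^sup>2)"
    using assms(5) by (simp add: c_def exp_minus field_simps)
  finally show "(norm (s *\<^sub>R a))\<^sup>2 * measure lebesgue (ball x0 R) \<le> 32 * (2 * exp 3 * 4 ^ DIM('a))\<^sup>2 *
    (R\<^sup>2 * (L2norm (ball x0 R) f)\<^sup>2 + (L2norm (ball x0 R) (\<lambda>x. gu x - w x))\<^sup>2)"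
    by (simp add: V_def)
qed

section \<open>Barycentric coordinates and face-adjacent elements\<close>

lemma GDERIV_elem:
  fixes K :: "'a::euclidean_space set"
  assumes "\<And>x. x \<in> K \<Longrightarrow> v x = a \<bullet> x + c" "x \<in> interior K"
  shows "GDERIV v x :> a"
  by (rule GDERIV_transform_open[OF GDERIV_affine open_interior assms(2)])
    (use assms(1) interior_subset in force)

lemma elem_grad_eqI:
  fixes K :: "'a::euclidean_space set"
  assumes "\<And>x. x \<in> K \<Longrightarrow> v x = a \<bullet> x + c" "interior K \<noteq> {}"
  shows "elem_grad v K = a"
  unfolding elem_grad_def
proof (rule the_equality)
  show "\<forall>x\<in>interior K. GDERIV v x :> a" using GDERIV_elem[OF assms(1)] by blast
  fix g assume "\<forall>x\<in>interior K. GDERIV v x :> g"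
  then show "g = a" using GDERIV_elem[OF assms(1)] GDERIV_unique assms(2) by blast
qed

lemma elem_affine:
  fixes K :: "'a::euclidean_space set"
  assumes "\<exists>a c. \<forall>x\<in>K. v x = a \<bullet> x + c" "interior K \<noteq> {}" "y \<in> K"
  shows "x \<in> K \<Longrightarrow> v x = v y + elem_grad v K \<bullet> (x - y)"
    and "x \<in> interior K \<Longrightarrow> GDERIV v x :> elem_grad v K"
proof -
  obtain a c where ac: "\<And>x. x \<in> K \<Longrightarrow> v x = a \<bullet> x + c" using assms(1) by blast
  have e: "elem_grad v K = a" by (rule elem_grad_eqI[OF ac assms(2)])
  show "x \<in> K \<Longrightarrow> v x = v y + elem_grad v K \<bullet> (x - y)"
    using ac[of x] ac[OF assms(3)] by (simp add: e inner_diff_right)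
  show "x \<in> interior K \<Longrightarrow> GDERIV v x :> elem_grad v K"
    unfolding e by (rule GDERIV_elem[OF ac])
qed

definition verts :: "'a::euclidean_space set \<Rightarrow> 'a set" where
  "verts K = {x. x extreme_point_of K}"

text \<open>On \<open>K\<close> this is \<open>\<phi> z\<close>; it is extended affinely so that it also makes sense outside \<open>K\<close>.\<close>

definition lam :: "('a::euclidean_space \<Rightarrow> 'a \<Rightarrow> real) \<Rightarrow> 'a set \<Rightarrow> 'a \<Rightarrow> 'a \<Rightarrow> real" where
  "lam \<phi> K z x = 1 + elem_grad (\<phi> z) K \<bullet> (x - z)"

text \<open>A dimension count suffices as encoding: in a conforming mesh the intersection is already
  a common face, so dimension d - 1 makes it a common facet.\<close>

definition face_adjacent :: "'a::euclidean_space set \<Rightarrow> 'a set \<Rightarrow> bool" where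
  "face_adjacent K K' \<longleftrightarrow> aff_dim (K \<inter> K') = int DIM('a) - 1"

text \<open>Dimension two is the least in which a facet contains an edge;
  \<open>face_adjacent_diameter\<close> compares diameters through such an edge.\<close>

locale fe_mesh =
  fixes \<Omega> :: "'a::euclidean_space set" and \<T> :: "'a set set" and \<phi> :: "'a \<Rightarrow> 'a \<Rightarrow> real" and \<kappa> :: real
  assumes dim: "2 \<le> DIM('a)"
    and dom: "polyhedral_domain \<Omega>"
    and kappa: "\<kappa> > 0"
    and mesh: "conforming_mesh \<Omega> \<T>"
    and reg: "shape_regular \<kappa> \<T>"
    and basis: "nodal_basis \<Omega> \<T> \<phi>"
begin

lemma open_domain: "open \<Omega>"
  using dom by (simp add: polyhedral_domain_def)

lemma Omega_lebesgue: "\<Omega> \<in> sets lebesgue"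
  using open_domain by (simp add: lborelD borel_open)

text \<open>A finite union of polytopes is closed, so it contains the closure of its interior. The
  consequence wanted later: an open ball covered by elements lies in \<open>\<Omega>\<close> and not
  merely in its closure.\<close>

lemma interior_closure_domain: "interior (closure \<Omega>) = \<Omega>"
proof
  obtain \<P> where P: "finite \<P>" "\<forall>P\<in>\<P>. polytope P" "\<Omega> = interior (\<Union>\<P>)"
    using dom by (auto simp: polyhedral_domain_def)
  have "closed (\<Union>\<P>)" using P by (intro closed_Union) (auto intro: polytope_imp_closed)
  then have "closure \<Omega> \<subseteq> \<Union>\<P>" using P(3) interior_subset closure_minimal by metis
  then show "interior (closure \<Omega>) \<subseteq> \<Omega>" using P(3) interior_mono by metis
  show "\<Omega> \<subseteq> interior (closure \<Omega>)"
    by (rule interior_maximal[OF closure_subset open_domain])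
qed

lemma finite_mesh: "finite \<T>"
  using mesh by (simp add: conforming_mesh_def triangulation_def)

lemma Union_mesh: "\<Union>\<T> = closure \<Omega>"
  using mesh by (simp add: conforming_mesh_def)

lemma inter_face: "K \<in> \<T> \<Longrightarrow> K' \<in> \<T> \<Longrightarrow> (K \<inter> K') face_of K"
  using mesh by (simp add: conforming_mesh_def triangulation_def)

section \<open>Geometry of a single element\<close>

context
  fixes K assumes K: "K \<in> \<T>"
begin

lemma elem_simplex: "int DIM('a) simplex K"
  using mesh K by (simp add: conforming_mesh_def)

lemma elem_verts:
  shows "\<not> affine_dependent (verts K)" "finite (verts K)" "card (verts K) = DIM('a) + 1"
    "K = convex hull (verts K)" "verts K \<subseteq> K"
proof -
  obtain C where C: "\<not> affine_dependent C" "int (card C) = int DIM('a) + 1" "K = convex hull C"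
    using elem_simplex unfolding simplex_def by blast
  have "verts K = C"
    using extreme_point_of_convex_hull_affine_independent[OF C(1)] C(3) by (auto simp: verts_def)
  then show "\<not> affine_dependent (verts K)" "finite (verts K)" "card (verts K) = DIM('a) + 1"
    "K = convex hull (verts K)" "verts K \<subseteq> K"
    using C aff_independent_finite by (auto intro: hull_inc)
qed

lemma affine_hull_verts: "affine hull (verts K) = UNIV"
proof -
  have "aff_dim (verts K) = int DIM('a)"
    using aff_dim_affine_independent[OF elem_verts(1)] elem_verts(3) by simp
  then show ?thesis using aff_dim_eq_full by blast
qed

lemma elem_props: "convex K" "compact K" "closed K" "bounded K" "K \<in> lmeasurable" "K \<in> sets lebesgue"
proof -
  show c: "convex K" "compact K" "closed K"
    using elem_simplex convex_simplex compact_simplex closed_simplex by auto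
  then show b: "bounded K" by (simp add: compact_imp_bounded)
  show l: "K \<in> lmeasurable" using c by (simp add: lmeasurable_compact)
  then show "K \<in> sets lebesgue" by (simp add: fmeasurableD)
qed

lemma elem_interior: "interior K \<noteq> {}" "negligible (K - interior K)" "closure (interior K) = K"
proof -
  have "aff_dim K = int DIM('a)" using aff_dim_simplex[OF elem_simplex] by simp
  then have "affine hull K = UNIV" by (simp only: aff_dim_eq_full)
  then have "rel_interior K = interior K" by (rule rel_interior_interior)
  moreover have "K \<noteq> {}" using \<open>aff_dim K = int DIM('a)\<close> by auto
  ultimately show i: "interior K \<noteq> {}"
    using rel_interior_eq_empty[OF elem_props(1)] by simp
  have "K - interior K \<subseteq> frontier K" by (simp add: frontier_def elem_props(3) closure_closed)
  then show "negligible (K - interior K)"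
    using negligible_convex_frontier[OF elem_props(1)] negligible_subset by blast
  show "closure (interior K) = K"
    using convex_closure_interior[OF elem_props(1) i] elem_props(3) by simp
qed

lemma elem_in_domain: "interior K \<subseteq> \<Omega>" "K \<subseteq> closure \<Omega>"
proof -
  show "K \<subseteq> closure \<Omega>" using K Union_mesh by blast
  then show "interior K \<subseteq> \<Omega>" using interior_closure_domain interior_mono by metis
qed

lemma verts_nodes: "z \<in> verts K \<Longrightarrow> z \<in> nodes \<T>"
  using K by (auto simp: verts_def nodes_def)

lemma basis_affine: 
  assumes "z \<in> nodes \<T>"
  shows "\<exists>a c. \<forall>x\<in>K. \<phi> z x = a \<bullet> x + c"
  using basis assms K by (auto simp: nodal_basis_def Vh_def)

lemma lam_eq_basis:
  assumes "z \<in> verts K" "x \<in> K"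
  shows "lam \<phi> K z x = \<phi> z x"
proof -
  have "\<phi> z z = 1" using basis verts_nodes[OF assms(1)] by (simp add: nodal_basis_def)
  then show ?thesis
    using elem_affine(1)[OF basis_affine[OF verts_nodes[OF assms(1)]] elem_interior(1) _ assms(2), of z]
      elem_verts(5) assms(1) by (auto simp: lam_def)
qed

lemma lam_delta: "z \<in> verts K \<Longrightarrow> y \<in> verts K \<Longrightarrow> lam \<phi> K z y = (if y = z then 1 else 0)"
  using basis verts_nodes elem_verts(5) by (auto simp: lam_eq_basis nodal_basis_def)

text \<open>An affine function commutes with affine combinations, and its vertex values are 0 and 1.
  Weights of either sign are allowed, so points outside the element get coordinates too.\<close>

lemma lam_affine_sum:
  assumes "sum u (verts K) = 1" "z \<in> verts K"
  shows "lam \<phi> K z (\<Sum>y\<in>verts K. u y *\<^sub>R y) = u z"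
proof -
  have "lam \<phi> K z (\<Sum>y\<in>verts K. u y *\<^sub>R y) = (\<Sum>y\<in>verts K. u y * lam \<phi> K z y)"
  proof -
    have "(\<Sum>y\<in>verts K. u y *\<^sub>R y) - z = (\<Sum>y\<in>verts K. u y *\<^sub>R (y - z))"
      using assms(1) by (simp add: scaleR_diff_right sum_subtractf scaleR_sum_left[symmetric])
    then show ?thesis
      using assms(1) by (simp add: lam_def inner_sum_right distrib_left sum.distrib)
  qed
  also have "\<dots> = (\<Sum>y\<in>verts K. if y = z then u y else 0)"
    using assms(2) by (intro sum.cong) (auto simp: lam_delta)
  also have "\<dots> = u z" using assms(2) elem_verts(2) by simp
  finally show ?thesis .
qed

lemma lam_repr: "(\<Sum>z\<in>verts K. lam \<phi> K z x *\<^sub>R z) = x" "(\<Sum>z\<in>verts K. lam \<phi> K z x) = 1"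
proof -
  obtain u where u: "sum u (verts K) = 1" "(\<Sum>y\<in>verts K. u y *\<^sub>R y) = x"
    using affine_hull_verts affine_hull_finite[OF elem_verts(2)] by blast
  have "lam \<phi> K z x = u z" if "z \<in> verts K" for z
    using lam_affine_sum[OF u(1) that] u(2) by simp
  then show "(\<Sum>z\<in>verts K. lam \<phi> K z x *\<^sub>R z) = x" "(\<Sum>z\<in>verts K. lam \<phi> K z x) = 1"
    using u by simp_all
qed

lemma affine_expansion: "g \<bullet> x + c = (\<Sum>z\<in>verts K. lam \<phi> K z x * (g \<bullet> z + c))"
proof -
  have "g \<bullet> x + c = g \<bullet> (\<Sum>z\<in>verts K. lam \<phi> K z x *\<^sub>R z) + c * (\<Sum>z\<in>verts K. lam \<phi> K z x)"
    by (simp add: lam_repr)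
  also have "\<dots> = (\<Sum>z\<in>verts K. lam \<phi> K z x * (g \<bullet> z + c))"
    by (simp add: inner_sum_right sum_distrib_left sum.distrib distrib_left distrib_right mult.commute)
  finally show ?thesis .
qed

lemma lam_nonneg_imp_mem:
  assumes "\<And>z. z \<in> verts K \<Longrightarrow> 0 \<le> lam \<phi> K z x"
  shows "x \<in> K"
proof -
  have "\<exists>u. (\<forall>z\<in>verts K. 0 \<le> u z) \<and> sum u (verts K) = 1 \<and> (\<Sum>z\<in>verts K. u z *\<^sub>R z) = x"
    using lam_repr assms by (intro exI[of _ "\<lambda>z. lam \<phi> K z x"]) blast
  then have "x \<in> convex hull (verts K)"
    unfolding convex_hull_finite[OF elem_verts(2)] by blast
  then show ?thesis using elem_verts(4) by simp
qed

lemma lam_range: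
  assumes "z \<in> verts K" "x \<in> K"
  shows "0 \<le> lam \<phi> K z x" "lam \<phi> K z x \<le> 1"
proof -
  have "x \<in> convex hull (verts K)" using assms(2) elem_verts(4) by simp
  then obtain u where u: "\<forall>y\<in>verts K. 0 \<le> u y" "sum u (verts K) = 1" "(\<Sum>y\<in>verts K. u y *\<^sub>R y) = x"
    unfolding convex_hull_finite[OF elem_verts(2)] by blast
  have e: "lam \<phi> K z x = u z" using lam_affine_sum[OF u(2) assms(1)] u(3) by simp
  then show "0 \<le> lam \<phi> K z x" using u(1) assms(1) by simp
  have "u z \<le> sum u (verts K)" using u(1) assms(1) elem_verts(2) by (intro member_le_sum) auto
  then show "lam \<phi> K z x \<le> 1" using e u(2) by simp
qed

lemma diameter_pos: "diameter K > 0"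
proof -
  obtain x r where xr: "r > 0" "ball x r \<subseteq> K"
    using elem_interior(1) mem_interior by (metis all_not_in_conv)
  then have "diameter (ball x r) \<le> diameter K" using elem_props(4) diameter_subset by blast
  then show ?thesis using xr(1) by simp
qed

text \<open>Taking a ball with more than half of the supremal diameter avoids showing that the
  supremum is attained; this is why the factor is 4 and not 2.\<close>

lemma inball: "\<exists>x0 r. cball x0 r \<subseteq> K \<and> diameter K < 4 * \<kappa> * r \<and> 0 < r"
proof -
  let ?X = "{2 * r |r. 0 \<le> r \<and> (\<exists>x. cball x r \<subseteq> K)}"
  have d: "diameter K \<le> \<kappa> * Sup ?X" using reg K by (auto simp: shape_regular_def inball_diameter_def)
  have "Sup ?X > 0"
    by (rule zero_less_mult_pos[OF less_le_trans[OF diameter_pos d] kappa])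
  then have "Sup ?X / 2 < Sup ?X" by simp
  moreover have "?X \<noteq> {}"
  proof -
    obtain x where "x \<in> K" using elem_interior(1) interior_subset by blast
    then have "cball x 0 \<subseteq> K" by simp
    then have "2 * 0 \<in> ?X" by blast
    then show ?thesis by blast
  qed
  ultimately obtain r x where r: "Sup ?X / 2 < 2 * r" "0 \<le> r" "cball x r \<subseteq> K"
    using less_cSupD[of ?X "Sup ?X / 2"] by blast
  have "\<kappa> * Sup ?X < \<kappa> * (4 * r)" using r(1) kappa by (intro mult_strict_left_mono) auto
  then have "diameter K < 4 * \<kappa> * r" using d by simp
  moreover have "r > 0" using r(1) \<open>Sup ?X > 0\<close> by linarith
  ultimately show ?thesis using r by blast
qed

text \<open>The inverse estimate. Along a diameter of an inscribed ball in the direction of its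
  gradient, the coordinate varies by 2r times the gradient norm, yet its values lie in
  [0,1].\<close>

lemma norm_grad_basis:
  assumes "z \<in> verts K"
  shows "norm (elem_grad (\<phi> z) K) \<le> 2 * \<kappa> / diameter K"
proof -
  obtain x0 r where r: "cball x0 r \<subseteq> K" "diameter K < 4 * \<kappa> * r" "0 < r" using inball by blast
  define a where "a = elem_grad (\<phi> z) K"
  have "2 * r * norm a \<le> 1"
  proof (cases "a = 0")
    case False
    define y where "y = (r / norm a) *\<^sub>R a"
    have ny: "norm y = r" using False r(3) by (simp add: y_def)
    have "x0 + y \<in> K" "x0 - y \<in> K" using r(1) ny by (auto simp: dist_norm)
    then have "lam \<phi> K z (x0 + y) - lam \<phi> K z (x0 - y) \<le> 1"
      using lam_range[OF assms, of "x0 + y"] lam_range[OF assms, of "x0 - y"] by linarith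
    moreover have "lam \<phi> K z (x0 + y) - lam \<phi> K z (x0 - y) = 2 * (a \<bullet> y)"
      by (simp add: lam_def a_def inner_diff_right inner_add_right)
    moreover have "a \<bullet> y = r * norm a"
      using False by (simp add: y_def power2_norm_eq_inner[symmetric] power2_eq_square)
    ultimately show ?thesis by simp
  qed simp
  then have "norm a \<le> 1 / (2 * r)" using r(3) by (simp add: field_simps)
  also have "\<dots> \<le> 2 * \<kappa> / diameter K"
    using r diameter_pos by (simp add: field_simps)
  finally show ?thesis by (simp add: a_def)
qed

text \<open>The coordinate of \<open>z\<close> falls from 1 to 0 along the edge, and its slope is
  bounded, so the edge cannot be short.\<close>

lemma diameter_le_edge:
  assumes "z \<in> verts K" "y \<in> verts K" "z \<noteq> y"
  shows "diameter K \<le> 2 * \<kappa> * dist z y"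
proof -
  have "1 = lam \<phi> K z z - lam \<phi> K z y" using assms by (simp add: lam_delta)
  also have "\<dots> = elem_grad (\<phi> z) K \<bullet> (z - y)" by (simp add: lam_def inner_diff_right)
  also have "\<dots> \<le> norm (elem_grad (\<phi> z) K) * norm (z - y)" by (rule norm_cauchy_schwarz)
  also have "\<dots> \<le> 2 * \<kappa> / diameter K * norm (z - y)"
    using norm_grad_basis[OF assms(1)] by (intro mult_right_mono) auto
  finally show ?thesis using diameter_pos by (simp add: field_simps dist_norm)
qed

end

text \<open>The intersection is a face of either simplex, hence the hull of some vertices of each.
  Its extreme points show that both vertex sets coincide, and its dimension counts them.\<close>

lemma face_adjacent_verts:
  assumes K: "K \<in> \<T>" "K' \<in> \<T>" and adj: "face_adjacent K K'"
  obtains c z z' where "verts K = insert z c" "verts K' = insert z' c" "z \<notin> c" "z' \<notin> c" "card c = DIM('a)"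
    "K \<inter> K' = convex hull c"
proof -
  have 1: "(K \<inter> K') face_of convex hull (verts K)" using inter_face[OF K] elem_verts(4)[OF K(1)] by simp
  have 2: "(K \<inter> K') face_of convex hull (verts K')" using inter_face[OF K(2,1)] elem_verts(4)[OF K(2)] by (simp add: Int_commute)
  obtain c where c: "c \<subseteq> verts K" "K \<inter> K' = convex hull c"
    using 1 face_of_convex_hull_affine_independent[OF elem_verts(1)[OF K(1)]] by auto
  obtain c' where c': "c' \<subseteq> verts K'" "K \<inter> K' = convex hull c'"
    using 2 face_of_convex_hull_affine_independent[OF elem_verts(1)[OF K(2)]] by auto
  have i: "\<not> affine_dependent c" "\<not> affine_dependent c'"
    using c(1) c'(1) elem_verts(1) K affine_independent_subset by blast+
  have "c = c'"
    using extreme_point_of_convex_hull_affine_independent[OF i(1)]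
      extreme_point_of_convex_hull_affine_independent[OF i(2)] c(2) c'(2) by auto
  have cc: "card c = DIM('a)"
    using aff_dim_affine_independent[OF i(1)] adj c(2) aff_dim_convex_hull[of c]
    by (simp add: face_adjacent_def)
  have "\<exists>z. verts L = insert z c \<and> z \<notin> c" if "c \<subseteq> verts L" "L \<in> \<T>" for L
  proof -
    have "card (verts L - c) = 1"
      using that cc elem_verts[OF that(2)] finite_subset by (subst card_Diff_subset) auto
    then obtain z where "verts L - c = {z}" by (rule card_1_singletonE)
    then show ?thesis using that(1) by blast
  qed
  note ex = this
  obtain z where z: "verts K = insert z c" "z \<notin> c" using ex[OF c(1) K(1)] by blast
  obtain z' where z': "verts K' = insert z' c" "z' \<notin> c"
    using ex[of K'] c'(1) K(2) unfolding \<open>c = c'\<close> by blast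
  show ?thesis by (rule that[OF z(1) z'(1) z(2) z'(2) cc c(2)])
qed

text \<open>The facet has at least two vertices, so the elements share an edge, which is long
  relative to \<open>K\<close> and fits into \<open>K'\<close>.\<close>

lemma face_adjacent_diameter:
  assumes "K \<in> \<T>" "K' \<in> \<T>" "face_adjacent K K'"
  shows "diameter K \<le> 2 * \<kappa> * diameter K'"
proof -
  obtain c z z' where c: "verts K = insert z c" "verts K' = insert z' c" "card c = DIM('a)"
    by (rule face_adjacent_verts[OF assms])
  have "finite c" using c(3) dim by (intro card_ge_0_finite) simp
  then obtain x y where xy: "x \<in> c" "y \<in> c" "x \<noteq> y"
    using card_le_Suc0_iff_eq[of c] c(3) dim by auto
  have "diameter K \<le> 2 * \<kappa> * dist x y"
    using xy c by (intro diameter_le_edge[OF assms(1)]) auto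
  also have "\<dots> \<le> 2 * \<kappa> * diameter K'"
    using xy c kappa elem_verts(5)[OF assms(2)] elem_props(4)[OF assms(2)]
    by (intro mult_left_mono diameter_bounded_bound) auto
  finally show ?thesis .
qed

end

section \<open>Balls across a common facet\<close>

context fe_mesh begin

text \<open>The centre is the barycentre of the facet, where each coordinate of a facet vertex
  equals 1/d. Since coordinate gradients are at most 2\<kappa>/h, these coordinates stay nonnegative
  within distance h/(2\<kappa>d), and only the coordinate of the opposite vertex decides membership.
  Its gradient on \<open>K\<close> is the normal \<open>a\<close>.\<close>

lemma face_ball:
  assumes K: "K \<in> \<T>" "K' \<in> \<T>" and adj: "face_adjacent K K'"
  obtains x0 a where
    "\<And>x. x \<in> ball x0 (min (diameter K) (diameter K') / (2 * \<kappa> * DIM('a))) \<Longrightarrow> 0 \<le> a \<bullet> (x - x0) \<Longrightarrow> x \<in> K"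
    "\<And>x. x \<in> ball x0 (min (diameter K) (diameter K') / (2 * \<kappa> * DIM('a))) \<Longrightarrow> a \<bullet> (x - x0) \<le> 0 \<Longrightarrow> x \<in> K'"
    "\<And>v. \<forall>L\<in>{K, K'}. \<exists>a c. \<forall>x\<in>L. v x = a \<bullet> x + c \<Longrightarrow> \<exists>s. elem_grad v K = elem_grad v K' + s *\<^sub>R a"
proof -
  define \<rho> where "\<rho> = min (diameter K) (diameter K') / (2 * \<kappa> * DIM('a))"
  obtain c z z' where c: "verts K = insert z c" "verts K' = insert z' c" "z \<notin> c" "z' \<notin> c" "card c = DIM('a)"
    "K \<inter> K' = convex hull c"
    by (rule face_adjacent_verts[OF assms])
  have fc: "finite c" using elem_verts(2)[OF K(1)] c(1) by simp
  define x0 where "x0 = (\<Sum>y\<in>c. (1 / DIM('a)) *\<^sub>R y)"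
  define a where "a = elem_grad (\<phi> z) K"
  have x0: "lam \<phi> L y x0 = (if y \<in> c then 1 / DIM('a) else 0)"
    if "L \<in> \<T>" "verts L = insert w c" "w \<notin> c" "y \<in> verts L" for L w y
  proof -
    let ?u = "\<lambda>y. if y \<in> c then 1 / real DIM('a) else 0"
    have "sum ?u (verts L) = 1" using that(3) fc c(5) by (simp add: that(2))
    moreover have "(\<Sum>y\<in>verts L. ?u y *\<^sub>R y) = x0" 
      using that(3) fc by (simp add: that(2) x0_def)
    ultimately show ?thesis using lam_affine_sum[OF that(1), of ?u y] that(4) by simp
  qed
  have shift: "lam \<phi> L y x = lam \<phi> L y x0 + elem_grad (\<phi> y) L \<bullet> (x - x0)" for L y x
    by (simp add: lam_def inner_diff_right)
  have lz: "lam \<phi> K z x = a \<bullet> (x - x0)" for x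
    using shift[of K z x] x0[OF K(1) c(1,3), of z] c by (simp add: a_def)
  have pos: "0 \<le> lam \<phi> L y x"
    if L: "L \<in> \<T>" "verts L = insert w c" "w \<notin> c" "y \<in> c" "\<rho> \<le> diameter L / (2 * \<kappa> * DIM('a))"
      and x: "x \<in> ball x0 \<rho>" for L w y x
  proof -
    have y: "y \<in> verts L" using L by simp
    have "norm (x - x0) \<le> diameter L / (2 * \<kappa> * DIM('a))" using x L(5) by (simp add: dist_norm norm_minus_commute)
    then have "norm (elem_grad (\<phi> y) L) * norm (x - x0) \<le> 2 * \<kappa> / diameter L * (diameter L / (2 * \<kappa> * DIM('a)))"
      using norm_grad_basis[OF L(1) y] kappa diameter_pos[OF L(1)] by (intro mult_mono) auto
    also have "\<dots> = 1 / DIM('a)" using kappa diameter_pos[OF L(1)] by simp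
    finally have "\<bar>elem_grad (\<phi> y) L \<bullet> (x - x0)\<bar> \<le> 1 / DIM('a)"
      using Cauchy_Schwarz_ineq2[of "elem_grad (\<phi> y) L" "x - x0"] by linarith
    moreover have "lam \<phi> L y x0 = 1 / DIM('a)" using x0[OF L(1-3) y] L(4) by simp
    ultimately show ?thesis unfolding shift[of L y x] by linarith
  qed
  have \<rho>: "\<rho> \<le> diameter K / (2 * \<kappa> * DIM('a))" "\<rho> \<le> diameter K' / (2 * \<kappa> * DIM('a))"
    using kappa by (auto simp: \<rho>_def intro!: divide_right_mono)
  have \<rho>0: "\<rho> > 0" using kappa diameter_pos[OF K(1)] diameter_pos[OF K(2)] by (simp add: \<rho>_def)
  have inK: "x \<in> K" if "x \<in> ball x0 \<rho>" "0 \<le> a \<bullet> (x - x0)" for x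
  proof (rule lam_nonneg_imp_mem[OF K(1)])
    fix y assume "y \<in> verts K"
    then show "0 \<le> lam \<phi> K y x"
      using pos[OF K(1) c(1,3) _ \<rho>(1) that(1), of y] lz[of x] that(2) c(1) by auto
  qed
  \<comment> \<open>An affine function vanishing at the facet vertices is a multiple of the
    coordinate of \<open>z\<close>. This serves both the opposite coordinate of \<open>K'\<close>
    and the jump of the gradient.\<close>
  have expand: "D x = a \<bullet> (x - x0) * D z" if "\<And>x. D x = g \<bullet> x + e" "\<And>y. y \<in> c \<Longrightarrow> D y = 0" for D :: "'a \<Rightarrow> real" and g e x
  proof -
    have "D x = (\<Sum>y\<in>verts K. lam \<phi> K y x * D y)"
      using affine_expansion[OF K(1), of g x e] by (simp add: that(1))
    also have "\<dots> = a \<bullet> (x - x0) * D z" using c(1,3) fc by (simp add: that(2) lz)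
    finally show ?thesis .
  qed
  define t where "t = lam \<phi> K' z' z"
  have lz': "lam \<phi> K' z' x = a \<bullet> (x - x0) * t" for x
    unfolding t_def
  proof (rule expand)
    show "lam \<phi> K' z' x = elem_grad (\<phi> z') K' \<bullet> x + (1 - elem_grad (\<phi> z') K' \<bullet> z')" for x
      by (simp add: lam_def inner_diff_right)
    show "lam \<phi> K' z' y = 0" if "y \<in> c" for y
      using that c by (auto simp: lam_delta[OF K(2)])
  qed
  \<comment> \<open>Otherwise a small step from the barycentre towards \<open>z\<close> would stay
    in both elements, hence in the hull of the facet vertices, although it leaves their
    hyperplane.\<close>
  have t: "t < 0"
  proof (rule ccontr)
    assume "\<not> t < 0"
    then have t0: "t \<ge> 0" by simp
    have lzz: "a \<bullet> (z - x0) = 1" using lz[of z] c(1) by (simp add: lam_delta[OF K(1)])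
    then have "z \<noteq> x0" by auto
    define \<epsilon> where "\<epsilon> = \<rho> / (2 * norm (z - x0))"
    define x where "x = x0 + \<epsilon> *\<^sub>R (z - x0)"
    have e: "\<epsilon> > 0" using \<rho>0 \<open>z \<noteq> x0\<close> by (simp add: \<epsilon>_def)
    have ax: "a \<bullet> (x - x0) = \<epsilon>" by (simp add: x_def lzz)
    have xb: "x \<in> ball x0 \<rho>" using \<rho>0 \<open>z \<noteq> x0\<close> e by (simp add: x_def dist_norm \<epsilon>_def)
    have "x \<in> K" using inK xb ax e by simp
    moreover have "x \<in> K'"
    proof (rule lam_nonneg_imp_mem[OF K(2)])
      fix y assume "y \<in> verts K'"
      then show "0 \<le> lam \<phi> K' y x"
        using pos[OF K(2) c(2,4) _ \<rho>(2) xb, of y] lz'[of x] ax e t0 c(2) by auto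
    qed
    ultimately have "x \<in> convex hull c" using c(6) by blast
    also have "convex hull c \<subseteq> {x. a \<bullet> x = a \<bullet> x0}"
    proof (rule hull_minimal)
      show "c \<subseteq> {x. a \<bullet> x = a \<bullet> x0}"
      proof
        fix y assume "y \<in> c"
        then have "lam \<phi> K z y = 0" using c by (auto simp: lam_delta[OF K(1)])
        then show "y \<in> {x. a \<bullet> x = a \<bullet> x0}" by (simp add: lz inner_diff_right)
      qed
    qed (rule convex_hyperplane)
    finally show False using ax e by (simp add: inner_diff_right)
  qed
  have inK': "x \<in> K'" if "x \<in> ball x0 \<rho>" "a \<bullet> (x - x0) \<le> 0" for x
  proof (rule lam_nonneg_imp_mem[OF K(2)])
    fix y assume "y \<in> verts K'"
    then show "0 \<le> lam \<phi> K' y x"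
      using pos[OF K(2) c(2,4) _ \<rho>(2) that(1), of y] lz'[of x] that(2) t c(2)
      by (auto simp: mult_nonpos_nonpos)
  qed
  have jump: "\<exists>s. elem_grad v K = elem_grad v K' + s *\<^sub>R a"
    if v: "\<forall>L\<in>{K, K'}. \<exists>a c. \<forall>x\<in>L. v x = a \<bullet> x + c" for v
  proof -
    have "c \<noteq> {}" using c(5) by auto
    then obtain y0 where y0: "y0 \<in> c" by blast
    then have y0K: "y0 \<in> K" "y0 \<in> K'"
      using c elem_verts(5) K by blast+
    let ?J = "elem_grad v K - elem_grad v K'"
    define D where "D x = ?J \<bullet> (x - y0)" for x
    have "D y = 0" if "y \<in> c" for y
    proof -
      have "y \<in> K" "y \<in> K'" using that c elem_verts(5) K by blast+
      then show ?thesis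
        using elem_affine(1)[of K v y0 y] elem_affine(1)[of K' v y0 y] v y0K elem_interior(1) K
        by (auto simp: D_def inner_diff_left)
    qed
    moreover have "D x = ?J \<bullet> x + (- (?J \<bullet> y0))" for x by (simp add: D_def inner_diff_right)
    ultimately have D: "D x = a \<bullet> (x - x0) * D z" for x using expand by blast
    have "?J \<bullet> y = (D z *\<^sub>R a) \<bullet> y" for y
      using D[of "x0 + y"] D[of x0] by (simp add: D_def inner_diff_right inner_add_right algebra_simps)
    then have "?J = D z *\<^sub>R a" by (metis vector_eq_ldot inner_commute)
    then have "elem_grad v K = elem_grad v K' + D z *\<^sub>R a" by (simp add: algebra_simps)
    then show ?thesis by blast
  qed
  show ?thesis by (rule that[OF inK inK' jump]) (simp_all add: \<rho>_def)
qed

text \<open>An inscribed ball of radius r forces a diameter of at least 2r. The bound makes powers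
  of 2\<kappa> monotone in the exponent and keeps the radius at a facet below both
  diameters.\<close>

lemma kappa_gt_half: "K \<in> \<T> \<Longrightarrow> 1 / 2 < \<kappa>"
proof -
  assume K: "K \<in> \<T>"
  obtain x0 r where r: "cball x0 r \<subseteq> K" "diameter K < 4 * \<kappa> * r" "0 < r" using inball[OF K] by blast
  have "2 * r \<le> diameter K" using diameter_subset[OF r(1) elem_props(4)[OF K]] r(3) by simp
  then have "2 * r < 4 * \<kappa> * r" using r(2) by simp
  then show ?thesis using r(3) by (simp add: field_simps)
qed

lemma measure_elem_le:
  assumes "K \<in> \<T>"
  shows "measure lebesgue K \<le> unit_ball_vol DIM('a) * diameter K ^ DIM('a)"
proof -
  obtain y where y: "y \<in> K" using elem_interior(1)[OF assms] interior_subset by blast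
  have "K \<subseteq> cball y (diameter K)"
    using diameter_bounded_bound[OF elem_props(4)[OF assms] y] by auto
  then have "measure lebesgue K \<le> measure lebesgue (cball y (diameter K))"
    using elem_props[OF assms] by (intro measure_mono_fmeasurable) auto
  also have "\<dots> = unit_ball_vol DIM('a) * diameter K ^ DIM('a)"
    using diameter_pos[OF assms] by (simp add: content_cball)
  finally show ?thesis .
qed

end

section \<open>Lower bounds for the error on one element and across one facet\<close>

definition load_const :: "real \<Rightarrow> nat \<Rightarrow> real" where
  "load_const \<kappa> d = 2 + 2 * ((8 * \<kappa>) ^ (d + 2) * (32 * (exp 2 * 2 ^ d)\<^sup>2))"

text \<open>The first factor is (\<mu>/R)^d, with \<mu> the smaller diameter and R the radius used
  at the facet; the second is the constant of \<open>face_bubble\<close>.\<close>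

definition jump_const :: "real \<Rightarrow> nat \<Rightarrow> real" where
  "jump_const \<kappa> d = (4 * \<kappa> * d) ^ d * (32 * (2 * exp 3 * 4 ^ d)\<^sup>2)"

locale fe_solution = fe_mesh \<Omega> \<T> \<phi> \<kappa>
  for \<Omega> :: "'a::euclidean_space set" and \<T> \<phi> \<kappa> +
  fixes f u :: "'a \<Rightarrow> real" and gu :: "'a \<Rightarrow> 'a" and uh :: "'a \<Rightarrow> real"
  assumes f: "f \<in> L2 \<Omega>"
    and sol: "poisson_weak_solution \<Omega> f u"
    and gu: "has_weak_gradient \<Omega> u gu"
    and uh: "uh \<in> Vh \<Omega> \<T>"
begin

abbreviation err :: "'a \<Rightarrow> 'a" where "err x \<equiv> gu x - grad uh x"

lemma uh_affine: "K \<in> \<T> \<Longrightarrow> \<exists>a c. \<forall>x\<in>K. uh x = a \<bullet> x + c"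
  using uh by (simp add: Vh_def)

lemma grad_uh:
  assumes "K \<in> \<T>" "x \<in> interior K"
  shows "grad uh x = elem_grad uh K"
  using elem_affine(2)[OF uh_affine[OF assms(1)] elem_interior(1)[OF assms(1)] _ assms(2)]
    interior_subset assms(2) by (intro grad_eqI) blast

context
  fixes K assumes K: "K \<in> \<T>"
begin

lemma int_lebesgue: "interior K \<in> sets lebesgue"
  by (simp add: lborelD borel_open)

text \<open>\<open>K\<close> may touch the frontier of \<open>\<Omega>\<close>, where nothing is
  assumed about \<open>f\<close>; its interior lies in \<open>\<Omega>\<close> and the rest of it is
  a null set.\<close>

lemma f_L2: "f \<in> L2 K"
proof (rule L2_spike_set(1)[OF _ interior_subset int_lebesgue elem_interior(2)[OF K]])
  show "f \<in> L2 (interior K)"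
    by (rule L2_subset[OF f elem_in_domain(1)[OF K] Omega_lebesgue int_lebesgue])
qed

lemma gu_L2: "gu \<in> L2 K"
proof (rule L2_spike_set(1)[OF _ interior_subset int_lebesgue elem_interior(2)[OF K]])
  show "gu \<in> L2 (interior K)"
    using gu by (intro L2_subset[OF _ elem_in_domain(1)[OF K] Omega_lebesgue int_lebesgue])
      (simp add: has_weak_gradient_def)
qed

lemma grad_uh_L2: "grad uh \<in> L2 K"
proof (rule L2_spike(1)[OF L2_const[OF elem_props(5)[OF K]] elem_props(6)[OF K] elem_interior(2)[OF K]])
  show "grad uh x = elem_grad uh K" if "x \<in> K - (K - interior K)" for x
    using that by (intro grad_uh[OF K]) simp
qed

lemma err_L2: "err \<in> L2 K"
  by (rule L2_diff[OF gu_L2 grad_uh_L2 elem_props(6)[OF K]])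

lemma osc_L2: "(\<lambda>x. f x - m) \<in> L2 K"
  by (rule L2_diff[OF f_L2 L2_const[OF elem_props(5)[OF K]] elem_props(6)[OF K]])

text \<open>A bump in an inscribed ball controls the constant \<open>m\<close>, and a constant
  spreads from the ball to all of \<open>K\<close> at the price of a volume ratio. The free
  \<open>m\<close> later becomes the mean of \<open>f\<close>.\<close>

lemma element_load_bound:
  "(diameter K)\<^sup>2 * (L2norm K f)\<^sup>2 \<le> load_const \<kappa> DIM('a) *
    ((L2norm K err)\<^sup>2 + (diameter K)\<^sup>2 * (L2norm K (\<lambda>x. f x - m))\<^sup>2)"
proof -
  define h where "h = diameter K"
  define E where "E = (L2norm K err)\<^sup>2"
  define O2 where "O2 = (L2norm K (\<lambda>x. f x - m))\<^sup>2"
  define d where "d = DIM('a)"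
  define v where "v = unit_ball_vol (real d)"
  define C0 where "C0 = 32 * (exp 2 * 2 ^ d :: real)\<^sup>2"
  have v: "v \<ge> 0" by (simp add: v_def)
  obtain x0 r where r: "cball x0 r \<subseteq> K" "h < 4 * \<kappa> * r" "0 < r"
    using inball[OF K] by (auto simp: h_def)
  \<comment> \<open>Halving the radius puts the closed ball into the interior of \<open>K\<close>:
    the bump becomes a test function on \<open>\<Omega>\<close>, and \<open>grad uh\<close> is
    constant on the ball.\<close>
  define R where "R = r / 2"
  have R: "R > 0" "h \<le> 8 * \<kappa> * R" using r by (simp_all add: R_def)
  have "2 * r \<le> h" using diameter_subset[OF r(1) elem_props(4)[OF K]] r(3) by (simp add: h_def)
  then have Rh: "R \<le> h" using r(3) by (simp add: R_def)
  have "ball x0 r \<subseteq> interior K" using r(1) ball_subset_cball by (intro interior_maximal) (blast, simp)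
  moreover have "cball x0 R \<subseteq> ball x0 r" using r(3) by (auto simp: R_def)
  ultimately have BI: "cball x0 R \<subseteq> interior K" by blast
  then have B\<Omega>: "cball x0 R \<subseteq> \<Omega>" using elem_in_domain(1)[OF K] by blast
  have BK: "ball x0 R \<subseteq> K" using BI interior_subset ball_subset_cball by blast
  have Bl: "ball x0 R \<in> sets lebesgue" by simp
  have e: "(L2norm (ball x0 R) (\<lambda>x. gu x - elem_grad uh K))\<^sup>2 \<le> E"
  proof -
    have "L2norm (ball x0 R) (\<lambda>x. gu x - elem_grad uh K) = L2norm (ball x0 R) err"
    proof (rule L2_spike(2)[OF L2_subset[OF err_L2 BK elem_props(6)[OF K] Bl] Bl negligible_empty])
      show "gu x - elem_grad uh K = err x" if "x \<in> ball x0 R - {}" for x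
      proof -
        have "x \<in> interior K" using that BI ball_subset_cball by blast
        then show ?thesis by (simp add: grad_uh[OF K])
      qed
    qed
    then show ?thesis unfolding E_def using L2norm_mono[OF err_L2 BK elem_props(6)[OF K] Bl] by simp
  qed
  have o: "(L2norm (ball x0 R) (\<lambda>x. f x - m))\<^sup>2 \<le> O2"
    unfolding O2_def by (rule L2norm_mono[OF osc_L2 BK elem_props(6)[OF K] Bl])
  have "m\<^sup>2 * R\<^sup>2 * (v * R ^ d) \<le> C0 * (R\<^sup>2 * (L2norm (ball x0 R) (\<lambda>x. f x - m))\<^sup>2 +
      (L2norm (ball x0 R) (\<lambda>x. gu x - elem_grad uh K))\<^sup>2)"
    using interior_bubble[OF sol gu f open_domain R(1) B\<Omega>, of m "elem_grad uh K"] R(1)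
    by (simp add: content_ball v_def d_def C0_def)
  also have "\<dots> \<le> C0 * (h\<^sup>2 * O2 + E)"
    using e o R(1) Rh by (intro mult_left_mono add_mono mult_mono power_mono) (auto simp: C0_def)
  finally have b: "m\<^sup>2 * R\<^sup>2 * (v * R ^ d) \<le> C0 * (h\<^sup>2 * O2 + E)" .
  have h: "h > 0" using diameter_pos[OF K] by (simp add: h_def)
  have "(L2norm K (\<lambda>x. m))\<^sup>2 \<le> m\<^sup>2 * measure lebesgue K"
    using L2norm_le_const[OF L2_const[OF elem_props(5)[OF K]] elem_props(5)[OF K] negligible_empty, of m "\<bar>m\<bar>"] by simp
  also have "\<dots> \<le> m\<^sup>2 * (v * h ^ d)"
    using measure_elem_le[OF K] by (intro mult_left_mono) (auto simp: v_def h_def d_def)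
  finally have mK: "(L2norm K (\<lambda>x. m))\<^sup>2 \<le> m\<^sup>2 * (v * h ^ d)" .
  have "h\<^sup>2 * (L2norm K (\<lambda>x. m))\<^sup>2 \<le> h\<^sup>2 * (m\<^sup>2 * (v * h ^ d))"
    using mK by (intro mult_left_mono) auto
  also have "\<dots> = m\<^sup>2 * v * h ^ (d + 2)" by (simp add: power_add power2_eq_square)
  \<comment> \<open>The exponent \<open>d + 2\<close> in \<open>load_const\<close>: d factors h/R
    from the volume and two from the weight h^2, each at most 8\<kappa>.\<close>
  also have "\<dots> \<le> m\<^sup>2 * v * (8 * \<kappa> * R) ^ (d + 2)"
    using R h v by (intro mult_left_mono power_mono) auto
  also have "\<dots> = (8 * \<kappa>) ^ (d + 2) * (m\<^sup>2 * R\<^sup>2 * (v * R ^ d))"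
    unfolding power_mult_distrib[of "8 * \<kappa>" R] power_add by simp
  also have "\<dots> \<le> (8 * \<kappa>) ^ (d + 2) * (C0 * (h\<^sup>2 * O2 + E))"
    using b kappa by (intro mult_left_mono) auto
  finally have 1: "h\<^sup>2 * (L2norm K (\<lambda>x. m))\<^sup>2 \<le> (8 * \<kappa>) ^ (d + 2) * (C0 * (h\<^sup>2 * O2 + E))" .
  have "(L2norm K f)\<^sup>2 \<le> 2 * O2 + 2 * (L2norm K (\<lambda>x. m))\<^sup>2"
    using L2_add(2)[OF osc_L2[of m] L2_const[OF elem_props(5)[OF K], of m] elem_props(6)[OF K]]
    by (simp add: O2_def)
  then have "h\<^sup>2 * (L2norm K f)\<^sup>2 \<le> h\<^sup>2 * (2 * O2 + 2 * (L2norm K (\<lambda>x. m))\<^sup>2)"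
    by (rule mult_left_mono) simp
  also have "\<dots> = 2 * (h\<^sup>2 * O2) + 2 * (h\<^sup>2 * (L2norm K (\<lambda>x. m))\<^sup>2)" by (simp add: algebra_simps)
  also have "\<dots> \<le> 2 * (E + h\<^sup>2 * O2) + 2 * ((8 * \<kappa>) ^ (d + 2) * (C0 * (E + h\<^sup>2 * O2)))"
    using 1 by (intro add_mono mult_left_mono) (auto simp: E_def add.commute)
  also have "\<dots> = load_const \<kappa> d * (E + h\<^sup>2 * O2)"
    by (simp add: load_const_def C0_def algebra_simps)
  finally show ?thesis by (simp add: h_def E_def O2_def d_def)
qed

end

lemma jump_bound:
  assumes K: "K \<in> \<T>" "K' \<in> \<T>" and adj: "face_adjacent K K'"
  shows "(norm (elem_grad uh K - elem_grad uh K'))\<^sup>2 *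
      (unit_ball_vol DIM('a) * min (diameter K) (diameter K') ^ DIM('a))
    \<le> jump_const \<kappa> DIM('a) * (((L2norm K err)\<^sup>2 + (diameter K)\<^sup>2 * (L2norm K f)\<^sup>2)
       + ((L2norm K' err)\<^sup>2 + (diameter K')\<^sup>2 * (L2norm K' f)\<^sup>2))"
proof -
  define d where "d = DIM('a)"
  have d: "d > 0" by (simp add: d_def)
  define v where "v = unit_ball_vol (real d)"
  define C0 where "C0 = 32 * (2 * exp 3 * 4 ^ d :: real)\<^sup>2"
  define \<mu> where "\<mu> = min (diameter K) (diameter K')"
  have \<mu>: "\<mu> > 0" using diameter_pos K by (simp add: \<mu>_def)
  obtain x0 a where a: "\<And>x. x \<in> ball x0 (\<mu> / (2 * \<kappa> * DIM('a))) \<Longrightarrow> 0 \<le> a \<bullet> (x - x0) \<Longrightarrow> x \<in> K"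
    "\<And>x. x \<in> ball x0 (\<mu> / (2 * \<kappa> * DIM('a))) \<Longrightarrow> a \<bullet> (x - x0) \<le> 0 \<Longrightarrow> x \<in> K'"
    "\<And>v. \<forall>L\<in>{K, K'}. \<exists>a c. \<forall>x\<in>L. v x = a \<bullet> x + c \<Longrightarrow> \<exists>s. elem_grad v K = elem_grad v K' + s *\<^sub>R a"
    unfolding \<mu>_def using face_ball[OF assms] by blast
  obtain s where s: "elem_grad uh K = elem_grad uh K' + s *\<^sub>R a"
    using a(3)[of uh] uh_affine K by blast
  define \<rho> where "\<rho> = \<mu> / (2 * \<kappa> * d)"
  define R where "R = \<rho> / 2"
  have R: "R > 0" "\<mu> = 4 * \<kappa> * d * R" using \<mu> kappa d by (simp_all add: R_def \<rho>_def)
  have "1 * \<mu> \<le> 4 * \<kappa> * d * \<mu>"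
    using kappa_gt_half[OF K(1)] d \<mu> mult_mono[of 1 "4 * \<kappa>" 1 "real d"] by (intro mult_right_mono) auto
  then have R\<mu>: "R \<le> \<mu>" using R kappa d by (simp add: R(2))
  have \<rho>: "ball x0 \<rho> \<subseteq> K \<union> K'"
  proof
    fix x assume "x \<in> ball x0 \<rho>"
    then show "x \<in> K \<union> K'" using a(1,2)[of x] by (cases "0 \<le> a \<bullet> (x - x0)") (auto simp: \<rho>_def d_def)
  qed
  then have "ball x0 \<rho> \<subseteq> closure \<Omega>" using elem_in_domain(2) K by blast
  \<comment> \<open>This excludes a slit of the domain along the common facet.\<close>
  then have "ball x0 \<rho> \<subseteq> \<Omega>" using interior_closure_domain interior_maximal[OF _ open_ball] by metis
  moreover have B\<rho>: "cball x0 R \<subseteq> ball x0 \<rho>" using R(1) by (auto simp: R_def)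
  ultimately have B\<Omega>: "cball x0 R \<subseteq> \<Omega>" by blast
  let ?B = "ball x0 R"
  define U where "U = K \<union> K'"
  have BU: "?B \<subseteq> U" using B\<rho> \<rho> ball_subset_cball unfolding U_def by blast
  have U: "U \<in> sets lebesgue" using elem_props(6) K by (simp add: U_def)
  have Bl: "?B \<in> sets lebesgue" by simp
  have errU: "err \<in> L2 U" "(L2norm U err)\<^sup>2 \<le> (L2norm K err)\<^sup>2 + (L2norm K' err)\<^sup>2"
    and fU: "f \<in> L2 U" "(L2norm U f)\<^sup>2 \<le> (L2norm K f)\<^sup>2 + (L2norm K' f)\<^sup>2"
    unfolding U_def by (intro L2_Un err_L2 f_L2 elem_props(6) K)+
  define w where "w = (\<lambda>x. if 0 < a \<bullet> (x - x0) then elem_grad uh K' + s *\<^sub>R a else elem_grad uh K')"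
  \<comment> \<open>The sign of \<open>a \<bullet> (x - x0)\<close> tells which element contains
    \<open>x\<close>, so \<open>w\<close> agrees with \<open>grad uh\<close> off the element
    boundaries.\<close>
  have weq: "L2norm ?B (\<lambda>x. gu x - w x) = L2norm ?B err"
  proof (rule L2_spike(2)[OF L2_subset[OF errU(1) BU U Bl] Bl])
    show "negligible ((K - interior K) \<union> (K' - interior K'))"
      using elem_interior(2) K by (intro negligible_Un)
    fix x assume x: "x \<in> ?B - ((K - interior K) \<union> (K' - interior K'))"
    then have xr: "x \<in> ball x0 (\<mu> / (2 * \<kappa> * DIM('a)))"
      using B\<rho> ball_subset_cball unfolding \<rho>_def d_def by blast
    show "gu x - w x = err x"
    proof (cases "0 < a \<bullet> (x - x0)")
      case True
      then have "x \<in> interior K" using a(1)[OF xr] x by auto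
      then show ?thesis using True s by (simp add: w_def grad_uh[OF K(1)])
    next
      case False
      then have "x \<in> interior K'" using a(2)[OF xr] x by auto
      then show ?thesis using False by (simp add: w_def grad_uh[OF K(2)])
    qed
  qed
  have "(norm (s *\<^sub>R a))\<^sup>2 * (v * R ^ d) \<le> C0 * (R\<^sup>2 * (L2norm ?B f)\<^sup>2 + (L2norm ?B (\<lambda>x. gu x - w x))\<^sup>2)"
    using face_bubble[OF sol gu f open_domain R(1) B\<Omega>, of s a "elem_grad uh K'"] R(1)
    by (simp add: content_ball v_def d_def C0_def w_def)
  also have "\<dots> \<le> C0 * (\<mu>\<^sup>2 * ((L2norm K f)\<^sup>2 + (L2norm K' f)\<^sup>2) + ((L2norm K err)\<^sup>2 + (L2norm K' err)\<^sup>2))"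
    unfolding weq using R(1) R\<mu>
      order_trans[OF L2norm_mono[OF fU(1) BU U Bl] fU(2)] order_trans[OF L2norm_mono[OF errU(1) BU U Bl] errU(2)]
    by (intro mult_left_mono add_mono mult_mono power_mono) (auto simp: C0_def)
  also have "\<mu>\<^sup>2 * ((L2norm K f)\<^sup>2 + (L2norm K' f)\<^sup>2) + ((L2norm K err)\<^sup>2 + (L2norm K' err)\<^sup>2)
     \<le> ((L2norm K err)\<^sup>2 + (diameter K)\<^sup>2 * (L2norm K f)\<^sup>2) + ((L2norm K' err)\<^sup>2 + (diameter K')\<^sup>2 * (L2norm K' f)\<^sup>2)"
  proof -
    have "\<mu>\<^sup>2 \<le> (diameter K)\<^sup>2" "\<mu>\<^sup>2 \<le> (diameter K')\<^sup>2" using \<mu> by (auto simp: \<mu>_def intro!: power_mono)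
    then have "\<mu>\<^sup>2 * (L2norm K f)\<^sup>2 \<le> (diameter K)\<^sup>2 * (L2norm K f)\<^sup>2" "\<mu>\<^sup>2 * (L2norm K' f)\<^sup>2 \<le> (diameter K')\<^sup>2 * (L2norm K' f)\<^sup>2"
      by (intro mult_right_mono; simp)+
    then show ?thesis by (simp add: distrib_left)
  qed
  finally have b: "(norm (s *\<^sub>R a))\<^sup>2 * (v * R ^ d) \<le> C0 * (((L2norm K err)\<^sup>2 + (diameter K)\<^sup>2 * (L2norm K f)\<^sup>2) + ((L2norm K' err)\<^sup>2 + (diameter K')\<^sup>2 * (L2norm K' f)\<^sup>2))"
    by (simp add: C0_def)
  have "(norm (elem_grad uh K - elem_grad uh K'))\<^sup>2 * (v * \<mu> ^ d) = (4 * \<kappa> * d) ^ d * ((norm (s *\<^sub>R a))\<^sup>2 * (v * R ^ d))"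
    unfolding s R(2) power_mult_distrib[of "4 * \<kappa> * d" R] by simp
  also have "\<dots> \<le> (4 * \<kappa> * d) ^ d * (C0 * (((L2norm K err)\<^sup>2 + (diameter K)\<^sup>2 * (L2norm K f)\<^sup>2) + ((L2norm K' err)\<^sup>2 + (diameter K')\<^sup>2 * (L2norm K' f)\<^sup>2)))"
    using b kappa by (intro mult_left_mono) auto
  finally show ?thesis by (simp add: jump_const_def C0_def v_def d_def \<mu>_def mult.assoc)
qed

end

section \<open>Vertex stars\<close>

lemma negligible_lowdim:
  fixes S :: "'a::euclidean_space set"
  assumes "aff_dim S < int DIM('a)"
  shows "negligible S"
  using aff_lowdim_subset_hyperplane[OF assms] negligible_hyperplane negligible_subset by metis

lemma open_avoids_negligible:
  assumes "open U" "U \<noteq> {}" "negligible N"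
  obtains x where "x \<in> U" "x \<notin> N"
proof -
  have "\<not> U \<subseteq> N"
    using negligible_subset[OF assms(3)] open_not_negligible[OF assms(1,2)] by blast
  then show ?thesis using that by blast
qed

lemma connected_closed_cover:
  assumes "connected S" "closed A" "closed B" "S \<subseteq> A \<union> B" "A \<inter> S \<noteq> {}" "B \<inter> S \<noteq> {}"
  obtains p where "p \<in> S" "p \<in> A" "p \<in> B"
  using connected_closedD[of S A B] assms by blast

text \<open>Squared because it counts pairs: a path in a finite relation can be shortened to at most
  as many steps as the relation has pairs, and a star has at most (4\<kappa>)^d elements.\<close>

definition chain_len :: "real \<Rightarrow> nat \<Rightarrow> nat" where
  "chain_len \<kappa> d = nat \<lceil>((4 * \<kappa>) ^ d)\<^sup>2\<rceil>"

context fe_mesh begin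

lemma distinct_elements_aff_dim:
  assumes "K \<in> \<T>" "K' \<in> \<T>" "K \<noteq> K'"
  shows "aff_dim (K \<inter> K') < int DIM('a)"
proof (rule ccontr)
  have d: "aff_dim L = int DIM('a)" if "L \<in> \<T>" for L
    using aff_dim_simplex[OF elem_simplex[OF that]] by simp
  assume "\<not> ?thesis"
  then have "\<not> aff_dim (K \<inter> K') < aff_dim K" "\<not> aff_dim (K' \<inter> K) < aff_dim K'"
    using d assms by (simp_all add: Int_commute)
  then have "K \<inter> K' = K" "K' \<inter> K = K'"
    using face_of_aff_dim_lt[OF elem_props(1) inter_face] assms by blast+
  then show False using assms(3) by blast
qed

lemma distinct_elements_interior:
  assumes "K \<in> \<T>" "K' \<in> \<T>" "K \<noteq> K'"
  shows "interior K \<inter> interior K' = {}"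
proof (rule ccontr)
  assume "interior K \<inter> interior K' \<noteq> {}"
  then have "interior (K \<inter> K') \<noteq> {}" by simp
  then have "aff_dim (K \<inter> K') = int DIM('a)" by (rule aff_dim_nonempty_interior)
  then show False using distinct_elements_aff_dim[OF assms] by simp
qed

text \<open>Conformity leaves no hanging nodes: the intersection with an element that has
  \<open>z\<close> as a vertex is a face of both elements, and an extreme point of a face is extreme
  in the whole.\<close>

lemma elements_at_iff:
  assumes "z \<in> nodes \<T>"
  shows "L \<in> elements_at \<T> z \<longleftrightarrow> L \<in> \<T> \<and> z \<in> L"
proof
  assume "L \<in> elements_at \<T> z"
  then show "L \<in> \<T> \<and> z \<in> L" by (simp add: elements_at_def extreme_point_of_def)
next
  assume L: "L \<in> \<T> \<and> z \<in> L"
  obtain K where K: "K \<in> \<T>" "z extreme_point_of K" using assms by (auto simp: nodes_def)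
  then have "z \<in> K" by (simp add: extreme_point_of_def)
  then have "z extreme_point_of (K \<inter> L)"
    using extreme_point_of_face[OF inter_face[OF K(1)], of L z] L K(2) by blast
  then have "z extreme_point_of L"
    using extreme_point_of_face[OF inter_face[of L K], of z] L K(1) by (simp add: Int_commute)
  then show "L \<in> elements_at \<T> z" using L by (simp add: elements_at_def)
qed

definition star_rel :: "'a \<Rightarrow> ('a set \<times> 'a set) set" where
  "star_rel z = {(K, K'). K \<in> elements_at \<T> z \<and> K' \<in> elements_at \<T> z \<and> face_adjacent K K'}"

text \<open>The elements avoiding \<open>z\<close> form a closed set, so near \<open>z\<close> the
  domain is covered by the star. A small ball settles interior nodes; boundary nodes use the local
  condition in \<open>polyhedral_domain\<close>.\<close>

lemma node_neighbourhood:
  assumes z: "z \<in> nodes \<T>"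
  obtains V where "open V" "z \<in> V" "connected (V \<inter> \<Omega>)" "V \<inter> \<Omega> \<subseteq> \<Union>(elements_at \<T> z)"
proof -
  define U where "U = - \<Union>{L \<in> \<T>. z \<notin> L}"
  have "closed (\<Union>{L \<in> \<T>. z \<notin> L})"
    using finite_mesh elem_props(3) by (intro closed_Union) auto
  then have U: "open U" "z \<in> U" by (auto simp: U_def)
  have sub: "V \<inter> \<Omega> \<subseteq> \<Union>(elements_at \<T> z)" if "V \<subseteq> U" for V
  proof
    fix x assume x: "x \<in> V \<inter> \<Omega>"
    then have "x \<in> closure \<Omega>" using closure_subset by blast
    then obtain L where "L \<in> \<T>" "x \<in> L" using Union_mesh by blast
    moreover have "z \<in> L" using x that calculation unfolding U_def by blast
    ultimately show "x \<in> \<Union>(elements_at \<T> z)" using elements_at_iff[OF z] by blast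
  qed
  obtain K where K: "K \<in> \<T>" "z \<in> K" using z by (auto simp: nodes_def extreme_point_of_def)
  then have zc: "z \<in> closure \<Omega>" using elem_in_domain(2) by blast
  show ?thesis
  proof (cases "z \<in> \<Omega>")
    case True
    then have "open (U \<inter> \<Omega>)" "z \<in> U \<inter> \<Omega>" using U open_domain by auto
    then obtain \<epsilon> where e: "\<epsilon> > 0" "ball z \<epsilon> \<subseteq> U \<inter> \<Omega>" by (meson open_contains_ball)
    then have "ball z \<epsilon> \<inter> \<Omega> = ball z \<epsilon>" by blast
    then show ?thesis using e by (intro that[of "ball z \<epsilon>"] sub) auto
  next
    case False
    then have "z \<in> frontier \<Omega>" using zc open_domain by (simp add: frontier_def interior_open)
    then obtain V where "open V" "z \<in> V" "V \<subseteq> U" "connected (V \<inter> \<Omega>)"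
      using dom U unfolding polyhedral_domain_def by blast
    then show ?thesis by (intro that[of V] sub)
  qed
qed

text \<open>If the unions of \<open>\<C>\<close> and \<open>\<D>\<close> met only in faces of codimension at least two, a generic short
  segment near a common point, running from one union to the other, would avoid all of these faces.\<close>

lemma star_split:
  assumes z: "z \<in> nodes \<T>" and un: "elements_at \<T> z = \<C> \<union> \<D>" and ne: "\<C> \<noteq> {}" "\<D> \<noteq> {}"
    and disj: "\<C> \<inter> \<D> = {}"
  shows "\<exists>A\<in>\<C>. \<exists>B\<in>\<D>. face_adjacent A B"
proof -
  have sT: "L \<in> \<T>" "z \<in> L" if "L \<in> \<C> \<union> \<D>" for L
    using that un elements_at_iff[OF z] by auto
  have fin: "finite \<C>" "finite \<D>"
    using finite_subset[OF _ finite_mesh] sT by blast+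
  have cl: "closed (\<Union>\<C>)" "closed (\<Union>\<D>)"
    using fin sT elem_props(3) by (auto intro!: closed_Union)
  obtain V where V: "open V" "z \<in> V" "connected (V \<inter> \<Omega>)" "V \<inter> \<Omega> \<subseteq> \<Union>(elements_at \<T> z)"
    using node_neighbourhood[OF z] by blast
  define W where "W = V \<inter> \<Omega>"
  have W: "open W" "connected W" "W \<subseteq> \<Union>\<C> \<union> \<Union>\<D>"
    using V open_domain un by (auto simp: W_def)
  have meet: "interior L \<inter> S \<noteq> {}" if "L \<in> \<T>" "p \<in> L" "p \<in> S" "open S" for L S p
    using elem_interior(3)[OF that(1)] that open_Int_closure_eq_empty[of S "interior L"] by blast
  have meetW: "\<Union>\<F> \<inter> W \<noteq> {}" if "\<F> \<subseteq> \<C> \<union> \<D>" "\<F> \<noteq> {}" for \<F>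
  proof -
    obtain L where L: "L \<in> \<F>" using \<open>\<F> \<noteq> {}\<close> by auto
    then have "L \<in> \<T>" "z \<in> L" using sT that by blast+
    then have "interior L \<inter> V \<noteq> {}" using meet V(1,2) by blast
    moreover have "interior L \<subseteq> \<Omega>" by (rule elem_in_domain(1)[OF \<open>L \<in> \<T>\<close>])
    ultimately show ?thesis using L interior_subset[of L] unfolding W_def by blast
  qed
  obtain p where p: "p \<in> W" "p \<in> \<Union>\<C>" "p \<in> \<Union>\<D>"
    using connected_closed_cover[OF W(2) cl W(3)] meetW[of \<C>] meetW[of \<D>] ne by blast
  then obtain r where r: "r > 0" "ball p r \<subseteq> W" using W(1) by (meson open_contains_ball)
  obtain K1 K2 where K: "K1 \<in> \<C>" "p \<in> K1" "K2 \<in> \<D>" "p \<in> K2" using p by blast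
  define \<F> where "\<F> = {F. \<exists>A\<in>\<T>. \<exists>B\<in>\<T>. F = A \<inter> B \<and> aff_dim F \<le> int DIM('a) - 2}"
  have finF: "finite \<F>"
  proof (rule finite_subset)
    show "\<F> \<subseteq> (\<lambda>(A, B). A \<inter> B) ` (\<T> \<times> \<T>)" by (auto simp: \<F>_def)
  qed (simp add: finite_mesh)
  have "negligible (\<Union>\<F>)"
    using finF by (rule negligible_Union) (auto simp: \<F>_def intro!: negligible_lowdim)
  moreover have "interior K1 \<inter> ball p r \<noteq> {}" using meet[of K1 p "ball p r"] sT K r(1) by simp
  ultimately obtain x where x: "x \<in> interior K1 \<inter> ball p r" "x \<notin> \<Union>\<F>"
    using open_avoids_negligible[of "interior K1 \<inter> ball p r"] by blast
  \<comment> \<open>Joining \<open>x\<close> to a face raises the dimension to at most d - 1. If the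
    segment from \<open>x\<close> to \<open>x'\<close> met a face in \<open>q\<close>, then
    \<open>x'\<close> would lie on the line through \<open>x\<close> and \<open>q\<close>, hence in
    one of these null sets.\<close>
  have "negligible (\<Union>((\<lambda>F. affine hull (insert x F)) ` \<F>))"
  proof (rule negligible_Union)
    fix T assume "T \<in> (\<lambda>F. affine hull (insert x F)) ` \<F>"
    then obtain F where F: "F \<in> \<F>" "T = affine hull (insert x F)" by blast
    then have "aff_dim T < int DIM('a)" by (auto simp: \<F>_def aff_dim_insert aff_dim_affine_hull)
    then show "negligible T" by (rule negligible_lowdim)
  qed (simp add: finF)
  moreover have "interior K2 \<inter> ball p r \<noteq> {}" using meet[of K2 p "ball p r"] sT K r(1) by simp
  ultimately obtain x' where x': "x' \<in> interior K2 \<inter> ball p r" "\<And>F. F \<in> \<F> \<Longrightarrow> x' \<notin> affine hull (insert x F)"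
    using open_avoids_negligible[of "interior K2 \<inter> ball p r"] by (metis (no_types, lifting) UN_iff open_Int open_ball open_interior)
  have seg: "closed_segment x x' \<subseteq> W"
    using x(1) x'(1) r(2) closed_segment_subset[of x "ball p r" x'] convex_ball by blast
  have "x \<in> \<Union>\<C> \<inter> closed_segment x x'" "x' \<in> \<Union>\<D> \<inter> closed_segment x x'"
    using x(1) x'(1) K interior_subset by auto
  then obtain q where q: "q \<in> closed_segment x x'" "q \<in> \<Union>\<C>" "q \<in> \<Union>\<D>"
    using connected_closed_cover[OF connected_segment(1) cl, of x x'] seg W(3) by blast
  then obtain A B where AB: "A \<in> \<C>" "B \<in> \<D>" "q \<in> A \<inter> B" by blast
  then have ABT: "A \<in> \<T>" "B \<in> \<T>" "A \<noteq> B" using sT disj by blast+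
  have "\<not> aff_dim (A \<inter> B) \<le> int DIM('a) - 2"
  proof
    assume "aff_dim (A \<inter> B) \<le> int DIM('a) - 2"
    then have F: "A \<inter> B \<in> \<F>" using ABT by (auto simp: \<F>_def)
    then have "q \<noteq> x" using x(2) AB(3) by blast
    obtain t where t: "q = (1 - t) *\<^sub>R x + t *\<^sub>R x'" using q(1) by (auto simp: closed_segment_def)
    then have t0: "t \<noteq> 0" using \<open>q \<noteq> x\<close> by auto
    have "x' = (1 - 1 / t) *\<^sub>R x + (1 / t) *\<^sub>R q"
      using t0 unfolding t by (simp add: algebra_simps)
    moreover have "x \<in> affine hull (insert x (A \<inter> B))" "q \<in> affine hull (insert x (A \<inter> B))"
      using AB(3) by (auto intro: hull_inc)
    ultimately have "x' \<in> affine hull (insert x (A \<inter> B))"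
      by (auto intro: mem_affine[OF affine_affine_hull])
    then show False using x'(2)[OF F] by blast
  qed
  then have "face_adjacent A B"
    using distinct_elements_aff_dim[OF ABT] by (simp add: face_adjacent_def)
  then show ?thesis using AB by blast
qed

text \<open>Otherwise the elements reachable from \<open>K\<close> and the remaining ones would
  split the star, and \<open>star_split\<close> would join a pair across the split.\<close>

lemma star_connected:
  assumes z: "z \<in> nodes \<T>" and K: "K \<in> elements_at \<T> z" "K' \<in> elements_at \<T> z"
  shows "(K, K') \<in> (star_rel z)\<^sup>*"
proof (rule ccontr)
  assume n: "(K, K') \<notin> (star_rel z)\<^sup>*"
  define \<C> where "\<C> = {L \<in> elements_at \<T> z. (K, L) \<in> (star_rel z)\<^sup>*}"
  define \<D> where "\<D> = elements_at \<T> z - \<C>"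
  have "K \<in> \<C>" "K' \<in> \<D>" using K n by (auto simp: \<C>_def \<D>_def)
  then obtain A B where AB: "A \<in> \<C>" "B \<in> \<D>" "face_adjacent A B"
    using star_split[OF z, of \<C> \<D>] unfolding \<D>_def \<C>_def by blast
  then have "(A, B) \<in> star_rel z" by (auto simp: star_rel_def \<C>_def \<D>_def)
  then have "(K, B) \<in> (star_rel z)\<^sup>*" using AB(1) by (auto simp: \<C>_def)
  then show False using AB(2) by (auto simp: \<C>_def \<D>_def)
qed

lemma finite_star: "finite (elements_at \<T> z)"
  using finite_mesh by (simp add: elements_at_def)

text \<open>Near \<open>z\<close> every element of the star fills a fixed fraction of a small ball.\<close>

lemma card_star:
  assumes z: "z \<in> nodes \<T>"
  shows "real (card (elements_at \<T> z)) \<le> (4 * \<kappa>) ^ DIM('a)"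
proof -
  let ?S = "elements_at \<T> z"
  have sT: "L \<in> \<T>" "z \<in> L" if "L \<in> ?S" for L using that elements_at_iff[OF z] by auto
  have "?S \<noteq> {}" using z by (auto simp: nodes_def elements_at_def)
  \<comment> \<open>With the smallest diameter as scale, every shrinking factor \<open>t\<close>
    below is at most one.\<close>
  define \<epsilon> where "\<epsilon> = Min (diameter ` ?S)"
  have \<epsilon>: "\<epsilon> > 0" using \<open>?S \<noteq> {}\<close> finite_star sT diameter_pos by (auto simp: \<epsilon>_def)
  have \<epsilon>_le: "\<epsilon> \<le> diameter L" if "L \<in> ?S" for L using that finite_star by (simp add: \<epsilon>_def)
  define R where "R = \<epsilon> / (4 * \<kappa>)"
  have R: "R > 0" using \<epsilon> kappa by (simp add: R_def)
  have "\<exists>y. ball y R \<subseteq> interior L \<inter> cball z \<epsilon>" if L: "L \<in> ?S" for L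
  proof -
    note LT = sT[OF L]
    define h where "h = diameter L"
    obtain x0 r where r: "cball x0 r \<subseteq> L" "h < 4 * \<kappa> * r" "0 < r" using inball[OF LT(1)] by (auto simp: h_def)
    have h: "h > 0" using diameter_pos[OF LT(1)] by (simp add: h_def)
    \<comment> \<open>Shrinking \<open>L\<close> towards \<open>z\<close> by the factor
      \<open>t\<close> stays in \<open>L\<close> by convexity, comes within
      \<open>\<epsilon>\<close> of \<open>z\<close>, and turns the inscribed ball, whose radius
      exceeds h/(4\<kappa>), into one of radius at least \<open>R\<close>.\<close>
    define t where "t = \<epsilon> / h"
    have t: "0 < t" "t \<le> 1" using \<epsilon> \<epsilon>_le[OF L] h by (simp_all add: t_def h_def)
    have R_le: "R \<le> t * r" using r(2) \<epsilon> h kappa by (simp add: R_def t_def field_simps)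
    define y where "y = z + t *\<^sub>R (x0 - z)"
    have in_L: "w \<in> L \<inter> cball z \<epsilon>" if w: "w \<in> ball y R" for w
    proof -
      define w' where "w' = x0 + (1 / t) *\<^sub>R (w - y)"
      have "norm (w - y) < R" using w by (simp add: dist_norm norm_minus_commute)
      then have "(1 / t) * norm (w - y) \<le> r" using R_le t(1) by (simp add: field_simps)
      then have w': "w' \<in> L" using r(1) t(1) by (auto simp: w'_def dist_norm)
      have e: "w = (1 - t) *\<^sub>R z + t *\<^sub>R w'"
        using t(1) by (simp add: w'_def y_def algebra_simps)
      then have "w \<in> L" using convexD_alt[OF elem_props(1)[OF LT(1)] LT(2) w'] t by simp
      moreover have "dist z w \<le> \<epsilon>"
      proof -
        have "w - z = t *\<^sub>R (w' - z)" by (simp add: e algebra_simps)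
        then have "dist z w = t * dist z w'" using t(1) by (simp add: dist_norm norm_minus_commute)
        also have "\<dots> \<le> t * h"
          using diameter_bounded_bound[OF elem_props(4)[OF LT(1)] LT(2) w'] t(1) by (simp add: h_def)
        finally show ?thesis using h by (simp add: t_def)
      qed
      ultimately show ?thesis by simp
    qed
    then have "ball y R \<subseteq> L" "ball y R \<subseteq> cball z \<epsilon>" by blast+
    then show ?thesis using interior_maximal[OF _ open_ball] by blast
  qed
  then obtain y where y: "\<And>L. L \<in> ?S \<Longrightarrow> ball (y L) R \<subseteq> interior L \<inter> cball z \<epsilon>" by metis
  have "measure lebesgue (\<Union>((\<lambda>L. ball (y L) R) ` ?S)) = (\<Sum>L\<in>?S. measure lebesgue (ball (y L) R))"
  proof (rule measure_negligible_finite_Union_image[OF finite_star])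
    show "pairwise (\<lambda>L L'. negligible (ball (y L) R \<inter> ball (y L') R)) ?S"
    proof (rule pairwiseI)
      fix L L' assume L: "L \<in> ?S" "L' \<in> ?S" "L \<noteq> L'"
      have "ball (y L) R \<inter> ball (y L') R = {}"
        using y[OF L(1)] y[OF L(2)] distinct_elements_interior[OF sT(1)[OF L(1)] sT(1)[OF L(2)] L(3)] by blast
      then show "negligible (ball (y L) R \<inter> ball (y L') R)" by simp
    qed
  qed simp
  moreover have "measure lebesgue (\<Union>((\<lambda>L. ball (y L) R) ` ?S)) \<le> measure lebesgue (cball z \<epsilon>)"
    using y finite_star by (intro measure_mono_fmeasurable) (auto intro!: fmeasurableD fmeasurable.finite_UN)
  ultimately have "card ?S * (unit_ball_vol DIM('a) * R ^ DIM('a)) \<le> unit_ball_vol DIM('a) * \<epsilon> ^ DIM('a)"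
    using R \<epsilon> by (simp add: content_ball content_cball)
  then have "unit_ball_vol DIM('a) * (card ?S * R ^ DIM('a)) \<le> unit_ball_vol DIM('a) * ((4 * \<kappa>) ^ DIM('a) * R ^ DIM('a))"
    using kappa by (simp add: R_def power_divide mult_ac)
  then have "card ?S * R ^ DIM('a) \<le> (4 * \<kappa>) ^ DIM('a) * R ^ DIM('a)"
    by (subst (asm) mult_le_cancel_left_pos) (simp_all add: unit_ball_vol_pos)
  then show ?thesis using R by simp
qed

lemma star_chain:
  assumes z: "z \<in> nodes \<T>" and K: "K \<in> elements_at \<T> z" "K' \<in> elements_at \<T> z"
  obtains n where "n \<le> chain_len \<kappa> DIM('a)" "(K, K') \<in> star_rel z ^^ n"
proof -
  let ?S = "elements_at \<T> z"
  have sub: "star_rel z \<subseteq> ?S \<times> ?S" by (auto simp: star_rel_def)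
  then have fin: "finite (star_rel z)" using finite_star finite_subset by blast
  then obtain n where n: "n \<le> card (star_rel z)" "(K, K') \<in> star_rel z ^^ n"
    using star_connected[OF assms] by (auto simp: rtrancl_finite_eq_relpow)
  have "card (star_rel z) \<le> card ?S * card ?S"
    using card_mono[OF _ sub] finite_star by (simp add: card_cartesian_product)
  then have "real (card (star_rel z)) \<le> (real (card ?S))\<^sup>2" by (simp add: power2_eq_square flip: of_nat_mult)
  also have "\<dots> \<le> ((4 * \<kappa>) ^ DIM('a))\<^sup>2" using card_star[OF z] by (intro power_mono) auto
  finally have "card (star_rel z) \<le> chain_len \<kappa> DIM('a)" unfolding chain_len_def by linarith
  then show ?thesis using n that by (meson order_trans)
qed

end

section \<open>Efficiency of the estimator\<close>

lemma L2_continuous_on_compact: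
  fixes f :: "'a::euclidean_space \<Rightarrow> 'b::euclidean_space"
  assumes "continuous_on K f" "compact K"
  shows "f \<in> L2 K"
proof -
  have K: "K \<in> sets lebesgue" using assms(2) by (simp add: lmeasurable_compact fmeasurableD)
  have m: "f \<in> borel_measurable (lebesgue_on K)"
    by (rule continuous_imp_measurable_on_sets_lebesgue[OF assms(1) K])
  obtain B where B: "\<And>x. x \<in> K \<Longrightarrow> norm (f x) \<le> B"
    using compact_imp_bounded[OF compact_continuous_image[OF assms]] by (auto simp: bounded_iff)
  have "(\<lambda>x. (norm (f x))\<^sup>2) integrable_on K"
  proof (rule measurable_bounded_by_integrable_imp_integrable[OF _ _ _ K])
    show "(\<lambda>x. (norm (f x))\<^sup>2) \<in> borel_measurable (lebesgue_on K)" using m by measurable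
    show "(\<lambda>x. B\<^sup>2) integrable_on K" using assms(2) by (intro integrable_on_const lmeasurable_compact)
    show "norm ((norm (f x))\<^sup>2) \<le> B\<^sup>2" if "x \<in> K" for x
      using B[OF that] by (simp add: power_mono)
  qed
  then show ?thesis using m by (simp only: L2_iff[OF K])
qed

text \<open>The squared number of links times the bound for one squared jump. The 2 stands for the
  two elements at a facet; the power of 2\<kappa> compares the volume scale of the first element
  with that of a later link.\<close>

definition chain_const :: "real \<Rightarrow> nat \<Rightarrow> real" where
  "chain_const \<kappa> d = (real (chain_len \<kappa> d))\<^sup>2 * (2 * jump_const \<kappa> d * ((2 * \<kappa>) ^ chain_len \<kappa> d) ^ d)"

text \<open>The last summand pays for \<open>f\<close> in the residual. The rest pays for the
  recovery, where the bracket joins the L2 deviation to the divergence.\<close>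

definition estimator_const :: "real \<Rightarrow> nat \<Rightarrow> real" where
  "estimator_const \<kappa> d = chain_const \<kappa> d * (1 + load_const \<kappa> d) * (1 + 2 * (2 * (d + 1) * \<kappa>)\<^sup>2)
     + 2 * load_const \<kappa> d"

section \<open>Jumps along chains and the resulting bound for the estimator\<close>

context fe_solution begin

lemma star_jump_bound:
  assumes z: "z \<in> nodes \<T>" and K: "K \<in> elements_at \<T> z" "K' \<in> elements_at \<T> z"
    and A: "\<And>L. L \<in> elements_at \<T> z \<Longrightarrow> (L2norm L err)\<^sup>2 + (diameter L)\<^sup>2 * (L2norm L f)\<^sup>2 \<le> A"
  shows "(norm (elem_grad uh K' - elem_grad uh K))\<^sup>2 * (unit_ball_vol DIM('a) * diameter K ^ DIM('a))
    \<le> chain_const \<kappa> DIM('a) * A"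
proof -
  define d where "d = DIM('a)"
  define v where "v = unit_ball_vol (real d)"
  have v: "v > 0" by (simp add: v_def unit_ball_vol_pos)
  define N where "N = chain_len \<kappa> d"
  define h where "h = diameter K"
  have sT: "L \<in> \<T>" if "L \<in> elements_at \<T> z" for L using that elements_at_iff[OF z] by auto
  have h: "h > 0" using diameter_pos[OF sT[OF K(1)]] by (simp add: h_def)
  have k1: "1 \<le> 2 * \<kappa>" using kappa_gt_half[OF sT[OF K(1)]] by simp
  have J0: "jump_const \<kappa> d \<ge> 0" using kappa by (simp add: jump_const_def)
  have A0: "A \<ge> 0" using A[OF K(1)] by (smt (verit) mult_nonneg_nonneg zero_le_power2)
  \<comment> \<open>One bound for every link: what \<open>jump_bound\<close> yields after the
    diameters along the chain have been compared with \<open>h\<close>.\<close>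
  define \<delta> where "\<delta> = sqrt (2 * jump_const \<kappa> d * A * ((2 * \<kappa>) ^ N) ^ d / (v * h ^ d))"
  have \<delta>: "\<delta> \<ge> 0" "\<delta>\<^sup>2 = 2 * jump_const \<kappa> d * A * ((2 * \<kappa>) ^ N) ^ d / (v * h ^ d)"
    using J0 A0 v h kappa by (simp_all add: \<delta>_def)
  have step: "norm (elem_grad uh L - elem_grad uh M) \<le> \<delta>"
    if LM: "L \<in> elements_at \<T> z" "M \<in> elements_at \<T> z" "face_adjacent L M"
      and hL: "h \<le> (2 * \<kappa>) ^ N * diameter L" "h \<le> (2 * \<kappa>) ^ N * diameter M" for L M
  proof -
    let ?\<mu> = "min (diameter L) (diameter M)"
    let ?j = "norm (elem_grad uh L - elem_grad uh M)"
    have "h \<le> (2 * \<kappa>) ^ N * ?\<mu>" using hL by (simp add: min_def)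
    then have "h ^ d \<le> ((2 * \<kappa>) ^ N * ?\<mu>) ^ d" using h by (intro power_mono) auto
    then have hd: "h ^ d \<le> ((2 * \<kappa>) ^ N) ^ d * ?\<mu> ^ d" by (simp add: power_mult_distrib)
    have "?j\<^sup>2 * (v * h ^ d) \<le> ?j\<^sup>2 * (v * (((2 * \<kappa>) ^ N) ^ d * ?\<mu> ^ d))"
      using hd v by (intro mult_left_mono) auto
    also have "\<dots> = ((2 * \<kappa>) ^ N) ^ d * (?j\<^sup>2 * (v * ?\<mu> ^ d))" by simp
    also have "\<dots> \<le> ((2 * \<kappa>) ^ N) ^ d * (jump_const \<kappa> d * (A + A))"
    proof (rule mult_left_mono)
      have "?j\<^sup>2 * (v * ?\<mu> ^ d) \<le> jump_const \<kappa> d * (((L2norm L err)\<^sup>2 + (diameter L)\<^sup>2 * (L2norm L f)\<^sup>2)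
       + ((L2norm M err)\<^sup>2 + (diameter M)\<^sup>2 * (L2norm M f)\<^sup>2))"
        using jump_bound[OF sT[OF LM(1)] sT[OF LM(2)] LM(3)] by (simp add: v_def d_def)
      also have "\<dots> \<le> jump_const \<kappa> d * (A + A)"
        using A[OF LM(1)] A[OF LM(2)] J0 by (intro mult_left_mono add_mono)
      finally show "?j\<^sup>2 * (v * ?\<mu> ^ d) \<le> jump_const \<kappa> d * (A + A)" .
    qed (use kappa in simp)
    finally have "?j\<^sup>2 * (v * h ^ d) \<le> 2 * jump_const \<kappa> d * A * ((2 * \<kappa>) ^ N) ^ d"
      by (simp add: algebra_simps)
    then have "?j\<^sup>2 \<le> \<delta>\<^sup>2" using v h unfolding \<delta>(2) by (simp add: pos_le_divide_eq)
    then show ?thesis using \<delta>(1) by (rule power2_le_imp_le)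
  qed
  \<comment> \<open>The diameter bound travels with the induction because \<open>step\<close> needs
    it at the next link.\<close>
  have chain: "L \<in> elements_at \<T> z \<and> h \<le> (2 * \<kappa>) ^ n * diameter L \<and> norm (elem_grad uh L - elem_grad uh K) \<le> n * \<delta>"
    if "n \<le> N" "(K, L) \<in> star_rel z ^^ n" for n L
    using that
  proof (induction n arbitrary: L)
    case 0
    then show ?case using K(1) by (simp add: h_def)
  next
    case (Suc n)
    obtain M where M: "(K, M) \<in> star_rel z ^^ n" "(M, L) \<in> star_rel z" using Suc.prems(2) by auto
    note IH = Suc.IH[OF Suc_leD[OF Suc.prems(1)] M(1)]
    have adj: "M \<in> elements_at \<T> z" "L \<in> elements_at \<T> z" "face_adjacent M L" using M(2) by (auto simp: star_rel_def)
    have "diameter M \<le> 2 * \<kappa> * diameter L" by (rule face_adjacent_diameter[OF sT[OF adj(1)] sT[OF adj(2)] adj(3)])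
    then have "(2 * \<kappa>) ^ n * diameter M \<le> (2 * \<kappa>) ^ n * (2 * \<kappa> * diameter L)"
      using kappa by (intro mult_left_mono) auto
    then have hL: "h \<le> (2 * \<kappa>) ^ Suc n * diameter L" using IH by (simp add: mult_ac)
    have up: "h \<le> (2 * \<kappa>) ^ N * diameter Q" if "Q \<in> \<T>" "h \<le> (2 * \<kappa>) ^ k * diameter Q" "k \<le> N" for Q k
    proof -
      have "(2 * \<kappa>) ^ k * diameter Q \<le> (2 * \<kappa>) ^ N * diameter Q"
        using k1 that(3) diameter_pos[OF that(1)] by (intro mult_right_mono power_increasing) auto
      then show ?thesis using that(2) by linarith
    qed
    have "norm (elem_grad uh M - elem_grad uh L) \<le> \<delta>"
      by (rule step[OF adj up[OF sT[OF adj(1)], of n] up[OF sT[OF adj(2)] hL]]) (use IH Suc.prems(1) in auto)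
    then have "norm (elem_grad uh L - elem_grad uh M) \<le> \<delta>" by (simp add: norm_minus_commute)
    moreover have "norm (elem_grad uh L - elem_grad uh K)
        \<le> norm (elem_grad uh L - elem_grad uh M) + norm (elem_grad uh M - elem_grad uh K)"
      using norm_triangle_ineq[of "elem_grad uh L - elem_grad uh M" "elem_grad uh M - elem_grad uh K"] by simp
    ultimately have "norm (elem_grad uh L - elem_grad uh K) \<le> real (Suc n) * \<delta>"
      using IH by (simp add: distrib_right)
    with hL adj(2) show ?case by blast
  qed
  obtain n where n: "n \<le> N" "(K, K') \<in> star_rel z ^^ n"
    using star_chain[OF z K] unfolding N_def d_def by blast
  have "norm (elem_grad uh K' - elem_grad uh K) \<le> n * \<delta>" using chain[OF n] by blast
  also have "\<dots> \<le> N * \<delta>" using n(1) \<delta>(1) by (intro mult_right_mono) auto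
  finally have "(norm (elem_grad uh K' - elem_grad uh K))\<^sup>2 \<le> (N * \<delta>)\<^sup>2" by (intro power_mono) auto
  then have "(norm (elem_grad uh K' - elem_grad uh K))\<^sup>2 * (v * h ^ d) \<le> (N * \<delta>)\<^sup>2 * (v * h ^ d)"
    using v h by (intro mult_right_mono) auto
  also have "\<dots> = N\<^sup>2 * (\<delta>\<^sup>2 * (v * h ^ d))" by (simp add: power_mult_distrib)
  also have "\<delta>\<^sup>2 * (v * h ^ d) = 2 * jump_const \<kappa> d * A * ((2 * \<kappa>) ^ N) ^ d"
    using v h unfolding \<delta>(2) by simp
  finally show ?thesis
    by (simp add: chain_const_def v_def d_def N_def h_def mult_ac)
qed

text \<open>Basis functions of nodes outside \<open>K\<close> vanish on \<open>K\<close>: they are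
  affine there and zero at all its vertices.\<close>

lemma basis_expansion:
  assumes K: "K \<in> \<T>" and x: "x \<in> K"
  shows "(\<Sum>z\<in>nodes \<T>. \<phi> z x *\<^sub>R (g z :: 'a)) = (\<Sum>z\<in>verts K. lam \<phi> K z x *\<^sub>R g z)"
proof -
  have fin: "finite (nodes \<T>)"
  proof -
    have "nodes \<T> = (\<Union>K\<in>\<T>. verts K)" by (auto simp: nodes_def verts_def)
    then show ?thesis using finite_mesh elem_verts(2) by simp
  qed
  have sub: "verts K \<subseteq> nodes \<T>" using verts_nodes[OF K] by blast
  have zero: "\<phi> z x = 0" if z: "z \<in> nodes \<T> - verts K" for z
  proof -
    obtain a c where ac: "\<And>x. x \<in> K \<Longrightarrow> \<phi> z x = a \<bullet> x + c" using basis_affine[OF K] z by blast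
    have "a \<bullet> y + c = 0" if "y \<in> verts K" for y
    proof -
      have "\<phi> z y = 0" using basis z that sub unfolding nodal_basis_def by force
      then show ?thesis using ac[of y] that elem_verts(5)[OF K] by auto
    qed
    then show ?thesis using ac[OF x] affine_expansion[OF K, of a x c] by simp
  qed
  have "(\<Sum>z\<in>nodes \<T>. \<phi> z x *\<^sub>R g z) = (\<Sum>z\<in>verts K. \<phi> z x *\<^sub>R g z)"
    using fin sub zero by (intro sum.mono_neutral_right) auto
  also have "\<dots> = (\<Sum>z\<in>verts K. lam \<phi> K z x *\<^sub>R g z)"
    using lam_eq_basis[OF K _ x] by (intro sum.cong) auto
  finally show ?thesis .
qed

text \<open>On \<open>K\<close> the field is the constant \<open>elem_grad uh K\<close> plus an
  affine field with nodal values of size at most \<open>\<Delta>\<close>. Convexity bounds that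
  field by \<open>\<Delta>\<close>. The constant has no divergence, and
  \<open>norm_grad_basis\<close> at the d + 1 vertices bounds the remaining one by a multiple of
  \<open>\<Delta>\<close> over the diameter, which the weight cancels.\<close>

lemma recovery_bound:
  assumes K: "K \<in> \<T>" and \<Delta>: "\<And>z. z \<in> verts K \<Longrightarrow> norm (g z - elem_grad uh K) \<le> \<Delta>" "\<Delta> \<ge> 0"
    and G: "\<And>x. G x = (\<Sum>z\<in>nodes \<T>. \<phi> z x *\<^sub>R (g z :: 'a))"
  shows "eta_sq f G uh K \<le> \<Delta>\<^sup>2 * (unit_ball_vol DIM('a) * diameter K ^ DIM('a)) * (1 + 2 * (2 * (DIM('a) + 1) * \<kappa>)\<^sup>2)
     + 2 * ((diameter K)\<^sup>2 * (L2norm K f)\<^sup>2)"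
proof -
  define h where "h = diameter K"
  have h: "h > 0" using diameter_pos[OF K] by (simp add: h_def)
  define gK where "gK = elem_grad uh K"
  define D where "D z = g z - gK" for z
  note Kp = elem_props[OF K]
  note N = elem_interior(2)[OF K]
  have fV: "finite (verts K)" by (rule elem_verts(2)[OF K])
  define P where "P x = (\<Sum>z\<in>verts K. lam \<phi> K z x *\<^sub>R D z)" for x
  have GP: "G x = gK + P x" if "x \<in> K" for x
  proof -
    have "G x = (\<Sum>z\<in>verts K. lam \<phi> K z x *\<^sub>R gK + lam \<phi> K z x *\<^sub>R D z)"
      unfolding G basis_expansion[OF K that] D_def by (simp add: scaleR_diff_right)
    also have "\<dots> = (\<Sum>z\<in>verts K. lam \<phi> K z x) *\<^sub>R gK + P x"
      by (simp add: sum.distrib scaleR_sum_left P_def)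
    finally show ?thesis by (simp add: lam_repr(2)[OF K])
  qed
  have cP: "continuous_on K P" unfolding P_def lam_def by (intro continuous_intros)
  have P2: "P \<in> L2 K" by (rule L2_continuous_on_compact[OF cP Kp(2)])
  have Pb: "norm (P x) \<le> \<Delta>" if "x \<in> K" for x
  proof -
    have "norm (P x) \<le> (\<Sum>z\<in>verts K. norm (lam \<phi> K z x *\<^sub>R D z))" unfolding P_def by (rule norm_sum)
    also have "\<dots> \<le> (\<Sum>z\<in>verts K. lam \<phi> K z x * \<Delta>)"
    proof (rule sum_mono)
      fix z assume z: "z \<in> verts K"
      have "\<bar>lam \<phi> K z x\<bar> = lam \<phi> K z x" using lam_range(1)[OF K z that] by simp
      then show "norm (lam \<phi> K z x *\<^sub>R D z) \<le> lam \<phi> K z x * \<Delta>"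
        using \<Delta>(1)[OF z] lam_range(1)[OF K z that] by (simp add: D_def gK_def mult_left_mono)
    qed
    also have "\<dots> = \<Delta>" by (simp add: sum_distrib_right[symmetric] lam_repr(2)[OF K])
    finally show ?thesis .
  qed
  have "L2norm K (\<lambda>x. G x - grad uh x) = L2norm K P"
  proof (rule L2_spike(2)[OF P2 Kp(6) N])
    fix x assume "x \<in> K - (K - interior K)"
    then show "G x - grad uh x = P x" by (simp add: GP grad_uh[OF K] gK_def)
  qed
  then have 1: "(L2norm K (\<lambda>x. G x - grad uh x))\<^sup>2 \<le> \<Delta>\<^sup>2 * measure lebesgue K"
    using L2norm_le_const[OF P2 Kp(5) N, of \<Delta>] Pb by simp
  define s where "s = (\<Sum>b\<in>Basis. (\<Sum>z\<in>verts K. (D z \<bullet> b) *\<^sub>R elem_grad (\<phi> z) K) \<bullet> b)"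
  have div: "divergence G x = s" if x: "x \<in> interior K" for x
    unfolding divergence_def s_def
  proof (rule sum.cong[OF refl])
    fix b :: 'a
    let ?a = "\<Sum>z\<in>verts K. (D z \<bullet> b) *\<^sub>R elem_grad (\<phi> z) K"
    let ?c = "gK \<bullet> b + (\<Sum>z\<in>verts K. (D z \<bullet> b) * (1 - elem_grad (\<phi> z) K \<bullet> z))"
    have "grad (\<lambda>y. G y \<bullet> b) x = ?a"
    proof (rule grad_eqI[OF GDERIV_elem[OF _ x]])
      fix y assume "y \<in> K"
      then show "G y \<bullet> b = ?a \<bullet> y + ?c"
        by (simp add: GP P_def inner_add_left inner_sum_left lam_def inner_diff_right algebra_simps
            sum.distrib sum_subtractf)
    qed
    then show "grad (\<lambda>y. G y \<bullet> b) x \<bullet> b = ?a \<bullet> b" by simp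
  qed
  \<comment> \<open>The trace: swapping the sums turns the sum over coordinates into inner
    products.\<close>
  have "s = (\<Sum>z\<in>verts K. D z \<bullet> elem_grad (\<phi> z) K)"
    unfolding s_def inner_sum_left inner_scaleR_left
    by (subst sum.swap) (intro sum.cong refl euclidean_inner[symmetric])
  then have "\<bar>s\<bar> \<le> (\<Sum>z\<in>verts K. \<bar>D z \<bullet> elem_grad (\<phi> z) K\<bar>)" by (simp add: sum_abs)
  also have "\<dots> \<le> (\<Sum>z\<in>verts K. \<Delta> * (2 * \<kappa> / h))"
  proof (rule sum_mono)
    fix z assume z: "z \<in> verts K"
    have "\<bar>D z \<bullet> elem_grad (\<phi> z) K\<bar> \<le> norm (D z) * norm (elem_grad (\<phi> z) K)" by (rule Cauchy_Schwarz_ineq2)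
    also have "\<dots> \<le> \<Delta> * (2 * \<kappa> / h)"
      using \<Delta>(1)[OF z] \<Delta>(2) norm_grad_basis[OF K z] by (intro mult_mono) (auto simp: D_def gK_def h_def)
    finally show "\<bar>D z \<bullet> elem_grad (\<phi> z) K\<bar> \<le> \<Delta> * (2 * \<kappa> / h)" .
  qed
  also have "\<dots> = 2 * (DIM('a) + 1) * \<kappa> * \<Delta> / h" by (simp add: elem_verts(3)[OF K])
  finally have sb: "\<bar>s\<bar> \<le> 2 * (DIM('a) + 1) * \<kappa> * \<Delta> / h" .
  have cs: "(\<lambda>x. s) \<in> L2 K" by (rule L2_const[OF Kp(5)])
  have dd: "divergence G \<in> L2 K" "L2norm K (divergence G) = L2norm K (\<lambda>x. s)"
    by (rule L2_spike[OF cs Kp(6) N]; simp add: div)+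
  have "(L2norm K (divergence G))\<^sup>2 \<le> s\<^sup>2 * measure lebesgue K"
    using L2norm_le_const[OF cs Kp(5) negligible_empty, of "\<bar>s\<bar>"] dd(2) by simp
  also have "\<dots> \<le> (2 * (DIM('a) + 1) * \<kappa> * \<Delta> / h)\<^sup>2 * measure lebesgue K"
  proof (rule mult_right_mono)
    show "s\<^sup>2 \<le> (2 * (DIM('a) + 1) * \<kappa> * \<Delta> / h)\<^sup>2"
      using power_mono[OF sb, of 2] by simp
  qed simp
  finally have "h\<^sup>2 * (L2norm K (divergence G))\<^sup>2 \<le> h\<^sup>2 * ((2 * (DIM('a) + 1) * \<kappa> * \<Delta> / h)\<^sup>2 * measure lebesgue K)"
    by (rule mult_left_mono) simp
  also have "\<dots> = (2 * (DIM('a) + 1) * \<kappa>)\<^sup>2 * (\<Delta>\<^sup>2 * measure lebesgue K)"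
    using h by (simp add: power_mult_distrib power_divide)
  finally have 2: "h\<^sup>2 * (L2norm K (divergence G))\<^sup>2 \<le> \<dots>" .
  have "h\<^sup>2 * (L2norm K (\<lambda>x. f x + divergence G x))\<^sup>2 \<le> h\<^sup>2 * (2 * (L2norm K f)\<^sup>2 + 2 * (L2norm K (divergence G))\<^sup>2)"
    using L2_add(2)[OF f_L2[OF K] dd(1) Kp(6)] by (intro mult_left_mono) auto
  also have "\<dots> = 2 * (h\<^sup>2 * (L2norm K f)\<^sup>2) + 2 * (h\<^sup>2 * (L2norm K (divergence G))\<^sup>2)" by (simp add: algebra_simps)
  also have "\<dots> \<le> 2 * (h\<^sup>2 * (L2norm K f)\<^sup>2) + 2 * ((2 * (DIM('a) + 1) * \<kappa>)\<^sup>2 * (\<Delta>\<^sup>2 * measure lebesgue K))"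
    using 2 by linarith
  finally have "eta_sq f G uh K \<le> \<Delta>\<^sup>2 * measure lebesgue K * (1 + 2 * (2 * (DIM('a) + 1) * \<kappa>)\<^sup>2) + 2 * (h\<^sup>2 * (L2norm K f)\<^sup>2)"
    using 1 unfolding eta_sq_def h_def[symmetric] by (simp add: algebra_simps)
  also have "\<dots> \<le> \<Delta>\<^sup>2 * (unit_ball_vol DIM('a) * h ^ DIM('a)) * (1 + 2 * (2 * (DIM('a) + 1) * \<kappa>)\<^sup>2) + 2 * (h\<^sup>2 * (L2norm K f)\<^sup>2)"
    using measure_elem_le[OF K] by (intro add_right_mono mult_right_mono mult_left_mono) (auto simp: h_def)
  finally show ?thesis by (simp only: h_def)
qed

text \<open>Locality comes from the stars: every element at a vertex of \<open>K\<close> meets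
  \<open>K\<close>, so all elements on the chains lie in the patch and their loads are bounded by
  the one quantity \<open>A\<close>.\<close>

lemma estimator_efficiency:
  assumes K: "K \<in> \<T>" and \<alpha>: "recovery_weights \<T> \<alpha>"
  shows "eta_sq f (recovered_gradient \<T> \<phi> \<alpha> uh) uh K \<le> estimator_const \<kappa> DIM('a) *
    ((L2norm (patch \<T> K) err)\<^sup>2 +
     (\<Sum>K'\<in>{K'\<in>\<T>. K' \<subseteq> patch \<T> K}. (diameter K')\<^sup>2 * (L2norm K' (\<lambda>x. f x - elem_mean f K'))\<^sup>2))"
proof -
  define d where "d = DIM('a)"
  let ?osc = "\<lambda>K'. (diameter K')\<^sup>2 * (L2norm K' (\<lambda>x. f x - elem_mean f K'))\<^sup>2"
  define A where "A = (L2norm (patch \<T> K) err)\<^sup>2 + (\<Sum>K'\<in>{K'\<in>\<T>. K' \<subseteq> patch \<T> K}. ?osc K')"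
  define Q where "Q = {L \<in> \<T>. L \<inter> K \<noteq> {}}"
  have fQ: "finite Q" using finite_mesh by (simp add: Q_def)
  have patchQ: "patch \<T> K = \<Union>Q" by (simp add: patch_def Q_def)
  have QT: "L \<in> \<T>" if "L \<in> Q" for L using that by (simp add: Q_def)
  have pm: "patch \<T> K \<in> sets lebesgue"
    unfolding patchQ using fQ QT elem_props(6) by (intro sets.finite_Union) auto
  have pe: "err \<in> L2 (patch \<T> K)"
    unfolding patchQ by (rule L2_Union[OF fQ err_L2[OF QT] elem_props(6)[OF QT]])
  have lc: "load_const \<kappa> d \<ge> 0" using kappa by (simp add: load_const_def)
  have A_load: "(diameter L)\<^sup>2 * (L2norm L f)\<^sup>2 \<le> load_const \<kappa> d * A \<and> (L2norm L err)\<^sup>2 \<le> A" if L: "L \<in> Q" for L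
  proof -
    have sub: "L \<subseteq> patch \<T> K" using L patchQ by blast
    have e: "(L2norm L err)\<^sup>2 \<le> (L2norm (patch \<T> K) err)\<^sup>2"
      by (rule L2norm_mono[OF pe sub pm elem_props(6)[OF QT[OF L]]])
    have o: "?osc L \<le> (\<Sum>K'\<in>{K'\<in>\<T>. K' \<subseteq> patch \<T> K}. ?osc K')"
      using finite_mesh sub QT[OF L] by (intro member_le_sum) auto
    have "(diameter L)\<^sup>2 * (L2norm L f)\<^sup>2 \<le> load_const \<kappa> d * ((L2norm L err)\<^sup>2 + ?osc L)"
      unfolding d_def by (rule element_load_bound[OF QT[OF L]])
    also have "\<dots> \<le> load_const \<kappa> d * A" unfolding A_def using e o lc by (intro mult_left_mono add_mono)
    finally have "(diameter L)\<^sup>2 * (L2norm L f)\<^sup>2 \<le> load_const \<kappa> d * A" .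
    moreover have "(L2norm L err)\<^sup>2 \<le> A"
    proof -
      have "0 \<le> ?osc L" by simp
      then show ?thesis using e o unfolding A_def by linarith
    qed
    ultimately show ?thesis by blast
  qed
  define v where "v = unit_ball_vol (real d) * diameter K ^ d"
  have v: "v > 0" using diameter_pos[OF K] by (simp add: v_def unit_ball_vol_pos)
  define B where "B = chain_const \<kappa> d * ((1 + load_const \<kappa> d) * A)"
  have KQ: "K \<in> Q" using K elem_interior(1)[OF K] interior_subset by (auto simp: Q_def)
  have "0 \<le> (L2norm K err)\<^sup>2" by simp
  then have A0: "A \<ge> 0" using A_load[OF KQ] by linarith
  have B0: "B \<ge> 0" using A0 lc kappa by (simp add: B_def chain_const_def jump_const_def)
  \<comment> \<open>\<open>star_jump_bound\<close> bounds a squared jump times the volume scale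
    \<open>v\<close> by \<open>B\<close>; dividing by \<open>v\<close> turns this into a bound on
    the gradients themselves.\<close>
  define \<Delta> where "\<Delta> = sqrt (B / v)"
  have \<Delta>: "\<Delta> \<ge> 0" "\<Delta>\<^sup>2 * v = B" using B0 v by (simp_all add: \<Delta>_def)
  define g where "g z = (\<Sum>L\<in>elements_at \<T> z. \<alpha> z L *\<^sub>R elem_grad uh L)" for z
  have gz: "norm (g z - elem_grad uh K) \<le> \<Delta>" if z: "z \<in> verts K" for z
  proof -
    have zn: "z \<in> nodes \<T>" by (rule verts_nodes[OF K z])
    have zK: "z \<in> K" using z elem_verts(5)[OF K] by blast
    have KS: "K \<in> elements_at \<T> z" using elements_at_iff[OF zn] K zK by blast
    have SQ: "L \<in> Q" if "L \<in> elements_at \<T> z" for L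
      using that elements_at_iff[OF zn] zK by (auto simp: Q_def)
    have \<alpha>0: "\<And>L. L \<in> elements_at \<T> z \<Longrightarrow> 0 \<le> \<alpha> z L" and \<alpha>1: "(\<Sum>L\<in>elements_at \<T> z. \<alpha> z L) = 1"
      using \<alpha> zn by (auto simp: recovery_weights_def)
    have jump: "norm (elem_grad uh L - elem_grad uh K) \<le> \<Delta>" if L: "L \<in> elements_at \<T> z" for L
    proof -
      have "(norm (elem_grad uh L - elem_grad uh K))\<^sup>2 * v \<le> B"
        unfolding v_def B_def d_def
      proof (rule star_jump_bound[OF zn KS L])
        fix M assume "M \<in> elements_at \<T> z"
        then show "(L2norm M err)\<^sup>2 + (diameter M)\<^sup>2 * (L2norm M f)\<^sup>2 \<le> (1 + load_const \<kappa> DIM('a)) * A"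
          using A_load[OF SQ] by (simp add: distrib_right d_def add_mono)
      qed
      then have "(norm (elem_grad uh L - elem_grad uh K))\<^sup>2 \<le> \<Delta>\<^sup>2"
        using \<Delta>(2) v by (metis mult_le_cancel_right_pos)
      then show ?thesis using \<Delta>(1) by (rule power2_le_imp_le)
    qed
    have "g z - elem_grad uh K = (\<Sum>L\<in>elements_at \<T> z. \<alpha> z L *\<^sub>R (elem_grad uh L - elem_grad uh K))"
      by (simp add: g_def scaleR_diff_right sum_subtractf scaleR_sum_left[symmetric] \<alpha>1)
    also have "norm \<dots> \<le> (\<Sum>L\<in>elements_at \<T> z. norm (\<alpha> z L *\<^sub>R (elem_grad uh L - elem_grad uh K)))"
      by (rule norm_sum)
    also have "\<dots> \<le> (\<Sum>L\<in>elements_at \<T> z. \<alpha> z L * \<Delta>)"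
      using \<alpha>0 jump by (intro sum_mono) (simp add: mult_left_mono)
    also have "\<dots> = \<Delta>" by (simp add: sum_distrib_right[symmetric] \<alpha>1)
    finally show ?thesis .
  qed
  have "eta_sq f (recovered_gradient \<T> \<phi> \<alpha> uh) uh K \<le> \<Delta>\<^sup>2 * v * (1 + 2 * (2 * (d + 1) * \<kappa>)\<^sup>2)
     + 2 * ((diameter K)\<^sup>2 * (L2norm K f)\<^sup>2)"
    unfolding v_def d_def
    by (rule recovery_bound[OF K gz \<Delta>(1)]) (simp_all add: recovered_gradient_def g_def)
  also have "\<dots> \<le> B * (1 + 2 * (2 * (d + 1) * \<kappa>)\<^sup>2) + 2 * (load_const \<kappa> d * A)"
    using A_load[OF KQ] by (simp add: \<Delta>(2))
  also have "\<dots> = estimator_const \<kappa> d * A"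
    by (simp add: estimator_const_def B_def algebra_simps)
  finally show ?thesis unfolding A_def d_def .
qed

end

text \<open>The witness is built from \<open>\<kappa>\<close> and the dimension alone, so it serves
  all meshes, data and weights at once.\<close>

theorem theorem3p2:
  fixes \<Omega> :: "'a::euclidean_space set" and \<kappa> :: real
  assumes "DIM('a) = 2 \<or> DIM('a) = 3"
    and "polyhedral_domain \<Omega>"
    and "\<kappa> > 0"
  shows "\<exists>C>0. \<forall>\<T> \<phi> \<alpha> f u gu uh.
           conforming_mesh \<Omega> \<T> \<and> shape_regular \<kappa> \<T> \<and>
           nodal_basis \<Omega> \<T> \<phi> \<and> recovery_weights \<T> \<alpha> \<and>
           f \<in> L2 \<Omega> \<and> poisson_weak_solution \<Omega> f u \<and> has_weak_gradient \<Omega> u gu \<and>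
           galerkin_solution \<Omega> \<T> f uh \<longrightarrow>
           (\<forall>K\<in>\<T>.
              eta_sq f (recovered_gradient \<T> \<phi> \<alpha> uh) uh K
              \<le> C * ((L2norm (patch \<T> K) (\<lambda>x. gu x - grad uh x))\<^sup>2 +
                     (\<Sum>K'\<in>{K'\<in>\<T>. K' \<subseteq> patch \<T> K}.
                        (diameter K')\<^sup>2 * (L2norm K' (\<lambda>x. f x - elem_mean f K'))\<^sup>2)))"
proof (intro exI[of _ "estimator_const \<kappa> DIM('a)"] conjI allI impI ballI)
  \<comment> \<open>Strict positivity is drawn from the load term; for the chain term nonnegativity
    suffices.\<close>
  have "load_const \<kappa> DIM('a) > 0"
    using assms(3) unfolding load_const_def by (intro add_pos_nonneg) auto
  moreover have "chain_const \<kappa> DIM('a) \<ge> 0"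
    using assms(3) by (simp add: chain_const_def jump_const_def)
  ultimately show "estimator_const \<kappa> DIM('a) > 0"
    unfolding estimator_const_def by (intro add_nonneg_pos mult_nonneg_nonneg) auto
next
  fix \<T> \<phi> \<alpha> f u gu uh K
  assume *: "conforming_mesh \<Omega> \<T> \<and> shape_regular \<kappa> \<T> \<and>
           nodal_basis \<Omega> \<T> \<phi> \<and> recovery_weights \<T> \<alpha> \<and>
           f \<in> L2 \<Omega> \<and> poisson_weak_solution \<Omega> f u \<and> has_weak_gradient \<Omega> u gu \<and>
           galerkin_solution \<Omega> \<T> f uh" and K: "K \<in> \<T>"
  interpret fe_solution \<Omega> \<T> \<phi> \<kappa> f u gu uh
    using * assms by unfold_locales (auto simp: galerkin_solution_def Vh0_def)
  show "eta_sq f (recovered_gradient \<T> \<phi> \<alpha> uh) uh K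
              \<le> estimator_const \<kappa> DIM('a) * ((L2norm (patch \<T> K) (\<lambda>x. gu x - grad uh x))\<^sup>2 +
                     (\<Sum>K'\<in>{K'\<in>\<T>. K' \<subseteq> patch \<T> K}.
                        (diameter K')\<^sup>2 * (L2norm K' (\<lambda>x. f x - elem_mean f K'))\<^sup>2))"
    using estimator_efficiency[OF K] * by blast
qed

end
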